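(* Let $G$ be the $xy$-sum of connected graphs $G_1,G_2\in\mathcal{G}^\circ_{xy}$. The subgraph $G_1$ is $\widehat{g}^+$-tight in $G$ if and only if $G_1\in\mathcal{C}^\circ(\widehat{g}^+)$.
   Context: All graphs are finite and simple. The Euler genus $\widehat{g}(G)$ is the minimum Euler genus of a surface in which $G$ embeds. $\mathcal{G}_{xy}$ is the class of graphs with two distinguished vertices $x,y$ (terminals). The set $\mathcal{M}(G)$ of minor-operations consists of deleting any edge, or contracting any edge other than $xy$ (a vertex obtained by contracting an edge incident with a terminal becomes a terminal; parallel edges are removed); $\mu G$ is the result of $\mu\in\mathcal{M}(G)$. $\mathcal{G}^\circ_{xy}$ is the subclass of graphs not containing the edge $xy$. $G^+$ is $G$ with the edge $xy$ added (if absent); $\widehat{g}^+(G)=\widehat{g}(G^+)$. For $G_1,G_2\in\mathcal{G}_{xy}$ with $V(G_1)\cap V(G_2)=\{x,y\}$, their $xy$-sum is $(V(G_1)\cup V(G_2),E(G_1)\cup E(G_2))$. A subgraph $H$ of $G$ is $\widehat{g}^+$-tight if $\widehat{g}^+(\mu G)<\widehat{g}^+(G)$ for every $\mu\in\mathcal{M}(H)$. $\mathcal{C}^\circ(\widehat{g}^+)$ is the class of $G\in\mathcal{G}^\circ_{xy}$ with $\widehat{g}^+(\mu G)<\widehat{g}^+(G)$ for every $\mu\in\mathcal{M}(G)$. *)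

theory Defs
  imports "Graph_Theory.Digraph_Component" "HOL-Combinatorics.Permutations" "HOL-Combinatorics.Orbits"
begin

text \<open>
  A finite simple graph is a \<^locale>\<open>pair_graph\<close>; an undirected edge is
  represented by its two opposite arcs.
\<close>

section \<open>Surfaces and the Euler genus\<close>

text \<open>
  The libraries contain no theory of surfaces, so a closed surface is given combinatorially
  (Heffter, Edmonds, Ringel; see Mohar and Thomassen, Graphs on Surfaces, Chapter 3): by a finite
  connected graph \<open>H\<close> with a rotation system \<open>\<pi>\<close> and a signature.  Every closed surface has such a
  cell decomposition, and conversely pasting a disc along each facial walk of
  \<open>(H, \<pi>, tw)\<close> yields a closed surface.  The map \<open>\<pi>\<close> acts on the arcs and permutes the arcs leaving
  each vertex cyclically; \<open>tw e\<close> holds when the edge \<open>e\<close> has signature \<open>-1\<close>.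
\<close>

definition rotation_system :: "'a pair_pre_digraph \<Rightarrow> ('a \<times> 'a \<Rightarrow> 'a \<times> 'a) \<Rightarrow> bool" where
  "rotation_system H \<pi> \<longleftrightarrow> \<pi> permutes parcs H \<and>
     (\<forall>v\<in>pverts H. out_arcs (with_proj H) v \<noteq> {} \<longrightarrow> cyclic_on \<pi> (out_arcs (with_proj H) v))"

definition edge_signature :: "'a pair_pre_digraph \<Rightarrow> ('a \<times> 'a \<Rightarrow> bool) \<Rightarrow> bool" where
  "edge_signature H tw \<longleftrightarrow> (\<forall>(u, v)\<in>parcs H. tw (u, v) = tw (v, u))"

definition comb_surface ::
  "'a pair_pre_digraph \<Rightarrow> ('a \<times> 'a \<Rightarrow> 'a \<times> 'a) \<Rightarrow> ('a \<times> 'a \<Rightarrow> bool) \<Rightarrow> bool" where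
  "comb_surface H \<pi> tw \<longleftrightarrow> pair_graph H \<and> Digraph_Component.connected (with_proj H) \<and>
     rotation_system H \<pi> \<and> edge_signature H tw"

text \<open>
  Face traversal.  A state \<open>((u, v), s)\<close> means: about to traverse the edge \<open>uv\<close> from \<open>u\<close> to \<open>v\<close>,
  using the rotation \<open>\<pi>\<close> if \<open>s\<close> holds and its inverse otherwise.  Traversing an edge
  of signature \<open>-1\<close> flips \<open>s\<close>; the walk then continues with the successor (or predecessor) of
  \<open>(v, u)\<close> in the rotation at \<open>v\<close>.
\<close>

definition face_step ::
  "('a \<times> 'a \<Rightarrow> 'a \<times> 'a) \<Rightarrow> ('a \<times> 'a \<Rightarrow> bool) \<Rightarrow> ('a \<times> 'a) \<times> bool \<Rightarrow> ('a \<times> 'a) \<times> bool" where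
  "face_step \<pi> tw = (\<lambda>(e, s). let s' = (s \<noteq> tw e) in
     (if s' then \<pi> (prod.swap e) else inv \<pi> (prod.swap e), s'))"

text \<open>The state traversing the same side of the same edge in the opposite direction.\<close>

definition face_reverse :: "('a \<times> 'a \<Rightarrow> bool) \<Rightarrow> ('a \<times> 'a) \<times> bool \<Rightarrow> ('a \<times> 'a) \<times> bool" where
  "face_reverse tw = (\<lambda>(e, s). (prod.swap e, \<not> (s \<noteq> tw e)))"

text \<open>A facial walk and its reverse are the same face.\<close>

definition faces ::
  "'a pair_pre_digraph \<Rightarrow> ('a \<times> 'a \<Rightarrow> 'a \<times> 'a) \<Rightarrow> ('a \<times> 'a \<Rightarrow> bool) \<Rightarrow> (('a \<times> 'a) \<times> bool) set set" where
  "faces H \<pi> tw =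
     (\<lambda>p. orbit (face_step \<pi> tw) p \<union> orbit (face_step \<pi> tw) (face_reverse tw p)) ` (parcs H \<times> UNIV)"

text \<open>A connected graph without edges is a single vertex; on the sphere it has one face.\<close>

definition num_faces ::
  "'a pair_pre_digraph \<Rightarrow> ('a \<times> 'a \<Rightarrow> 'a \<times> 'a) \<Rightarrow> ('a \<times> 'a \<Rightarrow> bool) \<Rightarrow> nat" where
  "num_faces H \<pi> tw = (if parcs H = {} then 1 else card (faces H \<pi> tw))"

definition surface_euler_char ::
  "'a pair_pre_digraph \<Rightarrow> ('a \<times> 'a \<Rightarrow> 'a \<times> 'a) \<Rightarrow> ('a \<times> 'a \<Rightarrow> bool) \<Rightarrow> int" where
  "surface_euler_char H \<pi> tw =
     int (card (pverts H)) - int (card (parcs H) div 2) + int (num_faces H \<pi> tw)"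

definition surface_euler_genus ::
  "'a pair_pre_digraph \<Rightarrow> ('a \<times> 'a \<Rightarrow> 'a \<times> 'a) \<Rightarrow> ('a \<times> 'a \<Rightarrow> bool) \<Rightarrow> int" where
  "surface_euler_genus H \<pi> tw = 2 - surface_euler_char H \<pi> tw"

text \<open>
  A graph embedded in a surface, cellularly or not, can be extended by further vertices and edges
  to a connected simple graph all of whose faces are discs.  So \<open>G\<close> embeds in a surface of Euler
  genus \<open>k\<close> iff it is isomorphic to a subgraph of the graph \<open>H\<close> of some cell decomposition of a
  surface of Euler genus \<open>k\<close>.  In particular \<open>G\<close> need not be connected.  Vertices of \<open>H\<close> are natural
  numbers so that there is always room for additional vertices.
\<close>

definition embeds_in_euler_genus :: "'a pair_pre_digraph \<Rightarrow> nat \<Rightarrow> bool" where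
  "embeds_in_euler_genus G k \<longleftrightarrow> (\<exists>(H :: nat pair_pre_digraph) \<pi> tw f.
     comb_surface H \<pi> tw \<and> surface_euler_genus H \<pi> tw = int k \<and>
     inj_on f (pverts G) \<and> f ` pverts G \<subseteq> pverts H \<and> map_prod f f ` parcs G \<subseteq> parcs H)"

definition euler_genus :: "'a pair_pre_digraph \<Rightarrow> nat" where
  "euler_genus G = (LEAST k. embeds_in_euler_genus G k)"


section \<open>Graphs with two terminals\<close>

definition terminal_graphs :: "'a \<Rightarrow> 'a \<Rightarrow> 'a pair_pre_digraph set" where
  "terminal_graphs x y = {G. pair_graph G \<and> x \<in> pverts G \<and> y \<in> pverts G \<and> x \<noteq> y}"

definition terminal_graphs_nonadj :: "'a \<Rightarrow> 'a \<Rightarrow> 'a pair_pre_digraph set" where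
  "terminal_graphs_nonadj x y = {G \<in> terminal_graphs x y. (x, y) \<notin> parcs G}"

definition add_edge :: "'a \<Rightarrow> 'a \<Rightarrow> 'a pair_pre_digraph \<Rightarrow> 'a pair_pre_digraph" where
  "add_edge u v G = \<lparr>pverts = pverts G, parcs = parcs G \<union> {(u, v), (v, u)}\<rparr>"

definition delete_edge :: "'a \<Rightarrow> 'a \<Rightarrow> 'a pair_pre_digraph \<Rightarrow> 'a pair_pre_digraph" where
  "delete_edge u v G = \<lparr>pverts = pverts G, parcs = parcs G - {(u, v), (v, u)}\<rparr>"

text \<open>The vertex resulting from the contraction of \<open>uv\<close> is named \<open>u\<close>.\<close>

definition contract_edge :: "'a \<Rightarrow> 'a \<Rightarrow> 'a pair_pre_digraph \<Rightarrow> 'a pair_pre_digraph" where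
  "contract_edge u v G = (let r = (\<lambda>w. if w = v then u else w) in
     \<lparr>pverts = r ` pverts G, parcs = {(r a, r b) | a b. (a, b) \<in> parcs G \<and> r a \<noteq> r b}\<rparr>)"

datatype 'a minor_operation = Delete 'a 'a | Contract 'a 'a

text \<open>
  The vertex \<open>v\<close> that loses its name in \<open>Contract u v\<close> must not be a terminal.  Hence a vertex obtained
  by contracting an edge at a terminal is that terminal, and of all edges exactly \<open>xy\<close> cannot
  be contracted.  If neither end is a terminal, \<open>Contract u v\<close> and \<open>Contract v u\<close> give isomorphic
  graphs.
\<close>

definition minor_operations :: "'a \<Rightarrow> 'a \<Rightarrow> 'a pair_pre_digraph \<Rightarrow> 'a minor_operation set" where
  "minor_operations x y G =
     {Delete u v | u v. (u, v) \<in> parcs G} \<union>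
     {Contract u v | u v. (u, v) \<in> parcs G \<and> v \<notin> {x, y}}"

fun apply_minor :: "'a minor_operation \<Rightarrow> 'a pair_pre_digraph \<Rightarrow> 'a pair_pre_digraph" where
  "apply_minor (Delete u v) G = delete_edge u v G"
| "apply_minor (Contract u v) G = contract_edge u v G"

definition euler_genus_plus :: "'a \<Rightarrow> 'a \<Rightarrow> 'a pair_pre_digraph \<Rightarrow> nat" where
  "euler_genus_plus x y G = euler_genus (add_edge x y G)"

definition is_xy_sum ::
  "'a \<Rightarrow> 'a \<Rightarrow> 'a pair_pre_digraph \<Rightarrow> 'a pair_pre_digraph \<Rightarrow> 'a pair_pre_digraph \<Rightarrow> bool" where
  "is_xy_sum x y G\<^sub>1 G\<^sub>2 G \<longleftrightarrow> pverts G\<^sub>1 \<inter> pverts G\<^sub>2 = {x, y} \<and>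
     G = \<lparr>pverts = pverts G\<^sub>1 \<union> pverts G\<^sub>2, parcs = parcs G\<^sub>1 \<union> parcs G\<^sub>2\<rparr>"

definition euler_genus_plus_tight ::
  "'a \<Rightarrow> 'a \<Rightarrow> 'a pair_pre_digraph \<Rightarrow> 'a pair_pre_digraph \<Rightarrow> bool" where
  "euler_genus_plus_tight x y H G \<longleftrightarrow> subgraph (with_proj H) (with_proj G) \<and>
     (\<forall>\<mu>\<in>minor_operations x y H. euler_genus_plus x y (apply_minor \<mu> G) < euler_genus_plus x y G)"

definition critical_nonadj :: "'a \<Rightarrow> 'a \<Rightarrow> 'a pair_pre_digraph set" where
  "critical_nonadj x y = {G \<in> terminal_graphs_nonadj x y.
     \<forall>\<mu>\<in>minor_operations x y G. euler_genus_plus x y (apply_minor \<mu> G) < euler_genus_plus x y G}"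

end

theory Submission
  imports Defs
begin

text \<open>
  For an \<open>xy\<close>-sum, \<open>G\<^sup>+\<close> is the amalgamation of \<open>G\<^sub>1\<^sup>+\<close> and \<open>G\<^sub>2\<^sup>+\<close> along the edge \<open>xy\<close>, and Euler genus is
  additive over edge amalgamations (Miller).  Since a minor-operation in \<open>G\<^sub>1\<close> turns \<open>G\<close> into the \<open>xy\<close>-sum
  of \<open>\<mu> G\<^sub>1\<close> and \<open>G\<^sub>2\<close>, the summand \<open>G\<^sub>2\<close> cancels in the inequality defining tightness.

  For additivity, an embedding is a set of flags with three matchings: across the end of a half-edge
  (\<open>flip\<close>), along an edge (\<open>traverse\<close>), and around the corner at a vertex (\<open>\<beta>\<close>); faces and vertices
  are components of the union of two matchings.  Re-pairing four flags changes the number of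
  components by at most one.  The hard inequality is that an embedding of the amalgamation splits
  into embeddings of the two sides without increasing the total genus.  Contract the edge \<open>xy\<close> to a
  vertex.  A corner between the two sides lies on a face that enters one side there and leaves it
  at another mixed corner; re-pairing the two corners cuts off a face.  The vertices may fall apart
  or be joined meanwhile, but a potential combining the numbers of faces, of vertices and of corners
  crossing from \<open>x\<close> to \<open>y\<close> does not decrease.  Once no mixed corners are left, each side is brought back,
  again without decreasing the potential, to a single vertex with exactly two crossing corners,
  between which the edge \<open>xy\<close> is reinserted.
\<close>

section \<open>Connected components and perfect matchings\<close>

text \<open>The edge \<open>xy\<close> of the enlarged graph belongs to both sides, so a corner next
  to it has no colour of its own. This is why it is contracted: afterwards every dart belongs to
  exactly one side. The contraction does not identify the names x and y. Each flag keeps its end,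
  and the merged vertex shows only in corners that lead from an x-flag to a y-flag. Cutting the
  vertex cycles at these crossing corners leaves arcs, and the vertex count K in the potential 2F -
  2K + c counts such arcs together with the uncut cycles. In normal form K = |V| and c = 2, so the
  potential is a function of F and |V|. The weight one half of a crossing balances the moves: a
  re-pairing changes F by at most one, and in each move used below the change of 2K - c makes up for
  a lost face or is paid for by a gained one. Half-edges let darts, and with them the vertices, stay
  in place while edges are deleted, and they keep x and y present after the contraction. Flags
  instead of darts are used because the surfaces may be nonorientable: a vertex or a face then has
  no preferred direction.\<close>

definition conn :: "'a set \<Rightarrow> 'a rel \<Rightarrow> 'a rel" where
  "conn X R = Restr ((Restr (R \<union> R\<inverse>) X)\<^sup>*) X"

text \<open>\<open>conn\<close> restricts R to X before closing it, so pairs that leave X are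
  ignored and one relation serves many carrier sets. Faces, vertices and graph components are all
  counted in this way.\<close>

definition comps :: "'a set \<Rightarrow> 'a rel \<Rightarrow> nat" where
  "comps X R = card (X // conn X R)"

lemma conn_refl: "a \<in> X \<Longrightarrow> (a, a) \<in> conn X R"
  by (simp add: conn_def)

lemma conn_sym: "(a, b) \<in> conn X R \<Longrightarrow> (b, a) \<in> conn X R"
proof -
  have "sym (Restr (R \<union> R\<inverse>) X)"
    by (auto simp: sym_def)
  then show "(a, b) \<in> conn X R \<Longrightarrow> (b, a) \<in> conn X R"
    by (auto simp: conn_def dest: symD[OF sym_rtrancl])
qed

lemma conn_trans [trans]: "(a, b) \<in> conn X R \<Longrightarrow> (b, c) \<in> conn X R \<Longrightarrow> (a, c) \<in> conn X R"
  by (auto simp: conn_def)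

lemma conn_cong_right: "(b, c) \<in> conn X R \<Longrightarrow> (a, b) \<in> conn X R \<longleftrightarrow> (a, c) \<in> conn X R"
  using conn_trans conn_sym by metis

lemma conn_in: "(a, b) \<in> conn X R \<Longrightarrow> a \<in> X \<and> b \<in> X"
  by (auto simp: conn_def)

lemma conn_base: "(a, b) \<in> R \<Longrightarrow> a \<in> X \<Longrightarrow> b \<in> X \<Longrightarrow> (a, b) \<in> conn X R"
  by (auto simp: conn_def)

lemma equiv_conn: "equiv X (conn X R)"
  by (rule equivI)
    (auto simp: refl_on_def sym_def trans_def intro: conn_refl conn_sym conn_trans dest: conn_in)

lemma conn_map:
  assumes "(a, b) \<in> conn X R" and "\<And>u. u \<in> X \<Longrightarrow> g u \<in> Y"
    and "\<And>u v. (u, v) \<in> R \<Longrightarrow> u \<in> X \<Longrightarrow> v \<in> X \<Longrightarrow> (g u, g v) \<in> conn Y R'"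
  shows "(g a, g b) \<in> conn Y R'"
proof -
  have "a \<in> X" and "(a, b) \<in> (Restr (R \<union> R\<inverse>) X)\<^sup>*"
    using assms(1) by (auto simp: conn_def)
  from this(2) show ?thesis
  proof (induction rule: rtrancl_induct)
    case base
    show ?case
      using assms(2) \<open>a \<in> X\<close> by (simp add: conn_refl)
  next
    case (step u v)
    then have "(g u, g v) \<in> conn Y R'"
      using assms(3) by (auto intro: conn_sym)
    with step.IH show ?case
      by (rule conn_trans)
  qed
qed

lemma conn_mono:
  assumes "(a, b) \<in> conn X R" and "X \<subseteq> Y"
    and "\<And>u v. (u, v) \<in> R \<Longrightarrow> u \<in> X \<Longrightarrow> v \<in> X \<Longrightarrow> (u, v) \<in> conn Y R'"
  shows "(a, b) \<in> conn Y R'"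
  using conn_map[of a b X R "\<lambda>u. u" Y R'] assms by auto

text \<open>Connectivity under the empty relation on \<open>UNIV\<close> is equality, so this is an
  instance of \<open>conn_map\<close>.\<close>

lemma conn_invariant:
  assumes "(a, b) \<in> conn X R"
    and "\<And>u v. (u, v) \<in> R \<Longrightarrow> u \<in> X \<Longrightarrow> v \<in> X \<Longrightarrow> f u = f v"
  shows "f a = f b"
proof -
  have "(f a, f b) \<in> conn UNIV {}"
    using assms(1) by (rule conn_map) (auto simp: assms(2) intro: conn_refl)
  then show ?thesis
    by (simp add: conn_def)
qed

text \<open>A walk from a never leaves the class of a. This is what permits parity and counting
  arguments inside a single face or vertex.\<close>

lemma conn_class:
  assumes "(a, b) \<in> conn X R"
  shows "(a, b) \<in> conn (conn X R `` {a}) R"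
proof -
  have "a \<in> X" and "(a, b) \<in> (Restr (R \<union> R\<inverse>) X)\<^sup>*"
    using assms by (auto simp: conn_def)
  from this(2) show ?thesis
  proof (induction rule: rtrancl_induct)
    case base
    show ?case
      using \<open>a \<in> X\<close> by (simp add: conn_refl)
  next
    case (step u v)
    let ?C = "conn X R `` {a}"
    have u: "u \<in> ?C"
      using conn_in[OF step.IH] by simp
    have "(u, v) \<in> conn X R"
      using step.hyps(2) by (auto intro: conn_base conn_sym)
    with u have v: "v \<in> ?C"
      by (auto intro: conn_trans)
    have "(u, v) \<in> conn ?C R"
      using step.hyps(2) u v by (auto simp del: Image_singleton_iff intro: conn_base conn_sym)
    with step.IH show ?case
      by (rule conn_trans)
  qed
qed

text \<open>The map induced by g on classes is well defined by the second and third premise and onto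
  by the last. Almost all comparisons of face and vertex counts are instances with a suitable
  g.\<close>

lemma comps_le:
  assumes "finite X" and "\<And>u. u \<in> X \<Longrightarrow> g u \<in> Y"
    and "\<And>u v. (u, v) \<in> R \<Longrightarrow> u \<in> X \<Longrightarrow> v \<in> X \<Longrightarrow> (g u, g v) \<in> conn Y R'"
    and "\<And>c. c \<in> Y \<Longrightarrow> \<exists>a\<in>X. (g a, c) \<in> conn Y R'"
  shows "comps Y R' \<le> comps X R"
proof -
  let ?h = "\<lambda>C. conn Y R' `` (g ` C)"
  have "Y // conn Y R' \<subseteq> ?h ` (X // conn X R)"
  proof
    fix D assume "D \<in> Y // conn Y R'"
    then obtain c where c: "c \<in> Y" and D: "D = conn Y R' `` {c}"
      by (auto elim: quotientE)
    obtain a where a: "a \<in> X" and ac: "(g a, c) \<in> conn Y R'"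
      using assms(4)[OF c] by blast
    have "(g b, d) \<in> conn Y R' \<longleftrightarrow> (c, d) \<in> conn Y R'" if "(a, b) \<in> conn X R" for b d
    proof -
      have "(g a, g b) \<in> conn Y R'"
        using that assms(2,3) by (rule conn_map)
      with ac show ?thesis
        by (meson conn_sym conn_trans)
    qed
    moreover have "(a, a) \<in> conn X R"
      using a by (rule conn_refl)
    ultimately have "?h (conn X R `` {a}) = D"
      unfolding D by blast
    with a show "D \<in> ?h ` (X // conn X R)"
      by (metis imageI quotientI)
  qed
  moreover have "finite (X // conn X R)"
    using assms(1) equiv_conn[of X R] by (intro finite_quotient) (auto simp: conn_def)
  ultimately show ?thesis
    unfolding comps_def by (rule surj_card_le[rotated])
qed

lemma comps_antimono:
  assumes "finite X"
    and "\<And>u v. (u, v) \<in> R \<Longrightarrow> u \<in> X \<Longrightarrow> v \<in> X \<Longrightarrow> (u, v) \<in> conn X R'"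
  shows "comps X R' \<le> comps X R"
  by (rule comps_le[where g = "\<lambda>u. u"]) (use assms in \<open>auto intro: conn_refl\<close>)

lemma comps_empty_rel: "comps X {} = card X"
proof -
  have "conn X {} = Id_on X"
    by (auto simp: conn_def)
  then have "X // conn X {} = (\<lambda>x. {x}) ` X"
    by (auto simp: quotient_def)
  then show ?thesis
    by (simp add: comps_def card_image)
qed

lemma card_image_le_comps:
  assumes "finite X" "\<And>u v. (u, v) \<in> R \<Longrightarrow> u \<in> X \<Longrightarrow> v \<in> X \<Longrightarrow> f u = f v"
  shows "card (f ` X) \<le> comps X R"
proof -
  have "comps (f ` X) {} \<le> comps X R"
    by (rule comps_le[where g = f]) (use assms in \<open>auto intro: conn_refl\<close>)
  then show ?thesis by (simp add: comps_empty_rel)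
qed

lemma comps_pos:
  assumes "finite X" "X \<noteq> {}"
  shows "comps X R \<ge> 1"
proof -
  have "finite (X // conn X R)"
    using assms(1) equiv_conn[of X R] by (intro finite_quotient) (auto simp: conn_def)
  moreover have "X // conn X R \<noteq> {}"
    using assms(2) by (auto simp: quotient_def)
  ultimately show ?thesis
    by (simp add: comps_def Suc_leI card_gt_0_iff)
qed

section \<open>Perfect matchings as fixed-point-free involutions\<close>

definition fpf :: "'a set \<Rightarrow> ('a \<Rightarrow> 'a) \<Rightarrow> bool" where
  "fpf X f \<longleftrightarrow> (\<forall>p\<in>X. f p \<in> X \<and> f (f p) = p \<and> f p \<noteq> p)"

definition gr :: "'a set \<Rightarrow> ('a \<Rightarrow> 'a) \<Rightarrow> 'a rel" where
  "gr X f = {(p, f p) | p. p \<in> X}"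

lemma gr_iff [simp]: "(p, q) \<in> gr X f \<longleftrightarrow> p \<in> X \<and> q = f p"
  by (auto simp: gr_def)

lemma fpfD:
  assumes "fpf X f" "p \<in> X"
  shows "f p \<in> X" "f (f p) = p" "f p \<noteq> p"
  using assms by (auto simp: fpf_def)

lemma fpf_inj: "fpf X f \<Longrightarrow> p \<in> X \<Longrightarrow> q \<in> X \<Longrightarrow> f p = f q \<longleftrightarrow> p = q"
  by (metis fpf_def)

lemma fpf_class:
  assumes "fpf X f" "\<And>u. u \<in> X \<Longrightarrow> (u, f u) \<in> conn X R"
  shows "fpf (conn X R `` {u}) f"
  unfolding fpf_def
proof
  fix v assume v: "v \<in> conn X R `` {u}"
  then have "v \<in> X" by (auto dest: conn_in)
  with v assms(2) have "f v \<in> conn X R `` {u}"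
    by (auto intro: conn_trans)
  with fpfD[OF assms(1) \<open>v \<in> X\<close>] show "f v \<in> conn X R `` {u} \<and> f (f v) = v \<and> f v \<noteq> v"
    by auto
qed

lemma comps_disjoint:
  assumes "finite X" "finite Y" "X \<inter> Y = {}"
    and "\<And>u v. (u, v) \<in> R \<Longrightarrow> u \<in> X \<union> Y \<Longrightarrow> v \<in> X \<union> Y \<Longrightarrow> u \<in> X \<longleftrightarrow> v \<in> X"
  shows "comps (X \<union> Y) R = comps X R + comps Y R"
proof -
  have inv: "u \<in> X \<longleftrightarrow> v \<in> X" if "(u, v) \<in> conn (X \<union> Y) R" for u v
    using conn_invariant[OF that, of "\<lambda>u. u \<in> X"] assms(4) by blast
  have sub: "conn Z R \<subseteq> conn (X \<union> Y) R" if "Z \<subseteq> X \<union> Y" for Z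
    using that by (auto elim!: conn_mono intro: conn_base)
  have cls: "conn (X \<union> Y) R `` {u} = conn Z R `` {u}"
    if "u \<in> Z" "conn (X \<union> Y) R `` {u} \<subseteq> Z" "Z \<subseteq> X \<union> Y" for u Z
  proof
    show "conn (X \<union> Y) R `` {u} \<subseteq> conn Z R `` {u}"
    proof
      fix v assume "v \<in> conn (X \<union> Y) R `` {u}"
      then have "(u, v) \<in> conn (conn (X \<union> Y) R `` {u}) R"
        by (auto intro: conn_class)
      then have "(u, v) \<in> conn Z R"
        by (rule conn_mono) (use that in \<open>auto intro: conn_base\<close>)
      then show "v \<in> conn Z R `` {u}"
        by simp
    qed
    show "conn Z R `` {u} \<subseteq> conn (X \<union> Y) R `` {u}"
      using sub[OF that(3)] by auto
  qed
  have cX: "conn (X \<union> Y) R `` {u} = conn X R `` {u}" if "u \<in> X" for u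
    by (rule cls) (use that inv in auto)
  have cY: "conn (X \<union> Y) R `` {u} = conn Y R `` {u}" if "u \<in> Y" for u
    by (rule cls) (use that inv assms(3) in \<open>auto dest: conn_in\<close>)
  have "(X \<union> Y) // conn (X \<union> Y) R = X // conn X R \<union> Y // conn Y R"
    unfolding quotient_def using cX cY by auto
  moreover have "X // conn X R \<inter> Y // conn Y R = {}"
    unfolding quotient_def using assms(3)
    by (auto simp: set_eq_iff) (meson conn_in conn_refl disjoint_iff)
  moreover have "finite (Z // conn Z R)" if "finite Z" for Z
    using that equiv_conn[of Z R] by (intro finite_quotient) (auto simp: conn_def)
  ultimately show ?thesis
    using assms(1,2) by (simp add: comps_def card_Un_disjoint)
qed

lemma conn_insert:
  assumes "(c, d) \<in> conn X (insert (a, b) R)" "a \<in> X" "b \<in> X"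
  shows "(c, d) \<in> conn X R \<or> (c, a) \<in> conn X R \<and> (b, d) \<in> conn X R
    \<or> (c, b) \<in> conn X R \<and> (a, d) \<in> conn X R"
proof -
  have "c \<in> X" and "(c, d) \<in> (Restr (insert (a, b) R \<union> (insert (a, b) R)\<inverse>) X)\<^sup>*"
    using assms by (auto simp: conn_def)
  from this(2) show ?thesis
  proof (induction rule: rtrancl_induct)
    case base
    show ?case
      using \<open>c \<in> X\<close> by (simp add: conn_refl)
  next
    case (step u v)
    then have "(u, v) \<in> conn X R \<or> u = a \<and> v = b \<or> u = b \<and> v = a"
      by (auto intro: conn_base conn_sym)
    with step.IH assms(2,3) show ?case
      by (metis conn_refl conn_trans conn_sym)
  qed
qed

text \<open>The new pair can only fuse the class of a with that of b, so the map from old to new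
  classes is injective once the class of a is left out.\<close>

lemma comps_insert_le:
  assumes "finite X" "a \<in> X" "b \<in> X"
  shows "comps X R \<le> comps X (insert (a, b) R) + 1"
proof -
  let ?R = "conn X (insert (a, b) R)"
  let ?A = "conn X R `` {a}"
  have fin: "finite (X // conn X R')" for R'
    using assms(1) equiv_conn[of X R'] by (intro finite_quotient) (auto simp: conn_def)
  have "inj_on (\<lambda>C. ?R `` C) (X // conn X R - {?A})"
  proof (rule inj_onI)
    fix C D assume C: "C \<in> X // conn X R - {?A}" and D: "D \<in> X // conn X R - {?A}"
      and eq: "?R `` C = ?R `` D"
    obtain c where c: "c \<in> X" "C = conn X R `` {c}"
      using C by (auto elim: quotientE)
    obtain d where d: "d \<in> X" "D = conn X R `` {d}"
      using D by (auto elim: quotientE)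
    have nca: "(c, a) \<notin> conn X R" "(a, c) \<notin> conn X R"
      using C c equiv_class_eq[OF equiv_conn] by (metis DiffE singletonI conn_sym)+
    have nda: "(d, a) \<notin> conn X R" "(a, d) \<notin> conn X R"
      using D d equiv_class_eq[OF equiv_conn] by (metis DiffE singletonI conn_sym)+
    have "d \<in> D"
      using d by (simp add: conn_refl)
    then have "d \<in> ?R `` D"
      using d(1) conn_refl by fastforce
    then obtain c' where c': "(c, c') \<in> conn X R" "(c', d) \<in> ?R"
      using eq c by auto
    then have "(c, d) \<in> ?R"
      using conn_mono[of c c' X R X "insert (a, b) R"]
      by (auto intro: conn_trans conn_base)
    then have "(c, d) \<in> conn X R"
      using conn_insert[of c d X a b R] assms nca nda by blast
    then show "C = D"
      using c d equiv_class_eq[OF equiv_conn] by metis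
  qed
  moreover have "(\<lambda>C. ?R `` C) ` (X // conn X R - {?A}) \<subseteq> X // ?R"
  proof (rule image_subsetI)
    fix C assume "C \<in> X // conn X R - {?A}"
    then obtain c where c: "c \<in> X" "C = conn X R `` {c}"
      by (auto elim: quotientE)
    have "(c', e) \<in> ?R \<longleftrightarrow> (c, e) \<in> ?R" if "(c, c') \<in> conn X R" for c' e
    proof -
      have "(c, c') \<in> ?R"
        using that by (rule conn_mono) (auto intro: conn_base)
      then show ?thesis
        by (meson conn_sym conn_trans)
    qed
    moreover have "(c, c) \<in> conn X R"
      using c(1) by (rule conn_refl)
    ultimately have "?R `` C = ?R `` {c}"
      unfolding c(2) by blast
    then show "?R `` C \<in> X // ?R"
      using c(1) by (simp add: quotientI)
  qed
  ultimately have "card (X // conn X R - {?A}) \<le> card (X // ?R)"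
    by (rule card_inj_on_le[OF _ _ fin])
  moreover have "card (X // conn X R) \<le> card (X // conn X R - {?A}) + 1"
    by (simp add: card_Diff_singleton_if) linarith
  ultimately show ?thesis
    by (simp add: comps_def)
qed

lemma comps_insert_less:
  assumes "finite X" "a \<in> X" "b \<in> X" "(a, b) \<notin> conn X R"
  shows "comps X (insert (a, b) R) + 1 \<le> comps X R"
proof -
  let ?R = "insert (a, b) R"
  let ?A = "conn X R `` {a}"
  have le: "comps (X - ?A) R + 1 \<le> comps X R"
  proof -
    have "comps ((X - ?A) \<union> ?A) R = comps (X - ?A) R + comps ?A R"
    proof (rule comps_disjoint)
      show "finite ?A"
        using assms(1) by (rule finite_subset[rotated]) (auto dest: conn_in)
      fix u v assume uv: "(u, v) \<in> R" "u \<in> X - ?A \<union> ?A" "v \<in> X - ?A \<union> ?A"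
      then have "u \<in> X" "v \<in> X"
        by (auto dest: conn_in)
      with uv(1) have "(u, v) \<in> conn X R"
        by (intro conn_base)
      with \<open>u \<in> X\<close> \<open>v \<in> X\<close> show "u \<in> X - ?A \<longleftrightarrow> v \<in> X - ?A"
        by (simp add: conn_cong_right)
    qed (use assms in auto)
    moreover have "(X - ?A) \<union> ?A = X"
      by (auto dest: conn_in)
    moreover have "comps ?A R \<ge> 1"
    proof (rule comps_pos)
      show "finite ?A"
        using assms(1) by (rule finite_subset[rotated]) (auto dest: conn_in)
    qed (use conn_refl[OF assms(2)] in blast)
    ultimately show ?thesis
      by simp
  qed
  have "comps X ?R \<le> comps (X - ?A) R"
  proof (rule comps_le[where g = "\<lambda>u. u"])
    fix c assume "c \<in> X"
    show "\<exists>u\<in>X - ?A. (u, c) \<in> conn X ?R"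
    proof (cases "c \<in> ?A")
      case True
      then have "(a, c) \<in> conn X ?R"
        by (auto elim: conn_mono intro: conn_base)
      moreover have "(b, a) \<in> conn X ?R"
        using assms by (auto intro: conn_sym conn_base)
      ultimately show ?thesis
        using assms by (auto intro: conn_trans)
    qed (use \<open>c \<in> X\<close> conn_refl[OF \<open>c \<in> X\<close>] in blast)
  qed (use assms in \<open>auto intro: conn_base\<close>)
  with le show ?thesis
    by simp
qed

text \<open>An invariant with at least as many values as there are classes tells all classes apart;
  otherwise joining p and q would respect f and yet leave fewer classes than values. This turns the
  numerical condition that each vertex is one cycle into a statement about connectedness.\<close>

lemma conn_if_comps_eq:
  assumes "finite X" "\<And>u v. (u, v) \<in> R \<Longrightarrow> u \<in> X \<Longrightarrow> v \<in> X \<Longrightarrow> f u = f v"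
    and "comps X R \<le> card (f ` X)" "p \<in> X" "q \<in> X" "f p = f q"
  shows "(p, q) \<in> conn X R"
proof (rule ccontr)
  assume "(p, q) \<notin> conn X R"
  then have "comps X (insert (p, q) R) + 1 \<le> comps X R"
    using assms by (intro comps_insert_less)
  moreover have "card (f ` X) \<le> comps X (insert (p, q) R)"
    by (rule card_image_le_comps) (use assms in auto)
  ultimately show False
    using assms(3) by linarith
qed

text \<open>The bound of vertices minus components by the number of edges, doubled because a
  symmetric relation contains every edge twice.\<close>

lemma comps_symmetric_edges:
  assumes "finite X" "finite R" "sym R" "irrefl R" "R \<subseteq> X \<times> X"
  shows "2 * card X \<le> 2 * comps X R + card R"
  using assms(2-)
proof (induction "card R" arbitrary: R rule: less_induct)
  case less
  show ?case
  proof (cases "R = {}")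
    case False
    then obtain a b where ab: "(a, b) \<in> R" by auto
    let ?R = "R - {(a, b), (b, a)}"
    have "a \<noteq> b" "(b, a) \<in> R"
      using ab less.prems by (auto simp: irrefl_def sym_def)
    then have "card R = card ?R + 2"
      using ab less.prems card_Diff_subset[of "{(a, b), (b, a)}" R] card_mono[of R "{(a, b), (b, a)}"]
      by auto
    moreover have "2 * card X \<le> 2 * comps X ?R + card ?R"
      using calculation less.prems
      by (intro less.hyps) (auto simp: sym_def irrefl_def)
    moreover have "comps X ?R \<le> comps X (insert (a, b) ?R) + 1"
      using assms ab less.prems by (intro comps_insert_le) auto
    moreover have "comps X (insert (a, b) ?R) \<le> comps X R"
    proof (rule comps_antimono)
      fix u v assume "(u, v) \<in> R" "u \<in> X" "v \<in> X"
      then show "(u, v) \<in> conn X (insert (a, b) ?R)"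
        by (cases "(u, v) = (b, a)") (auto intro: conn_sym conn_base)
    qed (fact assms(1))
    ultimately show ?thesis
      by linarith
  qed (simp add: comps_empty_rel)
qed

lemma fpf_diff:
  assumes "fpf X f" "u \<in> X"
  shows "fpf (X - {u, f u}) f"
  unfolding fpf_def
proof
  fix v assume "v \<in> X - {u, f u}"
  with assms fpfD[OF assms] show "f v \<in> X - {u, f u} \<and> f (f v) = v \<and> f v \<noteq> v"
    using fpf_inj[OF assms(1), of v u] fpf_inj[OF assms(1), of v "f u"]
    by (auto dest: fpfD[OF assms(1)])
qed

lemma fpf_even_card:
  assumes "finite X" "fpf X f"
  shows "even (card X)"
  using assms
proof (induction "card X" arbitrary: X rule: less_induct)
  case less
  show ?case
  proof (cases "X = {}")
    case False
    then obtain p where p: "p \<in> X" by auto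
    let ?Y = "X - {p, f p}"
    have q: "f p \<in> X" "f p \<noteq> p"
      using less.prems p by (auto simp: fpf_def)
    then have c: "card X = card ?Y + 2"
      using p less.prems card_Diff_subset[of "{p, f p}" X] card_mono[of X "{p, f p}"] by auto
    have "fpf ?Y f"
      using less.prems(2) p by (rule fpf_diff)
    then have "even (card ?Y)"
      using c less.prems by (intro less.hyps) auto
    with c show ?thesis by simp
  qed simp
qed

text \<open>By parity: if q were outside the class of p, then a would match this class perfectly,
  while b would match all of it except p. The alternating path from p to q thus exists without being
  constructed.\<close>

lemma path_ends_connected:
  assumes "finite X" "fpf X a" "p \<in> X" "fpf (X - {p, q}) b"
  shows "(p, q) \<in> conn X (gr X a \<union> gr (X - {p, q}) b)"
proof (rule ccontr)
  let ?R = "gr X a \<union> gr (X - {p, q}) b"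
  let ?C = "conn X ?R `` {p}"
  assume nq: "(p, q) \<notin> conn X ?R"
  have fin: "finite ?C"
    using assms(1) by (rule finite_subset[rotated]) (auto dest: conn_in)
  have CX: "?C \<subseteq> X" by (auto dest: conn_in)
  have "(u, a u) \<in> conn X ?R" if "u \<in> X" for u
    using that assms(2) by (intro conn_base) (auto simp: fpf_def)
  then have "fpf ?C a"
    using assms(2) by (intro fpf_class)
  then have 1: "even (card ?C)"
    using fin fpf_even_card by blast
  have b: "(u, b u) \<in> conn X ?R" if "u \<in> X - {p, q}" for u
    using that assms(4) by (intro conn_base) (auto simp: fpf_def)
  have "fpf (?C - {p}) b"
    unfolding fpf_def
  proof
    fix u assume u: "u \<in> ?C - {p}"
    then have u': "u \<in> X - {p, q}"
      using CX nq by auto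
    with assms(4) have "b u \<in> X - {p, q}" "b (b u) = u" "b u \<noteq> u"
      by (auto simp: fpf_def)
    with u b[OF u'] show "b u \<in> ?C - {p} \<and> b (b u) = u \<and> b u \<noteq> u"
      by (auto intro: conn_trans)
  qed
  then have 2: "even (card (?C - {p}))"
    using fin fpf_even_card by blast
  have "p \<in> ?C"
    using assms(3) by (simp add: conn_refl)
  with 1 2 fin show False
    by (metis card_Suc_Diff1 even_Suc)
qed

text \<open>The two matchings have at most |C| - |E|/2 edges together, and connecting C takes |C| -
  1 of them. Hence |E| is at most 2, and it is even because C and C - E are both matched.\<close>

lemma path_two_ends:
  assumes "finite C" "C \<noteq> {}" "fpf C a" "E \<subseteq> C" "fpf (C - E) b"
    and "\<And>p q. p \<in> C \<Longrightarrow> q \<in> C \<Longrightarrow> (p, q) \<in> conn C (gr C a \<union> gr (C - E) b)"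
  shows "card E = 0 \<or> card E = 2"
proof -
  let ?R = "gr C a \<union> gr (C - E) b"
  have "\<And>D. D \<in> C // conn C ?R \<Longrightarrow> D = C"
    using assms(6) by (fastforce elim!: quotientE dest: conn_in)
  then have "C // conn C ?R \<subseteq> {C}" by blast
  then have 1: "comps C ?R \<le> 1"
    using card_mono[of "{C}"] by (simp add: comps_def)
  have g: "gr Y f = (\<lambda>p. (p, f p)) ` Y" for Y and f :: "'a \<Rightarrow> 'a"
    by (auto simp: gr_def)
  have card_gr: "card (gr Y f) = card Y" for Y and f :: "'a \<Rightarrow> 'a"
    unfolding g by (intro card_image inj_onI) auto
  have "2 * card C \<le> 2 * comps C ?R + card ?R"
  proof (rule comps_symmetric_edges)
    show "sym ?R"
      using assms(3,5) by (auto simp: sym_def fpf_def)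
    show "irrefl ?R"
      using assms(3,5) unfolding irrefl_def fpf_def by (metis Un_iff gr_iff)
    show "?R \<subseteq> C \<times> C"
      using assms(3,5) by (auto simp: fpf_def)
  qed (use assms(1) g in auto)
  moreover have "card ?R \<le> card C + card (C - E)"
    using card_Un_le[of "gr C a" "gr (C - E) b"] by (simp add: card_gr)
  moreover have "card (C - E) + card E = card C"
    using assms(1,4) by (metis add.commute card_Diff_subset card_mono finite_subset le_add_diff_inverse)
  ultimately have "card E \<le> 2"
    using 1 by linarith
  moreover have "even (card E)"
    using fpf_even_card[OF assms(1,3)] fpf_even_card[of "C - E" b] assms(1,5)
      \<open>card (C - E) + card E = card C\<close> by (metis even_add finite_Diff)
  ultimately show ?thesis
    by (cases "card E = 1") auto
qed

section \<open>Re-pairing two pairs of a matching\<close>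

definition switch :: "('a \<Rightarrow> 'a) \<Rightarrow> 'a \<Rightarrow> 'a \<Rightarrow> 'a \<Rightarrow> 'a" where
  "switch f p r = f(p := r, r := p, f p := f r, f r := f p)"

lemma fpf_switch:
  assumes "fpf X f" "p \<in> X" "r \<in> X" "r \<noteq> p" "r \<noteq> f p"
  shows "fpf X (switch f p r)"
proof -
  have d: "f p \<noteq> p" "f r \<noteq> r" "f p \<noteq> f r" "f r \<noteq> p" "f (f p) = p" "f (f r) = r"
    "f p \<in> X" "f r \<in> X"
    using assms by (auto simp: fpf_def) metis+
  show ?thesis
    unfolding fpf_def
  proof
    fix u assume u: "u \<in> X"
    show "switch f p r u \<in> X \<and> switch f p r (switch f p r u) = u \<and> switch f p r u \<noteq> u"
    proof (cases "u \<in> {p, r, f p, f r}")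
      case True
      then show ?thesis using d assms by (auto simp: switch_def)
    next
      case False
      then have "f u \<notin> {p, r, f p, f r}" "f u \<in> X" "f (f u) = u" "f u \<noteq> u"
        using u d fpfD[OF assms(1) u] by auto
      then show ?thesis using False by (auto simp: switch_def)
    qed
  qed
qed

lemma switch_simps:
  assumes "fpf X f" "p \<in> X" "r \<in> X" "r \<noteq> p" "r \<noteq> f p"
  shows "switch f p r p = r" "switch f p r r = p" "switch f p r (f p) = f r" "switch f p r (f r) = f p"
    "u \<notin> {p, r, f p, f r} \<Longrightarrow> switch f p r u = f u"
  using assms fpfD[OF assms(1,2)] fpfD[OF assms(1,3)] by (auto simp: switch_def)

text \<open>Adding the pair of p and r to the old relation puts all four points into one class, so
  the result connects everything that the new relation connects; it has lost at most one
  component.\<close>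

lemma comps_switch_le:
  assumes "finite X" "fpf X f" "p \<in> X" "r \<in> X" "r \<noteq> p" "r \<noteq> f p"
  shows "comps X (R \<union> gr X f) \<le> comps X (R \<union> gr X (switch f p r)) + 1"
proof -
  let ?N = "insert (p, r) (R \<union> gr X f)"
  have [simp]: "f p \<in> X" "f r \<in> X" "f (f p) = p" "f (f r) = r"
    using assms by (auto simp: fpf_def)
  note sw = switch_simps[OF assms(2-)]
  have 1: "(p, r) \<in> conn X ?N" "(p, f p) \<in> conn X ?N" "(r, f r) \<in> conn X ?N"
    using assms by (auto intro: conn_base)
  have 2: "(u, f u) \<in> conn X ?N" if "u \<in> X" for u
    using that assms(2) by (auto intro!: conn_base simp: fpf_def)
  have "comps X (R \<union> gr X f) \<le> comps X ?N + 1"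
    using assms by (intro comps_insert_le) auto
  also have "comps X ?N \<le> comps X (R \<union> gr X (switch f p r))"
  proof (rule comps_antimono)
    fix u v assume uv: "(u, v) \<in> R \<union> gr X (switch f p r)" "u \<in> X" "v \<in> X"
    show "(u, v) \<in> conn X ?N"
    proof (cases "(u, v) \<in> R")
      case True
      then show ?thesis using uv by (auto intro: conn_base)
    next
      case False
      with uv have "v = switch f p r u" by auto
      then show ?thesis
        using 1 2[OF uv(2)] sw by (cases "u \<in> {p, r, f p, f r}") (auto, (meson conn_sym conn_trans)+)
    qed
  qed (fact assms(1))
  finally show ?thesis by simp
qed

text \<open>The inverse of a switch is again a switch, so every bound on component counts can be
  read in both directions.\<close>

lemma switch_switch:
  assumes "fpf X f" "p \<in> X" "r \<in> X" "r \<noteq> p" "r \<noteq> f p"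
  shows "switch (switch f p r) p (f p) = f"
proof -
  have "f p \<noteq> p" "f r \<noteq> r" "f p \<noteq> f r" "f r \<noteq> p" "f (f p) = p" "f (f r) = r"
    using assms by (auto simp: fpf_def) metis+
  then show ?thesis
    using assms(4,5) by (auto simp: switch_def fun_eq_iff)
qed

lemma comps_switch_ge:
  assumes "finite X" "fpf X f" "p \<in> X" "r \<in> X" "r \<noteq> p" "r \<noteq> f p"
  shows "comps X (R \<union> gr X (switch f p r)) \<le> comps X (R \<union> gr X f) + 1"
proof -
  let ?g = "switch f p r"
  note sw = switch_simps[OF assms(2-)] and f = fpfD[OF assms(2,3)]
  have "comps X (R \<union> gr X ?g) \<le> comps X (R \<union> gr X (switch ?g p (f p))) + 1"
  proof (rule comps_switch_le)
    show "fpf X ?g"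
      using assms(2-) by (rule fpf_switch)
    show "f p \<noteq> ?g p"
      using sw(1) assms(6) by simp
  qed (use assms f in simp_all)
  then show ?thesis
    unfolding switch_switch[OF assms(2-)] .
qed

text \<open>The alternating cycles through p and through r are each opened at one f-pair, and the
  new pairs close the two paths to a single cycle.\<close>

lemma comps_switch_merge:
  assumes "finite X" "fpf X a" "fpf X f" "p \<in> X" "r \<in> X"
    and "(p, r) \<notin> conn X (gr X a \<union> gr X f)"
  shows "comps X (gr X a \<union> gr X (switch f p r)) + 1 \<le> comps X (gr X a \<union> gr X f)"
proof -
  let ?O = "gr X a \<union> gr X f" and ?N = "gr X a \<union> gr X (switch f p r)"
  have in_X [simp]: "f p \<in> X" "f r \<in> X" "f (f p) = p" "f (f r) = r" "f p \<noteq> p" "f r \<noteq> r"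
    using assms by (auto simp: fpf_def)
  have f_conn: "(u, f u) \<in> conn X ?O" if "u \<in> X" for u
    using that assms(3) by (auto intro!: conn_base simp: fpf_def)
  have ne: "r \<noteq> p" "r \<noteq> f p"
    using assms(4-) f_conn[OF assms(4)] conn_refl[OF assms(4)] by auto
  note sw = switch_simps[OF assms(3-5) ne]
  \<comment> \<open>Without its f-pair the cycle of u still connects u with f u the long way round,
    using only pairs that the switch leaves alone.\<close>
  have bypass: "(u, f u) \<in> conn X ?N" if "u = p \<or> u = r" for u
  proof -
    let ?C = "conn X ?O `` {u}"
    have u: "u \<in> X" using that assms by auto
    have CX: "?C \<subseteq> X" by (auto dest: conn_in)
    have a_conn: "(v, a v) \<in> conn X ?O" if "v \<in> X" for v
      using that assms(2) by (auto intro!: conn_base simp: fpf_def)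
    have fpfC: "fpf ?C a" "fpf ?C f"
      using assms(2,3) a_conn f_conn by (auto intro: fpf_class)
    define w where "w = (if u = p then r else p)"
    have Cu: "w \<notin> ?C"
      using that assms(6) conn_sym[of r p X ?O] by (auto simp: w_def split: if_splits)
    have "f (f w) = w"
      by (simp add: w_def)
    with Cu have Cfu: "f w \<notin> ?C"
      using fpfD(1)[OF fpfC(2), of "f w"] by auto
    have "(u, f u) \<in> conn ?C (gr ?C a \<union> gr (?C - {u, f u}) f)"
    proof (rule path_ends_connected)
      show "finite ?C"
        using assms(1) CX finite_subset by blast
      show "fpf (?C - {u, f u}) f"
        using fpfC(2) by (rule fpf_diff) (use u conn_refl in \<open>simp add: conn_refl\<close>)
      show "u \<in> ?C"
        using u by (simp add: conn_refl)
    qed (use fpfC in simp_all)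
    then show ?thesis
    proof (rule conn_mono)
      fix v v' assume vw: "(v, v') \<in> gr ?C a \<union> gr (?C - {u, f u}) f" "v \<in> ?C" "v' \<in> ?C"
      show "(v, v') \<in> conn X ?N"
      proof (cases "v' = a v")
        case True
        then show ?thesis using vw CX by (auto intro!: conn_base)
      next
        case False
        then have "v \<notin> {p, r, f p, f r}"
          using vw Cu Cfu that by (auto simp: w_def split: if_splits)
        then have "switch f p r v = f v" by (rule sw(5))
        then show ?thesis using vw False CX by (intro conn_base) auto
      qed
    qed (fact CX)
  qed
  have pr: "(p, r) \<in> conn X ?N"
    using sw assms(4,5) by (intro conn_base) auto
  have "comps X ?N \<le> comps X (insert (p, r) ?O)"
  proof (rule comps_antimono)
    fix u v assume uv: "(u, v) \<in> insert (p, r) ?O" "u \<in> X" "v \<in> X"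
    then consider "(u, v) = (p, r)" | "v = a u" | "v = f u" by auto
    then show "(u, v) \<in> conn X ?N"
    proof cases
      case 3
      show ?thesis
      proof (cases "u \<in> {p, r, f p, f r}")
        case True
        then show ?thesis using bypass 3 by (auto intro: conn_sym)
      next
        case False
        then show ?thesis using 3 uv sw(5) by (intro conn_base) auto
      qed
    qed (use pr uv in \<open>auto intro!: conn_base\<close>)
  qed (fact assms(1))
  moreover have "comps X (insert (p, r) ?O) + 1 \<le> comps X ?O"
    using assms by (intro comps_insert_less)
  ultimately show ?thesis by simp
qed

lemma gr_cong: "(\<And>p. p \<in> X \<Longrightarrow> f p = g p) \<Longrightarrow> gr X f = gr X g"
  by (auto simp: gr_def)

lemma fpf_cong: "(\<And>p. p \<in> X \<Longrightarrow> f p = g p) \<Longrightarrow> fpf X f \<longleftrightarrow> fpf X g"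
  by (auto simp: fpf_def)

lemma comps_cong_conn:
  assumes "finite X"
    and "\<And>u v. (u, v) \<in> R \<Longrightarrow> u \<in> X \<Longrightarrow> v \<in> X \<Longrightarrow> (u, v) \<in> conn X R'"
    and "\<And>u v. (u, v) \<in> R' \<Longrightarrow> u \<in> X \<Longrightarrow> v \<in> X \<Longrightarrow> (u, v) \<in> conn X R"
  shows "comps X R = comps X R'"
  using assms by (intro antisym comps_antimono)

text \<open>The switch matches e with a e and closes the gap by matching their former partners. So
  {e, a e} becomes one extra component, which disappears with the passage to X'.\<close>

lemma comps_unsplice:
  assumes "finite X" "fpf X a" "fpf X f" "e \<in> X" "f e \<noteq> a e"
  defines "X' \<equiv> X - {e, a e}"
  shows "fpf X' (switch f e (a e))"
    and "comps X (gr X a \<union> gr X f) = comps X' (gr X' a \<union> gr X' (switch f e (a e)))"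
proof -
  let ?g = "switch f e (a e)" and ?E = "{e, a e}"
  have ae: "a e \<in> X" "a (a e) = e" "a e \<noteq> e"
    using assms(2,4) by (auto simp: fpf_def)
  note pre = assms(3,4) ae(1,3) assms(5)[symmetric]
  note sw = switch_simps[OF pre]
  have g: "fpf X ?g"
    using pre by (rule fpf_switch)
  show "fpf X' ?g"
    using fpf_diff[OF g assms(4)] sw(1) by (simp add: X'_def)
  have X: "X = X' \<union> ?E"
    using ae(1) assms(4) by (auto simp: X'_def)
  let ?G = "gr X a \<union> gr X ?g"
  have inv: "u \<in> X' \<longleftrightarrow> v \<in> X'" if "(u, v) \<in> ?G" for u v
    using that ae sw(1,2) fpfD[OF assms(2)] fpfD[OF g] unfolding X'_def
    by (auto simp: fpf_inj) metis+
  have "comps X ?G = comps X' ?G + comps ?E ?G"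
  proof -
    have "comps (X' \<union> ?E) ?G = comps X' ?G + comps ?E ?G"
      by (rule comps_disjoint) (use assms(1) inv in \<open>auto simp: X'_def\<close>)
    then show ?thesis using X by simp
  qed
  moreover have "comps X' ?G = comps X' (gr X' a \<union> gr X' ?g)"
    by (rule comps_cong_conn) (use assms(1) in \<open>auto simp: X'_def intro!: conn_base\<close>)
  moreover have "comps ?E ?G = 1"
  proof -
    have "comps ?E {(e, a e)} + 1 \<le> comps ?E {}"
      by (rule comps_insert_less) (use ae in \<open>auto simp: conn_def\<close>)
    moreover have "comps ?E ?G \<le> comps ?E {(e, a e)}"
      by (rule comps_antimono) (use assms(4) in \<open>auto intro: conn_base\<close>)
    moreover have "comps ?E ?G \<ge> 1"
      by (rule comps_pos) auto
    ultimately show ?thesis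
      using ae by (simp add: comps_empty_rel)
  qed
  ultimately have 1: "comps X ?G = comps X' (gr X' a \<union> gr X' ?g) + 1"
    by simp
  have fe: "f e \<in> X" "f e \<noteq> e"
    using assms(3,4) by (auto simp: fpf_def)
  \<comment> \<open>Undoing the switch therefore joins two different cycles, which shows that the
    switch gained a component; by \<open>comps_switch_ge\<close> it gained no more than one.\<close>
  have "(e, f e) \<notin> conn X ?G"
  proof
    assume "(e, f e) \<in> conn X ?G"
    then have "(e \<in> X') = (f e \<in> X')"
      by (rule conn_invariant[where f = "\<lambda>u. u \<in> X'"]) (use inv in auto)
    then show False
      using fe assms(5) by (simp add: X'_def)
  qed
  then have "comps X (gr X a \<union> gr X (switch ?g e (f e))) + 1 \<le> comps X ?G"
    using assms g fe by (intro comps_switch_merge)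
  then have "comps X (gr X a \<union> gr X f) + 1 \<le> comps X ?G"
    unfolding switch_switch[OF pre] .
  moreover have "comps X ?G \<le> comps X (gr X a \<union> gr X f) + 1"
    using assms(1) pre by (rule comps_switch_ge)
  ultimately show "comps X (gr X a \<union> gr X f) = comps X' (gr X' a \<union> gr X' ?g)"
    using 1 by linarith
qed

text \<open>The reverse of \<open>comps_unsplice\<close>: h matches the new points e and e' with
  each other, and switching h at p and e inserts them between p and f p.\<close>

lemma comps_splice:
  assumes "finite X" "fpf X a" "fpf X f" "p \<in> X" "e \<notin> X" "e' \<notin> X" "e \<noteq> e'" "a e = e'" "a e' = e"
  defines "g \<equiv> f(p := e, e := p, f p := e', e' := f p)"
  shows "fpf (X \<union> {e, e'}) g"
    and "comps (X \<union> {e, e'}) (gr (X \<union> {e, e'}) a \<union> gr (X \<union> {e, e'}) g) = comps X (gr X a \<union> gr X f)"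
proof -
  let ?X = "X \<union> {e, e'}" and ?h = "f(e := e', e' := e)"
  have fp: "f p \<in> X" "f p \<noteq> p" "f (f p) = p"
    using assms by (auto simp: fpf_def)
  have h: "fpf ?X ?h"
    using assms(3,5-7) by (auto simp: fpf_def)
  have a: "fpf ?X a"
    using assms(2,5-9) by (auto simp: fpf_def)
  have ne: "p \<noteq> e" "p \<noteq> e'" "f p \<noteq> e" "f p \<noteq> e'"
    using fp assms by auto
  have g: "g = switch ?h p e"
    using ne assms(7) unfolding g_def switch_def by (auto simp: fun_eq_iff)
  show fg: "fpf ?X g"
    unfolding g by (rule fpf_switch) (use h ne assms in auto)
  have ge: "g e = p" "g e' = f p" "g p = e" "g (f p) = e'"
    using ne fp assms(7) by (auto simp: g_def)
  have "comps ?X (gr ?X a \<union> gr ?X g)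
    = comps (?X - {e, a e}) (gr (?X - {e, a e}) a \<union> gr (?X - {e, a e}) (switch g e (a e)))"
    by (rule comps_unsplice) (use assms(1,8) a fg ge ne in auto)
  moreover have "?X - {e, a e} = X"
    using assms by auto
  moreover have "switch g e (a e) u = f u" if "u \<in> X" for u
    using that fp ne ge assms(5-8) by (auto simp: switch_def g_def)
  then have "gr X (switch g e (a e)) = gr X f"
    by (rule gr_cong)
  ultimately show "comps ?X (gr ?X a \<union> gr ?X g) = comps X (gr X a \<union> gr X f)"
    by (simp only:)
qed


section \<open>Maps with half-edges\<close>

type_synonym 'v flag = "('v \<times> 'v) \<times> bool"

abbreviation flags :: "('v \<times> 'v) set \<Rightarrow> 'v flag set" where
  "flags D \<equiv> D \<times> UNIV"

abbreviation vtx :: "'v flag \<Rightarrow> 'v" where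
  "vtx p \<equiv> fst (fst p)"

text \<open>The two flags of a dart are the two sides of its initial end.\<close>

definition flip :: "'v flag \<Rightarrow> 'v flag" where
  "flip p = (fst p, \<not> snd p)"

text \<open>Darts outside \<open>S\<close> are half-edges without a partner; a face walk turns around at their free end.\<close>

definition traverse :: "('v \<times> 'v) set \<Rightarrow> ('v \<times> 'v \<Rightarrow> bool) \<Rightarrow> 'v flag \<Rightarrow> 'v flag" where
  "traverse S tw p = (if fst p \<in> S then (prod.swap (fst p), snd p = tw (fst p)) else flip p)"

text \<open>Corners that change the vertex name are left out: the cycle of a pinched vertex is cut
  at its crossing corners. In a dart map nothing is left out.\<close>

definition corner_rel :: "('v \<times> 'v) set \<Rightarrow> ('v flag \<Rightarrow> 'v flag) \<Rightarrow> 'v flag rel" where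
  "corner_rel D \<beta> = gr (flags D) flip \<union> {(p, \<beta> p) | p. p \<in> flags D \<and> vtx (\<beta> p) = vtx p}"

definition num_verts :: "('v \<times> 'v) set \<Rightarrow> ('v flag \<Rightarrow> 'v flag) \<Rightarrow> nat" where
  "num_verts D \<beta> = comps (flags D) (corner_rel D \<beta>)"

definition map_faces ::
  "('v \<times> 'v) set \<Rightarrow> ('v \<times> 'v) set \<Rightarrow> ('v \<times> 'v \<Rightarrow> bool) \<Rightarrow> ('v flag \<Rightarrow> 'v flag) \<Rightarrow> nat" where
  "map_faces D S tw \<beta> = comps (flags D) (gr (flags D) (traverse S tw) \<union> gr (flags D) \<beta>)"

definition dart_graph :: "('v \<times> 'v) set \<Rightarrow> ('v \<times> 'v) set \<Rightarrow> ('v \<times> 'v \<Rightarrow> bool) \<Rightarrow> bool" where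
  "dart_graph D S tw \<longleftrightarrow> finite D \<and> (\<forall>d\<in>D. fst d \<noteq> snd d) \<and> S \<subseteq> D \<and>
     (\<forall>d\<in>S. prod.swap d \<in> S) \<and> (\<forall>d. tw (prod.swap d) = tw d)"

text \<open>The vertices are the first components of darts, so each vertex carries a dart, and an
  isolated vertex is represented by half-edges. The last conjunct says that the flags at each vertex
  form one cycle.\<close>

definition dart_map ::
  "('v \<times> 'v) set \<Rightarrow> ('v \<times> 'v) set \<Rightarrow> ('v \<times> 'v \<Rightarrow> bool) \<Rightarrow> ('v flag \<Rightarrow> 'v flag) \<Rightarrow> bool" where
  "dart_map D S tw \<beta> \<longleftrightarrow> dart_graph D S tw \<and> fpf (flags D) \<beta> \<and>
     (\<forall>p\<in>flags D. vtx (\<beta> p) = vtx p) \<and> num_verts D \<beta> = card (fst ` D)"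

text \<open>The Euler genus 2c - V + E - F of a map with c components. Only pairs of darts in S
  count as edges; half-edges do not.\<close>

definition map_genus ::
  "('v \<times> 'v) set \<Rightarrow> ('v \<times> 'v) set \<Rightarrow> ('v \<times> 'v \<Rightarrow> bool) \<Rightarrow> ('v flag \<Rightarrow> 'v flag) \<Rightarrow> int" where
  "map_genus D S tw \<beta> = 2 * int (comps (fst ` D) S) - int (card (fst ` D)) + int (card S div 2)
     - int (map_faces D S tw \<beta>)"

lemma flip_simps [simp]: "fst (flip p) = fst p" "snd (flip p) = (\<not> snd p)" "flip (flip p) = p" "flip p \<noteq> p"
  by (auto simp: flip_def prod_eq_iff)

lemma fpf_flip: "fpf (flags D) flip"
  by (auto simp: fpf_def flip_def)

lemma dart_graphD:
  assumes "dart_graph D S tw"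
  shows "finite D" "S \<subseteq> D" "finite S"
  using assms unfolding dart_graph_def by (blast intro: finite_subset)+

lemma dart_graph_dartD:
  assumes "dart_graph D S tw"
  shows "tw (prod.swap d) = tw d" "d \<in> D \<Longrightarrow> fst d \<noteq> snd d"
    "d \<in> S \<Longrightarrow> prod.swap d \<in> S" "d \<in> S \<Longrightarrow> prod.swap d \<noteq> d"
proof -
  have 1: "\<forall>d\<in>D. fst d \<noteq> snd d" "S \<subseteq> D" "\<forall>d\<in>S. prod.swap d \<in> S" "\<forall>d. tw (prod.swap d) = tw d"
    using assms unfolding dart_graph_def by blast+
  then show "tw (prod.swap d) = tw d" "d \<in> D \<Longrightarrow> fst d \<noteq> snd d" "d \<in> S \<Longrightarrow> prod.swap d \<in> S"
    by blast+
  show "d \<in> S \<Longrightarrow> prod.swap d \<noteq> d"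
    using 1 by (metis fst_swap subsetD)
qed

lemma dart_mapD:
  assumes "dart_map D S tw \<beta>"
  shows "dart_graph D S tw" "fpf (flags D) \<beta>" "\<forall>p\<in>flags D. vtx (\<beta> p) = vtx p"
    "num_verts D \<beta> = card (fst ` D)"
  using assms unfolding dart_map_def by blast+

lemma fpf_traverse:
  assumes "dart_graph D S tw"
  shows "fpf (flags D) (traverse S tw)"
  unfolding fpf_def
proof
  fix p :: "'a flag" assume "p \<in> flags D"
  then obtain d s where p: "p = (d, s)" "d \<in> D" by auto
  then show "traverse S tw p \<in> flags D \<and> traverse S tw (traverse S tw p) = p \<and> traverse S tw p \<noteq> p"
    using dart_graphD[OF assms] dart_graph_dartD[OF assms, of d] by (auto simp: traverse_def flip_def)
qed

lemma vtx_traverse: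
  "vtx (traverse S tw p) = (if fst p \<in> S then snd (fst p) else vtx p)"
  by (auto simp: traverse_def)

lemma vtx_image_flags: "vtx ` flags D = fst ` D"
  by force

lemma num_verts_ge:
  assumes "finite D"
  shows "card (fst ` D) \<le> num_verts D \<beta>"
proof -
  have "card (vtx ` flags D) \<le> num_verts D \<beta>"
    unfolding num_verts_def
    by (rule card_image_le_comps) (use assms in \<open>auto simp: corner_rel_def\<close>)
  then show ?thesis
    by (simp only: vtx_image_flags)
qed

lemma corner_connected:
  assumes "finite D" "num_verts D \<beta> = card (fst ` D)"
    and "p \<in> flags D" "q \<in> flags D" "vtx p = vtx q"
  shows "(p, q) \<in> conn (flags D) (corner_rel D \<beta>)"
proof (rule conn_if_comps_eq[where f = vtx])
  show "comps (flags D) (corner_rel D \<beta>) \<le> card (vtx ` flags D)"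
    using assms(2) by (simp only: vtx_image_flags num_verts_def)
qed (use assms in \<open>auto simp: corner_rel_def\<close>)

lemma corner_rel_dart_map:
  "\<forall>p\<in>flags D. vtx (\<beta> p) = vtx p \<Longrightarrow> corner_rel D \<beta> = gr (flags D) flip \<union> gr (flags D) \<beta>"
  unfolding corner_rel_def by auto

section \<open>Deleting edges, and monotonicity of the genus\<close>

lemma dart_graph_delete:
  assumes "dart_graph D S tw"
  shows "dart_graph D (S - {d, prod.swap d}) tw"
proof -
  have "prod.swap e \<noteq> prod.swap d" if "e \<noteq> d" for e
    using that by (metis swap_swap)
  then show ?thesis
    using assms unfolding dart_graph_def by (metis (no_types, lifting) DiffD1 DiffD2 DiffI Diff_subset insertCI insertE singletonD subset_trans swap_swap)
qed

text \<open>Cutting an edge into two half-edges re-pairs its four flags, so the switch lemmas bound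
  the change in the number of faces.\<close>

lemma traverse_switch:
  fixes d :: "'v \<times> 'v"
  assumes "dart_graph D S tw" "d \<in> S"
  defines "S' \<equiv> S - {d, prod.swap d}"
  shows "traverse S tw = switch (traverse S' tw) (d, True) (prod.swap d, tw d)"
    and "traverse S' tw = switch (traverse S tw) (d, True) (d, False)"
proof -
  have d: "prod.swap d \<noteq> d" "prod.swap d \<in> S" "tw (prod.swap d) = tw d"
    using dart_graphD[OF assms(1)] dart_graph_dartD[OF assms(1), of d] assms(2) by auto
  have "traverse S tw p = switch (traverse S' tw) (d, True) (prod.swap d, tw d) p \<and>
    traverse S' tw p = switch (traverse S tw) (d, True) (d, False) p" for p
  proof (cases "fst p \<in> {d, prod.swap d}")
    case True
    then consider s where "p = (d, s)" | s where "p = (prod.swap d, s)"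
      by (cases p) auto
    then show ?thesis
      using d assms(2) by cases (auto simp: traverse_def switch_def S'_def flip_def)
  next
    case False
    then show ?thesis
      using d assms(2) by (cases p) (auto simp: traverse_def switch_def S'_def flip_def)
  qed
  then show "traverse S tw = switch (traverse S' tw) (d, True) (prod.swap d, tw d)"
    and "traverse S' tw = switch (traverse S tw) (d, True) (d, False)"
    by blast+
qed

lemma map_faces_delete:
  assumes "dart_graph D S tw" "d \<in> S" "fpf (flags D) \<beta>" "\<forall>p\<in>flags D. vtx (\<beta> p) = vtx p"
  defines "S' \<equiv> S - {d, prod.swap d}"
  shows "map_faces D S tw \<beta> \<le> map_faces D S' tw \<beta> + 1"
    and "map_faces D S' tw \<beta> \<le> map_faces D S tw \<beta> + 1"
    and "d \<notin> conn (fst ` D) S' \<Longrightarrow> map_faces D S tw \<beta> + 1 \<le> map_faces D S' tw \<beta>"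
proof -
  let ?X = "flags D" and ?p = "(d, True)" and ?r = "(prod.swap d, tw d)"
  have fin: "finite ?X" and swap: "prod.swap d \<noteq> d" "prod.swap d \<in> S" and "S \<subseteq> D"
    using dart_graphD[OF assms(1)] dart_graph_dartD[OF assms(1), of d] assms(2) by auto
  have S': "dart_graph D S' tw"
    unfolding S'_def using assms(1) by (rule dart_graph_delete)
  note f = fpf_traverse[OF S']
  note sw = traverse_switch(1)[OF assms(1,2), folded S'_def]
  have p: "?p \<in> ?X" "?r \<in> ?X"
    using assms(2) swap \<open>S \<subseteq> D\<close> by auto
  have ne: "?r \<noteq> ?p" "?r \<noteq> traverse S' tw ?p"
    using swap by (auto simp: traverse_def S'_def flip_def)
  show "map_faces D S tw \<beta> \<le> map_faces D S' tw \<beta> + 1"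
    using comps_switch_ge[OF fin f p ne, of "gr ?X \<beta>"] by (simp add: map_faces_def sw Un_commute)
  show "map_faces D S' tw \<beta> \<le> map_faces D S tw \<beta> + 1"
    using comps_switch_le[OF fin f p ne, of "gr ?X \<beta>"] by (simp add: map_faces_def sw Un_commute)
  assume nc: "d \<notin> conn (fst ` D) S'"
  \<comment> \<open>Without the bridge d a face stays within one component of the graph, so the two
    flags to be joined lie on different faces.\<close>
  have "(?p, ?r) \<notin> conn ?X (gr ?X \<beta> \<union> gr ?X (traverse S' tw))"
  proof
    assume "(?p, ?r) \<in> conn ?X (gr ?X \<beta> \<union> gr ?X (traverse S' tw))"
    then have "(vtx ?p, vtx ?r) \<in> conn (fst ` D) S'"
    proof (rule conn_map)
      fix u v assume uv: "(u, v) \<in> gr ?X \<beta> \<union> gr ?X (traverse S' tw)" "u \<in> ?X" "v \<in> ?X"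
      from uv(2,3) have V: "vtx u \<in> fst ` D" "vtx v \<in> fst ` D"
        using vtx_image_flags[of D] by blast+
      from uv consider "v = \<beta> u" | "v = traverse S' tw u" by auto
      then show "(vtx u, vtx v) \<in> conn (fst ` D) S'"
      proof cases
        case 1
        then have "vtx v = vtx u" using uv(2) assms(4) by blast
        then show ?thesis using V by (simp add: conn_refl)
      next
        case 2
        show ?thesis
        proof (cases "fst u \<in> S'")
          case True
          with 2 have "vtx v = snd (fst u)" by (simp add: traverse_def)
          with True have "(vtx u, vtx v) \<in> S'" by simp
          then show ?thesis using V by (rule conn_base)
        next
          case False
          with 2 V show ?thesis by (simp add: vtx_traverse conn_refl)
        qed
      qed
    qed auto
    then show False using nc by (cases d) simp
  qed
  then show "map_faces D S tw \<beta> + 1 \<le> map_faces D S' tw \<beta>"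
    using comps_switch_merge[OF fin assms(3) f p] by (simp add: map_faces_def sw Un_commute)
qed

text \<open>E drops by one. If the ends of d stay connected, c is unchanged and F drops by at most
  one. If d is a bridge, c and F both rise by one and the genus stays the same.\<close>

lemma map_genus_delete:
  assumes "dart_map D S tw \<beta>" "d \<in> S"
  defines "S' \<equiv> S - {d, prod.swap d}"
  shows "map_genus D S' tw \<beta> \<le> map_genus D S tw \<beta>"
    and "d \<notin> conn (fst ` D) S' \<Longrightarrow> map_genus D S tw \<beta> \<le> map_genus D S' tw \<beta>"
    and "d \<notin> conn (fst ` D) S' \<Longrightarrow> comps (fst ` D) S' = comps (fst ` D) S + 1"
proof -
  let ?V = "fst ` D"
  have dg: "dart_graph D S tw" "fpf (flags D) \<beta>" "\<forall>p\<in>flags D. vtx (\<beta> p) = vtx p"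
    using dart_mapD[OF assms(1)] by blast+
  have swap: "prod.swap d \<noteq> d" "prod.swap d \<in> S" and "S \<subseteq> D" and fin: "finite ?V" "finite S"
    using dart_graphD[OF dg(1)] dart_graph_dartD[OF dg(1), of d] assms(2) by auto
  have "card S = card S' + 2"
    using assms(2) swap fin card_Diff_subset[of "{d, prod.swap d}" S] card_mono[of S "{d, prod.swap d}"]
    by (auto simp: S'_def)
  then have cS: "card S div 2 = card S' div 2 + 1"
    by simp
  obtain u w where d: "d = (u, w)" by (cases d)
  have uw: "u \<in> ?V" "w \<in> ?V"
    using assms(2) swap(2) \<open>S \<subseteq> D\<close> unfolding d by force+
  have S: "comps ?V S = comps ?V (insert d S')"
  proof (rule comps_cong_conn)
    fix a b assume "(a, b) \<in> S" "a \<in> ?V" "b \<in> ?V"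
    then show "(a, b) \<in> conn ?V (insert d S')"
      using uw by (cases "(a, b) = (w, u)") (auto simp: S'_def d intro: conn_sym conn_base)
  qed (use fin assms(2) in \<open>auto simp: S'_def intro: conn_base\<close>)
  note del = map_faces_delete[OF dg(1) assms(2) dg(2,3), folded S'_def]
  have c1: "comps ?V S' \<le> comps ?V S + 1"
    unfolding S d using fin(1) uw by (rule comps_insert_le)
  have c2: "comps ?V S + 1 \<le> comps ?V S'" if "d \<notin> conn ?V S'"
    unfolding S using that fin(1) uw unfolding d by (intro comps_insert_less)
  have c3: "comps ?V S = comps ?V S'" if "d \<in> conn ?V S'"
    unfolding S by (rule comps_cong_conn) (use that fin(1) in \<open>auto intro: conn_base\<close>)
  show "map_genus D S' tw \<beta> \<le> map_genus D S tw \<beta>"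
    using c1 c3 del cS unfolding map_genus_def by (cases "d \<in> conn ?V S'") auto
  assume nc: "d \<notin> conn ?V S'"
  show "comps ?V S' = comps ?V S + 1"
    using c1 c2[OF nc] by simp
  then show "map_genus D S tw \<beta> \<le> map_genus D S' tw \<beta>"
    using del(2) cS unfolding map_genus_def by auto
qed

lemma map_genus_mono:
  assumes "dart_map D S tw \<beta>" "T \<subseteq> S" "\<forall>d\<in>T. prod.swap d \<in> T"
  shows "map_genus D T tw \<beta> \<le> map_genus D S tw \<beta>"
  using assms(1,2)
proof (induction "card S" arbitrary: S rule: less_induct)
  case less
  show ?case
  proof (cases "S = T")
    case False
    then obtain d where d: "d \<in> S" "d \<notin> T" using less.prems by auto
    let ?S = "S - {d, prod.swap d}"
    have "finite S"
      using dart_graphD(3)[OF dart_mapD(1)] less.prems by blast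
    then have "card ?S < card S"
      using d by (intro psubset_card_mono) auto
    moreover have "dart_map D ?S tw \<beta>"
      using less.prems(1) dart_graph_delete unfolding dart_map_def by blast
    moreover have "prod.swap d \<notin> T"
      using assms(3) d(2) by force
    then have "T \<subseteq> ?S"
      using d(2) less.prems(2) by auto
    ultimately have "map_genus D T tw \<beta> \<le> map_genus D ?S tw \<beta>"
      by (rule less.hyps)
    also have "\<dots> \<le> map_genus D S tw \<beta>"
      using less.prems(1) d(1) by (rule map_genus_delete)
    finally show ?thesis .
  qed simp
qed

text \<open>Without edges \<open>traverse\<close> is \<open>flip\<close>, so faces are vertices and
  the genus is 2V - V - V = 0; putting the edges back does not lower it.\<close>

lemma map_genus_nonneg:
  assumes "dart_map D S tw \<beta>"
  shows "0 \<le> map_genus D S tw \<beta>"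
proof -
  have "gr (flags D) (traverse {} tw) = gr (flags D) flip"
    by (rule gr_cong) (simp add: traverse_def)
  then have "map_faces D {} tw \<beta> = num_verts D \<beta>"
    using assms by (simp add: map_faces_def num_verts_def corner_rel_dart_map dart_map_def)
  then have "map_genus D {} tw \<beta> = 0"
    using assms by (simp add: map_genus_def comps_empty_rel dart_map_def)
  then show ?thesis
    using map_genus_mono[OF assms, of "{}"] by simp
qed

text \<open>The half-edge is spliced into some corner of its vertex. \<open>traverse\<close> and
  \<open>flip\<close> both exchange its two flags, so one splice preserves the number of faces and
  the number of vertices.\<close>

lemma dart_map_insert:
  assumes "dart_map D S tw \<beta>" "fst d \<in> fst ` D" "fst d \<noteq> snd d"
  obtains \<beta>' where "dart_map (insert d D) S tw \<beta>'" "map_faces (insert d D) S tw \<beta>' = map_faces D S tw \<beta>"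
proof (cases "d \<in> D")
  case True
  then have "insert d D = D" by auto
  then show ?thesis using that assms(1) by metis
next
  case False
  obtain p where p: "p \<in> flags D" "vtx p = fst d"
    using assms(2) by force
  let ?X = "flags D" and ?e = "(d, True)" and ?e' = "(d, False)"
  let ?\<beta> = "\<beta>(p := ?e, ?e := p, \<beta> p := ?e', ?e' := \<beta> p)"
  have dg: "dart_graph D S tw" "fpf ?X \<beta>" "\<forall>p\<in>?X. vtx (\<beta> p) = vtx p" "num_verts D \<beta> = card (fst ` D)"
    using dart_mapD[OF assms(1)] by blast+
  have fin: "finite ?X" and "S \<subseteq> D"
    using dart_graphD[OF dg(1)] by auto
  have X: "flags (insert d D) = ?X \<union> {?e, ?e'}"
    by (auto simp: UNIV_bool)
  have e: "?e \<notin> ?X" "?e' \<notin> ?X" "?e \<noteq> ?e'"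
    using False by auto
  have a: "traverse S tw ?e = ?e'" "traverse S tw ?e' = ?e"
    using False \<open>S \<subseteq> D\<close> by (auto simp: traverse_def flip_def)
  have b: "flip ?e = ?e'" "flip ?e' = ?e"
    by (auto simp: flip_def)
  have V: "fst ` insert d D = fst ` D"
    using assms(2) by auto
  note F = comps_splice[OF fin fpf_traverse[OF dg(1)] dg(2) p(1) e a, folded X]
  note K = comps_splice[OF fin fpf_flip dg(2) p(1) e b, folded X]
  have v: "\<forall>q\<in>flags (insert d D). vtx (?\<beta> q) = vtx q"
  proof
    fix q assume "q \<in> flags (insert d D)"
    then have "q \<in> ?X \<or> q = ?e \<or> q = ?e'" unfolding X by blast
    moreover have "\<beta> p \<in> ?X" "vtx (\<beta> p) = fst d"
      using dg(3) p fpfD[OF dg(2) p(1)] by (blast, metis)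
    moreover have "vtx (\<beta> q) = vtx q" if "q \<in> ?X"
      using dg(3) that by blast
    ultimately show "vtx (?\<beta> q) = vtx q"
      using e p by auto
  qed
  have "dart_map (insert d D) S tw ?\<beta>"
    unfolding dart_map_def
  proof (intro conjI)
    show "dart_graph (insert d D) S tw"
      using dg(1) assms(3) by (auto simp: dart_graph_def)
    show "num_verts (insert d D) ?\<beta> = card (fst ` insert d D)"
      using K(2) dg(4) V by (simp only: num_verts_def corner_rel_dart_map[OF dg(3)] corner_rel_dart_map[OF v])
  qed (use F(1) v in auto)
  moreover have "map_faces (insert d D) S tw ?\<beta> = map_faces D S tw \<beta>"
    using F(2) by (simp only: map_faces_def)
  ultimately show ?thesis using that by blast
qed

lemma map_genus_cong_darts:
  assumes "fst ` D' = fst ` D" "map_faces D' S tw \<beta>' = map_faces D S tw \<beta>"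
  shows "map_genus D' S tw \<beta>' = map_genus D S tw \<beta>"
  using assms by (simp add: map_genus_def)

text \<open>As long as two components remain, two half-edges are inserted between them and joined to
  an edge. This edge is a bridge, so the genus does not rise.\<close>

lemma dart_map_connect:
  assumes "dart_map D S tw \<beta>" "D \<noteq> {}"
  obtains D' S' \<beta>' where "dart_map D' S' tw \<beta>'" "fst ` D' = fst ` D" "S \<subseteq> S'"
    "map_genus D' S' tw \<beta>' \<le> map_genus D S tw \<beta>" "comps (fst ` D') S' = 1"
proof -
  have "\<exists>D' S' \<beta>'. dart_map D' S' tw \<beta>' \<and> fst ` D' = fst ` D \<and> S \<subseteq> S' \<and>
    map_genus D' S' tw \<beta>' \<le> map_genus D S tw \<beta> \<and> comps (fst ` D') S' = 1"
    using assms
  proof (induction "comps (fst ` D) S" arbitrary: D S \<beta> rule: less_induct)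
    case less
    let ?V = "fst ` D"
    have fin: "finite ?V" and "?V \<noteq> {}"
      using less.prems by (auto simp: dart_map_def dart_graph_def)
    then have "comps ?V S \<ge> 1"
      by (rule comps_pos)
    show ?case
    proof (cases "comps ?V S = 1")
      case True
      with less.prems show ?thesis by blast
    next
      case False
      have "\<exists>u\<in>?V. \<exists>w\<in>?V. (u, w) \<notin> conn ?V S"
      proof (rule ccontr)
        assume "\<not> ?thesis"
        then have *: "(u, w) \<in> conn ?V S" if "u \<in> ?V" "w \<in> ?V" for u w
          using that by blast
        obtain v where "v \<in> ?V" using \<open>?V \<noteq> {}\<close> by blast
        then have "comps ?V S \<le> comps {v} {}"
          using * by (intro comps_le[where g = "\<lambda>u. u"]) auto
        then show False
          using False \<open>comps ?V S \<ge> 1\<close> by (simp add: comps_empty_rel)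
      qed
      then obtain u w where uw: "u \<in> ?V" "w \<in> ?V" "(u, w) \<notin> conn ?V S" by blast
      have "u \<noteq> w"
        using uw conn_refl by metis
      obtain \<beta>\<^sub>1 where 1: "dart_map (insert (u, w) D) S tw \<beta>\<^sub>1"
        "map_faces (insert (u, w) D) S tw \<beta>\<^sub>1 = map_faces D S tw \<beta>"
        using dart_map_insert[OF less.prems(1), of "(u, w)"] uw \<open>u \<noteq> w\<close> by auto
      obtain \<beta>\<^sub>2 where 2: "dart_map (insert (w, u) (insert (u, w) D)) S tw \<beta>\<^sub>2"
        "map_faces (insert (w, u) (insert (u, w) D)) S tw \<beta>\<^sub>2 = map_faces D S tw \<beta>"
        using dart_map_insert[OF 1(1), of "(w, u)"] 1(2) uw \<open>u \<noteq> w\<close> by auto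
      let ?D = "insert (w, u) (insert (u, w) D)" and ?S = "insert (w, u) (insert (u, w) S)"
      have V: "fst ` ?D = ?V"
        using uw by auto
      have "(u, w) \<notin> S" "(w, u) \<notin> S"
        using uw conn_base conn_sym by metis+
      then have S: "?S - {(u, w), prod.swap (u, w)} = S"
        by auto
      have dm: "dart_map ?D ?S tw \<beta>\<^sub>2"
        using 2(1) \<open>u \<noteq> w\<close> unfolding dart_map_def dart_graph_def by auto
      note del = map_genus_delete[OF dm, of "(u, w)", unfolded S V]
      have "comps ?V S = comps ?V ?S + 1"
        using del(3) uw(3) by auto
      moreover have "map_genus ?D ?S tw \<beta>\<^sub>2 \<le> map_genus ?D S tw \<beta>\<^sub>2"
        using del(2) uw(3) by auto
      moreover have "map_genus ?D S tw \<beta>\<^sub>2 = map_genus D S tw \<beta>"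
        using V 2(2) by (rule map_genus_cong_darts)
      moreover obtain D' S' \<beta>' where "dart_map D' S' tw \<beta>'" "fst ` D' = fst ` ?D" "?S \<subseteq> S'"
        "map_genus D' S' tw \<beta>' \<le> map_genus ?D ?S tw \<beta>\<^sub>2" "comps (fst ` D') S' = 1"
        using less.hyps[OF _ dm] calculation(1) V by auto
      ultimately show ?thesis
        using V by (intro exI[of _ D'] exI[of _ S'] exI[of _ \<beta>']) auto
    qed
  qed
  then show ?thesis using that by blast
qed


section \<open>Contracting and splitting off the terminal edge\<close>

text \<open>There is no condition on the number of cycles at a vertex: the re-pairings may split or
  join vertices, and only the potential keeps track of it.\<close>

definition pinched_map ::
  "'v \<Rightarrow> 'v \<Rightarrow> ('v \<times> 'v) set \<Rightarrow> ('v \<times> 'v) set \<Rightarrow> ('v \<times> 'v \<Rightarrow> bool) \<Rightarrow> ('v flag \<Rightarrow> 'v flag) \<Rightarrow> bool" where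
  "pinched_map x y D S tw \<beta> \<longleftrightarrow> x \<noteq> y \<and> dart_graph D S tw \<and> fpf (flags D) \<beta> \<and>
     (\<forall>p\<in>flags D. vtx (\<beta> p) = vtx p \<or> {vtx p, vtx (\<beta> p)} = {x, y})"

definition crossings ::
  "'v \<Rightarrow> 'v \<Rightarrow> ('v \<times> 'v) set \<Rightarrow> ('v flag \<Rightarrow> 'v flag) \<Rightarrow> 'v flag set" where
  "crossings x y D \<beta> = {p \<in> flags D. vtx p = x \<and> vtx (\<beta> p) = y}"

text \<open>A corner crossing from \<open>x\<close> to \<open>y\<close> is a place where the contracted edge \<open>xy\<close> can be reinserted; each
  crossing is counted once, from its \<open>x\<close> side.\<close>

definition contracted_map ::
  "'v \<Rightarrow> 'v \<Rightarrow> ('v \<times> 'v) set \<Rightarrow> ('v \<times> 'v) set \<Rightarrow> ('v \<times> 'v \<Rightarrow> bool) \<Rightarrow> ('v flag \<Rightarrow> 'v flag) \<Rightarrow> bool" where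
  "contracted_map x y D S tw \<beta> \<longleftrightarrow> pinched_map x y D S tw \<beta> \<and>
     num_verts D \<beta> = card (fst ` D) \<and> card (crossings x y D \<beta>) = 2"

lemma flags_finite: "dart_graph D S tw \<Longrightarrow> finite (flags D)"
  by (auto dest: dart_graphD(1))

lemma corner_rel_iff:
  "(p, q) \<in> corner_rel D \<beta> \<longleftrightarrow> p \<in> flags D \<and> (q = flip p \<or> q = \<beta> p \<and> vtx (\<beta> p) = vtx p)"
  by (auto simp: corner_rel_def)

lemma dart_graph_subset:
  assumes "dart_graph D S tw" "D' \<subseteq> D" "S' \<subseteq> S" "S' \<subseteq> D'" "\<And>d. d \<in> S' \<Longrightarrow> prod.swap d \<in> S'"
  shows "dart_graph D' S' tw"
  unfolding dart_graph_def
proof (intro conjI ballI allI)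
  show "finite D'"
    using dart_graphD(1)[OF assms(1)] assms(2) by (rule finite_subset[rotated])
qed (use assms dart_graph_dartD[OF assms(1)] in blast)+

text \<open>Taking a dart out of its cycle of flags leaves a path whose ends are the former
  neighbours of the dart.\<close>

lemma detour_at_vertex:
  assumes "finite D" "fpf (flags D) \<beta>" "\<forall>p\<in>flags D. vtx (\<beta> p) = vtx p" "e \<in> flags D" "\<beta> e \<noteq> flip e"
  defines "X \<equiv> {u \<in> flags (D - {fst e}). vtx u = vtx e}"
  shows "\<beta> e \<in> X" "\<beta> (flip e) \<in> X"
    "(\<beta> e, \<beta> (flip e)) \<in> conn X (gr X flip \<union> gr (X - {\<beta> e, \<beta> (flip e)}) \<beta>)"
proof -
  have flip_in: "flip e \<in> flags D"
    using assms(4) by (auto simp: flip_def)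
  note e = fpfD[OF assms(2,4)] and e' = fpfD[OF assms(2) flip_in]
  have other: "fst u = fst e \<longleftrightarrow> u = e \<or> u = flip e" for u
    by (cases u; cases e) (auto simp: flip_def)
  have X: "X = {u \<in> flags D. vtx u = vtx e} - {e, flip e}"
  proof (rule set_eqI)
    fix u
    have "u \<in> flags (D - {fst e}) \<longleftrightarrow> u \<in> flags D - {e, flip e}"
      using other[of u] unfolding Diff_iff mem_Times_iff by blast
    then show "u \<in> X \<longleftrightarrow> u \<in> {u \<in> flags D. vtx u = vtx e} - {e, flip e}"
      unfolding X_def Diff_iff mem_Collect_eq by argo
  qed
  have ne: "\<beta> (flip e) \<noteq> e"
    using e' assms(5) by metis
  have in_D: "vtx (\<beta> u) = vtx u" if "u \<in> flags D" for u
    using assms(3) that by blast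
  show 1: "\<beta> e \<in> X"
    unfolding X using e assms(4,5) in_D[OF assms(4)] by auto
  show 2: "\<beta> (flip e) \<in> X"
    unfolding X using e' ne in_D[OF flip_in] by auto
  show "(\<beta> e, \<beta> (flip e)) \<in> conn X (gr X flip \<union> gr (X - {\<beta> e, \<beta> (flip e)}) \<beta>)"
  proof (rule path_ends_connected)
    show "finite X"
      unfolding X using assms(1) by auto
    show "fpf X flip"
    proof -
      have "fpf {u \<in> flags D. vtx u = vtx e} flip"
        by (simp add: fpf_def mem_Times_iff)
      then show ?thesis
        unfolding X using assms(4) by (intro fpf_diff) auto
    qed
    show "fpf (X - {\<beta> e, \<beta> (flip e)}) \<beta>"
      unfolding fpf_def
    proof
      fix u assume u: "u \<in> X - {\<beta> e, \<beta> (flip e)}"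
      then have uD: "u \<in> flags D" "vtx u = vtx e" "u \<noteq> e" "u \<noteq> flip e"
        unfolding X by auto
      note bu = fpfD[OF assms(2) uD(1)]
      have "\<beta> u \<noteq> e" "\<beta> u \<noteq> flip e"
        using u bu by auto
      moreover have "\<beta> u \<noteq> \<beta> e" "\<beta> u \<noteq> \<beta> (flip e)"
        using uD fpf_inj[OF assms(2)] assms(4) flip_in by metis+
      ultimately show "\<beta> u \<in> X - {\<beta> e, \<beta> (flip e)} \<and> \<beta> (\<beta> u) = u \<and> \<beta> u \<noteq> u"
        using bu in_D[OF uD(1)] uD(2) unfolding X by auto
    qed
  qed (fact 1)
qed

text \<open>On each of the two sides of xy, its two flags are cut out of their face by
  \<open>comps_unsplice\<close>. This matches the neighbouring x-flag with the neighbouring y-flag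
  and so produces the two crossings. The darts \<open>d\<^sub>1\<close> and \<open>d\<^sub>2\<close>
  make x and y survive.\<close>

lemma contract_edge_map:
  assumes dm: "dart_map D S tw \<beta>" and xy: "(x, y) \<in> S"
    and d1: "d\<^sub>1 \<in> D" "fst d\<^sub>1 = x" "d\<^sub>1 \<noteq> (x, y)" and d2: "d\<^sub>2 \<in> D" "fst d\<^sub>2 = y" "d\<^sub>2 \<noteq> (y, x)"
  obtains \<beta>' where "contracted_map x y (D - {(x, y), (y, x)}) (S - {(x, y), (y, x)}) tw \<beta>'"
    "map_faces (D - {(x, y), (y, x)}) (S - {(x, y), (y, x)}) tw \<beta>' = map_faces D S tw \<beta>"
    "fst ` (D - {(x, y), (y, x)}) = fst ` D"
proof -
  let ?D = "D - {(x, y), (y, x)}" and ?S = "S - {(x, y), (y, x)}"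
  let ?X = "flags D" and ?a = "traverse S tw"
  note dg = dart_mapD[OF dm]
  note X = flags_finite[OF dg(1)]
  have "x \<noteq> y"
    using dart_graph_dartD(4)[OF dg(1) xy] by auto
  have "(y, x) \<in> S"
    using dart_graph_dartD(3)[OF dg(1) xy] by simp
  then have D: "(x, y) \<in> D" "(y, x) \<in> D"
    using xy dart_graphD(2)[OF dg(1)] by auto
  have V: "fst ` ?D = fst ` D"
  proof -
    have "d\<^sub>1 \<in> ?D" "d\<^sub>2 \<in> ?D"
      using d1 d2 \<open>x \<noteq> y\<close> by (metis Diff_iff fst_conv insertE singletonD)+
    then have "x \<in> fst ` ?D" "y \<in> fst ` ?D"
      using d1(2) d2(2) by blast+
    moreover have "fst d \<in> insert x (insert y (fst ` ?D))" if "d \<in> D" for d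
      using that by (cases "d \<in> ?D") auto
    moreover have "fst ` ?D \<subseteq> fst ` D"
      by (rule image_mono) blast
    ultimately show ?thesis by auto
  qed
  define e where "e = ((x, y), True)"
  define e' where "e' = flip e"
  define f where "f = ?a e"
  define f' where "f' = flip f"
  have in_X: "e \<in> ?X" "e' \<in> ?X" "f \<in> ?X" "f' \<in> ?X"
    using D xy by (auto simp: e_def e'_def f_def f'_def traverse_def flip_def)
  have a: "?a e = f" "?a e' = f'" and v: "vtx e = x" "vtx e' = x" "vtx f = y" "vtx f' = y"
    and fe: "fst e = (x, y)" "fst e' = (x, y)" "fst f = (y, x)" "fst f' = (y, x)"
    using xy by (auto simp: e_def e'_def f_def f'_def traverse_def flip_def)
  have flips: "flip e = e'" "flip e' = e" "flip f = f'" "flip f' = f"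
    by (simp_all add: e'_def f'_def)
  have ne: "e \<noteq> e'" "f \<noteq> f'" "e \<noteq> f" "e \<noteq> f'" "e' \<noteq> f" "e' \<noteq> f'"
    using v \<open>x \<noteq> y\<close> flip_simps(4)[of e] flip_simps(4)[of f] unfolding flips by metis+
  have memb: "fst u \<in> {(x, y), (y, x)} \<longleftrightarrow> u \<in> {e, e', f, f'}" for u
    by (cases u) (auto simp: e_def e'_def f_def f'_def flip_def traverse_def xy)
  have X2: "?X - {e, f} - {e', f'} = flags ?D"
  proof (rule set_eqI)
    fix u show "u \<in> ?X - {e, f} - {e', f'} \<longleftrightarrow> u \<in> flags ?D"
      using memb[of u] unfolding Diff_iff mem_Times_iff insert_iff by blast
  qed
  have bv: "vtx (\<beta> u) = vtx u" if "u \<in> ?X" for u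
    using dg(3) that by blast
  \<comment> \<open>A corner that closes up around one dart would make its two flags a whole vertex,
    contrary to the further dart d at that vertex.\<close>
  have no_pair: "\<beta> u \<noteq> flip u" if u: "u \<in> ?X" and d: "d \<in> D" "fst d = vtx u" "d \<noteq> fst u" for u d
  proof
    assume eq: "\<beta> u = flip u"
    then have eq': "\<beta> (flip u) = u"
      using fpfD[OF dg(2) u] by metis
    have "(u, (d, True)) \<in> conn ?X (corner_rel D \<beta>)"
      using dg(1,4) u d by (intro corner_connected) (auto dest: dart_graphD)
    then have "(u \<in> {u, flip u}) = ((d, True) \<in> {u, flip u})"
    proof (rule conn_invariant[where f = "\<lambda>w. w \<in> {u, flip u}"])
      fix a b assume ab: "(a, b) \<in> corner_rel D \<beta>" "a \<in> ?X" "b \<in> ?X"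
      then consider "b = flip a" | "b = \<beta> a"
        by (auto simp: corner_rel_def)
      then show "(a \<in> {u, flip u}) = (b \<in> {u, flip u})"
        by cases (use eq eq' fpfD[OF dg(2) ab(2)] in \<open>auto; metis flip_simps(3)\<close>)+
    qed
    then show False
      using d(3) by (auto simp: flip_def)
  qed
  have be: "\<beta> e \<noteq> e'" and bf: "\<beta> f \<noteq> f'"
    using no_pair[OF in_X(1) d1(1)] no_pair[OF in_X(3) d2(1)] d1 d2 v fe flips by auto
  define p where "p = \<beta> e"
  define q where "q = \<beta> e'"
  define r where "r = \<beta> f"
  define s where "s = \<beta> f'"
  have inv: "\<beta> p = e" "\<beta> q = e'" "\<beta> r = f" "\<beta> s = f'"
    and pqrs_X: "p \<in> ?X" "q \<in> ?X" "r \<in> ?X" "s \<in> ?X"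
    using fpfD[OF dg(2)] in_X by (auto simp: p_def q_def r_def s_def)
  have hv: "\<beta> e = p" "\<beta> e' = q" "\<beta> f = r" "\<beta> f' = s"
    by (simp_all add: p_def q_def r_def s_def)
  have vp: "vtx p = x" "vtx q = x" "vtx r = y" "vtx s = y"
    using bv in_X v by (auto simp: p_def q_def r_def s_def)
  have dist: "p \<noteq> q" "r \<noteq> s"
    using inv ne by auto
  have notin: "p \<notin> {e, e', f, f'}" "q \<notin> {e, e', f, f'}" "r \<notin> {e, e', f, f'}" "s \<notin> {e, e', f, f'}"
    using be bf inv vp v \<open>x \<noteq> y\<close> fpfD(3)[OF dg(2)] in_X
    by (auto simp: p_def q_def r_def s_def)
  have pqrs: "p \<in> flags ?D" "q \<in> flags ?D" "r \<in> flags ?D" "s \<in> flags ?D"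
    using pqrs_X notin unfolding X2[symmetric] by auto
  define b1 where "b1 = switch \<beta> e f"
  define b2 where "b2 = switch b1 e' f'"
  have b1: "b1 e' = q" "b1 f' = s"
    using ne notin dist inv vp v \<open>x \<noteq> y\<close> unfolding b1_def switch_def q_def s_def
    by (auto simp: p_def[symmetric] r_def[symmetric])
  have b2: "b2 p = r" "b2 r = p" "b2 q = s" "b2 s = q"
    "u \<in> flags ?D \<Longrightarrow> u \<notin> {p, q, r, s} \<Longrightarrow> b2 u = \<beta> u" for u
  proof -
    have 1: "b2 = b1(e' := f', f' := e', q := s, s := q)"
      by (simp add: b2_def switch_def b1)
    have 2: "b1 = \<beta>(e := f, f := e, p := r, r := p)"
      by (simp add: b1_def switch_def p_def r_def)
    have "p \<noteq> s" "r \<noteq> q" "p \<noteq> r" "q \<noteq> s"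
      using vp \<open>x \<noteq> y\<close> by auto
    then show "b2 p = r" "b2 r = p" "b2 q = s" "b2 s = q"
      using dist notin unfolding 1 2 by auto
    assume "u \<in> flags ?D" "u \<notin> {p, q, r, s}"
    moreover have "u \<notin> {e, e', f, f'}"
      using calculation(1) unfolding X2[symmetric] by auto
    ultimately show "b2 u = \<beta> u"
      unfolding 1 2 by auto
  qed
  have fa: "fpf ?X ?a"
    using dg(1) by (rule fpf_traverse)
  have u1: "fpf (?X - {e, f}) b1"
    "comps ?X (gr ?X ?a \<union> gr ?X \<beta>)
      = comps (?X - {e, f}) (gr (?X - {e, f}) ?a \<union> gr (?X - {e, f}) b1)"
    using comps_unsplice[OF X fa dg(2) in_X(1)] notin unfolding a b1_def p_def by auto
  have fa1: "fpf (?X - {e, f}) ?a"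
    using fpf_diff[OF fa in_X(1)] by (simp add: a)
  have u2: "fpf (flags ?D) b2"
    "comps (?X - {e, f}) (gr (?X - {e, f}) ?a \<union> gr (?X - {e, f}) b1)
      = comps (flags ?D) (gr (flags ?D) ?a \<union> gr (flags ?D) b2)"
    using comps_unsplice[OF _ fa1 u1(1), of e'] X in_X ne notin b1
    unfolding a b2_def X2 by auto
  have "gr (flags ?D) (traverse ?S tw) = gr (flags ?D) ?a"
    by (rule gr_cong) (auto simp: traverse_def)
  with u1 u2 have F: "map_faces ?D ?S tw b2 = map_faces D S tw \<beta>"
    by (simp add: map_faces_def)
  have dg': "dart_graph ?D ?S tw"
  proof -
    have "dart_graph D ?S tw"
      using dart_graph_delete[OF dg(1), of "(x, y)"] by simp
    then show ?thesis
      by (rule dart_graph_subset)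
        (use dart_graph_dartD(3)[OF \<open>dart_graph D ?S tw\<close>] dart_graphD(2)[OF dg(1)] in blast)+
  qed
  have cross: "vtx (b2 u) = vtx u \<longleftrightarrow> u \<notin> {p, q, r, s}" if "u \<in> flags ?D" for u
  proof (cases "u \<in> {p, q, r, s}")
    case True
    then show ?thesis using b2 vp \<open>x \<noteq> y\<close> by auto
  next
    case False
    moreover have "u \<in> ?X" using that unfolding X2[symmetric] by blast
    ultimately show ?thesis using b2(5)[OF that] bv[of u] by simp
  qed
  have pm: "pinched_map x y ?D ?S tw b2"
    unfolding pinched_map_def
  proof (intro conjI ballI)
    fix u assume u: "u \<in> flags ?D"
    show "vtx (b2 u) = vtx u \<or> {vtx u, vtx (b2 u)} = {x, y}"
    proof (cases "u \<in> {p, q, r, s}")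
      case True
      then show ?thesis using b2 vp by auto
    next
      case False
      then show ?thesis using cross[OF u] by blast
    qed
  qed (use \<open>x \<noteq> y\<close> dg' u2(1) in blast)+
  have cr: "crossings x y ?D b2 = {p, q}"
  proof -
    have "u \<in> crossings x y ?D b2 \<longleftrightarrow> u \<in> {p, q}" for u
    proof (cases "u \<in> flags ?D")
      case True
      show ?thesis
      proof (cases "u \<in> {p, q, r, s}")
        case u: True
        then have "vtx u = x \<and> vtx (b2 u) = y \<longleftrightarrow> u \<in> {p, q}"
          using b2 vp \<open>x \<noteq> y\<close> by (elim insertE) auto
        with True show ?thesis unfolding crossings_def by blast
      next
        case False
        then show ?thesis using cross[OF True] \<open>x \<noteq> y\<close> unfolding crossings_def by auto
      qed
    next
      case False
      then show ?thesis using pqrs unfolding crossings_def by blast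
    qed
    then show ?thesis by blast
  qed
  \<comment> \<open>The two neighbours of the removed dart at x, and those at y, stay connected the
    other way round, so neither vertex falls apart.\<close>
  have path: "(\<beta> u, \<beta> (flip u)) \<in> conn (flags ?D) (corner_rel ?D b2)" if u: "u = e \<or> u = f" for u
  proof -
    let ?Z = "{w \<in> flags (D - {fst u}). vtx w = vtx u}"
    have Z: "?Z \<subseteq> flags ?D"
    proof
      fix w assume "w \<in> ?Z"
      then have w: "fst w \<in> D" "fst w \<noteq> fst u" "vtx w = vtx u"
        by (auto simp: mem_Times_iff)
      then have "fst w \<notin> {(x, y), (y, x)}"
        using u v fe \<open>x \<noteq> y\<close> by (metis empty_iff fst_conv insert_iff)
      with w show "w \<in> flags ?D" by (simp add: mem_Times_iff)
    qed
    have "(\<beta> u, \<beta> (flip u)) \<in> conn ?Z (gr ?Z flip \<union> gr (?Z - {\<beta> u, \<beta> (flip u)}) \<beta>)"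
      using detour_at_vertex(3)[OF dart_graphD(1)[OF dg(1)] dg(2,3), of u] u in_X be bf flips by auto
    then show ?thesis
    proof (rule conn_mono)
      fix w w' assume w: "(w, w') \<in> gr ?Z flip \<union> gr (?Z - {\<beta> u, \<beta> (flip u)}) \<beta>" "w \<in> ?Z" "w' \<in> ?Z"
      have "(w, w') \<in> corner_rel ?D b2"
      proof (cases "w' = flip w")
        case True
        then show ?thesis using w Z by (auto simp: corner_rel_def)
      next
        case False
        with w have w': "w' = \<beta> w" "w \<notin> {\<beta> u, \<beta> (flip u)}" by auto
        moreover have "w \<in> flags ?D" using w Z by blast
        moreover have "w \<notin> {p, q, r, s}"
          using u w' w(2) vp v \<open>x \<noteq> y\<close> flips by (auto simp: p_def q_def r_def s_def)
        ultimately show ?thesis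
          using b2(5)[of w] cross[of w] by (auto simp: corner_rel_def)
      qed
      then show "(w, w') \<in> conn (flags ?D) (corner_rel ?D b2)"
        using w Z by (intro conn_base) blast+
    qed (fact Z)
  qed
  then have pq: "(p, q) \<in> conn (flags ?D) (corner_rel ?D b2)" "(r, s) \<in> conn (flags ?D) (corner_rel ?D b2)"
    using path[of e] path[of f] flips by (simp_all add: p_def q_def r_def s_def)
  have "num_verts ?D b2 \<le> num_verts D \<beta>"
    unfolding num_verts_def
  proof (rule comps_le)
    \<comment> \<open>Flags of the removed edge are represented by the flags next to them.\<close>
    let ?g = "\<lambda>u. if u \<in> {e, e', f, f'} then \<beta> u else u"
    show g: "?g u \<in> flags ?D" if "u \<in> ?X" for u
    proof (cases "u \<in> {e, e', f, f'}")
      case True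
      then show ?thesis using pqrs unfolding p_def q_def r_def s_def by (elim insertE) simp_all
    next
      case False
      then show ?thesis using that unfolding X2[symmetric] by simp
    qed
    show "(?g u, ?g w) \<in> conn (flags ?D) (corner_rel ?D b2)"
      if uw: "(u, w) \<in> corner_rel D \<beta>" "u \<in> ?X" "w \<in> ?X" for u w
    proof -
      consider "w = flip u" "u \<in> {e, e', f, f'}" | "w = flip u" "u \<notin> {e, e', f, f'}" | "w = \<beta> u"
        using uw corner_rel_iff[of u w D \<beta>] by blast
      then show ?thesis
      proof cases
        case 1
        then show ?thesis
          using pq pq[THEN conn_sym] flips hv by (elim insertE) simp_all
      next
        case 2
        then have "w \<notin> {e, e', f, f'}"
          using flips by (metis flip_simps(3) insert_iff singletonD)
        then show ?thesis
          using g[OF uw(2)] g[OF uw(3)] 2 by (intro conn_base) (simp_all add: corner_rel_iff)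
      next
        case 3
        then show ?thesis
        proof (cases "u \<in> {e, e', f, f', p, q, r, s}")
          case True
          then have "?g u = ?g w"
            using 3 notin inv hv by (elim insertE) auto
          then show ?thesis
            using g[OF uw(2)] by (simp add: conn_refl)
        next
          case False
          moreover have "\<beta> w = u"
            using 3 fpfD(2)[OF dg(2) uw(2)] by simp
          ultimately have "w \<notin> {e, e', f, f'}"
            using hv by auto
          then show ?thesis
            using g[OF uw(2)] g[OF uw(3)] 3 False b2(5)[of u] cross[of u]
            by (intro conn_base) (simp_all add: corner_rel_iff)
        qed
      qed
    qed
    show "\<exists>u\<in>?X. (?g u, c) \<in> conn (flags ?D) (corner_rel ?D b2)" if c: "c \<in> flags ?D" for c
    proof (rule bexI[of _ c])
      have "c \<notin> {e, e', f, f'}"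
        using c unfolding X2[symmetric] by auto
      then show "(?g c, c) \<in> conn (flags ?D) (corner_rel ?D b2)"
        using c by (simp add: conn_refl)
    qed (use c in auto)
  qed (fact X)
  then have "num_verts ?D b2 = card (fst ` ?D)"
    using num_verts_ge[of ?D b2] dg(4) V dart_graphD(1)[OF dg'] by simp
  then have "contracted_map x y ?D ?S tw b2"
    unfolding contracted_map_def using pm cr dist by simp
  with F V show ?thesis by (intro that)
qed

text \<open>One side of the edge is spliced into each of the two crossing corners. The arcs at x and
  at y, which end at these corners, are thereby closed to cycles.\<close>

lemma uncontract_edge_map:
  assumes cm: "contracted_map x y D S tw \<beta>" and new: "(x, y) \<notin> D" "(y, x) \<notin> D"
  obtains \<beta>' tw' where "dart_map (D \<union> {(x, y), (y, x)}) (S \<union> {(x, y), (y, x)}) tw' \<beta>'"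
    "map_faces (D \<union> {(x, y), (y, x)}) (S \<union> {(x, y), (y, x)}) tw' \<beta>' = map_faces D S tw \<beta>"
    "fst ` (D \<union> {(x, y), (y, x)}) = fst ` D"
proof -
  let ?D = "D \<union> {(x, y), (y, x)}" and ?S = "S \<union> {(x, y), (y, x)}"
  \<comment> \<open>With signature -1, \<open>traverse\<close> keeps the bit, so that e meets f and
    e' meets f'.\<close>
  define tw' where "tw' = tw((x, y) := True, (y, x) := True)"
  let ?X = "flags D" and ?a = "traverse ?S tw'"
  have "x \<noteq> y" and dg: "dart_graph D S tw" and fb: "fpf ?X \<beta>"
    and bv: "\<And>u. u \<in> ?X \<Longrightarrow> vtx (\<beta> u) = vtx u \<or> {vtx u, vtx (\<beta> u)} = {x, y}"
    and K: "num_verts D \<beta> = card (fst ` D)" and cr2: "card (crossings x y D \<beta>) = 2"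
    using cm unfolding contracted_map_def pinched_map_def by blast+
  note X = flags_finite[OF dg]
  obtain p q where pq: "crossings x y D \<beta> = {p, q}" "p \<noteq> q"
    using cr2 unfolding card_2_iff by blast
  then have p: "p \<in> ?X" "vtx p = x" "vtx (\<beta> p) = y" and q: "q \<in> ?X" "vtx q = x" "vtx (\<beta> q) = y"
    by (auto simp: crossings_def)
  define r where "r = \<beta> p"
  define s where "s = \<beta> q"
  have rs: "r \<in> ?X" "s \<in> ?X" "\<beta> r = p" "\<beta> s = q" "vtx r = y" "vtx s = y"
    using fpfD[OF fb p(1)] fpfD[OF fb q(1)] p q by (auto simp: r_def s_def)
  have "r \<noteq> s" using rs pq(2) by auto
  have V: "fst ` ?D = fst ` D"
  proof -
    have "x \<in> fst ` D" "y \<in> fst ` D"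
      using imageI[OF p(1), of vtx] imageI[OF rs(1), of vtx] p(2) rs(5)
      unfolding vtx_image_flags by simp_all
    then show ?thesis by auto
  qed
  define e where "e = ((x, y), True)"
  define e' where "e' = ((x, y), False)"
  define f where "f = ((y, x), True)"
  define f' where "f' = ((y, x), False)"
  have nin: "e \<notin> ?X" "e' \<notin> ?X" "f \<notin> ?X" "f' \<notin> ?X"
    using new by (auto simp: e_def e'_def f_def f'_def)
  have ne: "e \<noteq> e'" "f \<noteq> f'" "e \<noteq> f" "e \<noteq> f'" "e' \<noteq> f" "e' \<noteq> f'"
    using \<open>x \<noteq> y\<close> by (auto simp: e_def e'_def f_def f'_def)
  have a: "?a e = f" "?a f = e" "?a e' = f'" "?a f' = e'"
    by (auto simp: e_def e'_def f_def f'_def traverse_def tw'_def)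
  have XE: "flags ?D = ?X \<union> {e, f} \<union> {e', f'}"
  proof (rule set_eqI)
    fix u :: "'a flag"
    obtain d b where "u = (d, b)" by (cases u)
    then show "u \<in> flags ?D \<longleftrightarrow> u \<in> ?X \<union> {e, f} \<union> {e', f'}"
      by (cases b) (auto simp: e_def e'_def f_def f'_def)
  qed
  have tr: "traverse ?S tw' u = traverse S tw u" if "u \<in> ?X" for u
  proof -
    have "fst u \<noteq> (x, y)" "fst u \<noteq> (y, x)"
      using that new by (metis mem_Times_iff)+
    then show ?thesis by (simp add: traverse_def tw'_def)
  qed
  have fa: "fpf ?X ?a"
  proof -
    have "fpf ?X ?a \<longleftrightarrow> fpf ?X (traverse S tw)"
      by (rule fpf_cong) (rule tr)
    then show ?thesis using fpf_traverse[OF dg] by (rule iffD2)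
  qed
  define b1 where "b1 = \<beta>(p := e, e := p, \<beta> p := f, f := \<beta> p)"
  define b2 where "b2 = b1(q := e', e' := q, b1 q := f', f' := b1 q)"
  have pq_ne: "p \<noteq> s" "r \<noteq> q" "p \<noteq> r" "q \<noteq> s"
    using p q rs \<open>x \<noteq> y\<close> by auto
  have b1q: "b1 q = s"
    using pq(2) pq_ne q(1) nin by (auto simp: b1_def r_def[symmetric] s_def)
  have ex: "p \<notin> {e, e', f, f'}" "q \<notin> {e, e', f, f'}" "r \<notin> {e, e', f, f'}" "s \<notin> {e, e', f, f'}"
    using p q rs nin by auto
  have b2: "b2 p = e" "b2 e = p" "b2 r = f" "b2 f = r" "b2 q = e'" "b2 e' = q" "b2 s = f'" "b2 f' = s"
    "u \<in> ?X \<Longrightarrow> u \<notin> {p, q, r, s} \<Longrightarrow> b2 u = \<beta> u" for u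
  proof -
    have 1: "b2 = \<beta>(p := e, e := p, r := f, f := r, q := e', e' := q, s := f', f' := s)"
      unfolding b2_def b1q by (simp add: b1_def r_def)
    show "b2 p = e" "b2 e = p" "b2 r = f" "b2 f = r" "b2 q = e'" "b2 e' = q" "b2 s = f'" "b2 f' = s"
      using ex pq_ne pq(2) \<open>r \<noteq> s\<close> ne unfolding 1 by auto
    assume "u \<in> ?X" "u \<notin> {p, q, r, s}"
    moreover have "u \<notin> {e, e', f, f'}"
      using calculation(1) nin by auto
    ultimately show "b2 u = \<beta> u"
      unfolding 1 by auto
  qed
  note s1 = comps_splice[where X = "flags D" and a = "traverse (S \<union> {(x, y), (y, x)}) tw'" and f = \<beta> and p = p and e = e and e' = f, OF X fa fb p(1) nin(1,3) ne(3) a(1,2), folded b1_def]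
  have fin1: "finite (?X \<union> {e, f})" using X by simp
  have fa1: "fpf (?X \<union> {e, f}) ?a"
    unfolding fpf_def
  proof
    fix u assume "u \<in> ?X \<union> {e, f}"
    then show "?a u \<in> ?X \<union> {e, f} \<and> ?a (?a u) = u \<and> ?a u \<noteq> u"
      using a ne fpfD[OF fa, of u] by auto
  qed
  have q1: "q \<in> ?X \<union> {e, f}" using q by simp
  have nin1: "e' \<notin> ?X \<union> {e, f}" "f' \<notin> ?X \<union> {e, f}" using nin ne by auto
  note s2 = comps_splice[where X = "flags D \<union> {e, f}" and a = "traverse (S \<union> {(x, y), (y, x)}) tw'" and f = b1 and p = q and e = e' and e' = f', OF fin1 fa1 s1(1) q1 nin1 ne(6) a(3,4), folded b2_def XE]
  have gr_eq: "gr ?X ?a = gr ?X (traverse S tw)"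
    using tr by (rule gr_cong)
  have F: "map_faces ?D ?S tw' b2 = map_faces D S tw \<beta>"
    unfolding map_faces_def gr_eq[symmetric] by (rule trans[OF s2(2) s1(2)])
  have dg': "dart_graph ?D ?S tw'"
  proof -
    have "tw' (prod.swap d) = tw' d" for d
    proof (cases "d \<in> {(x, y), (y, x)}")
      case True
      then have "d = (x, y) \<or> d = (y, x)" by blast
      moreover have "tw' (x, y)" "tw' (y, x)" by (simp_all add: tw'_def)
      ultimately show ?thesis by (elim disjE) simp_all
    next
      case False
      then have "prod.swap d \<notin> {(x, y), (y, x)}"
        by (cases d) auto
      with False have "tw' d = tw d" "tw' (prod.swap d) = tw (prod.swap d)"
        by (simp_all add: tw'_def)
      then show ?thesis using dart_graph_dartD(1)[OF dg, of d] by simp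
    qed
    moreover have "prod.swap d \<in> ?S" if "d \<in> ?S" for d
    proof (cases "d \<in> S")
      case True
      then show ?thesis using dart_graph_dartD(3)[OF dg] by blast
    next
      case False
      then show ?thesis using that by auto
    qed
    moreover have "fst d \<noteq> snd d" if "d \<in> ?D" for d
    proof (cases "d \<in> D")
      case True
      then show ?thesis using dart_graph_dartD(2)[OF dg] by blast
    next
      case False
      then show ?thesis using that \<open>x \<noteq> y\<close> by auto
    qed
    moreover have "finite ?D" "?S \<subseteq> ?D"
      using dart_graphD[OF dg] by auto
    ultimately show ?thesis
      unfolding dart_graph_def by blast
  qed
  \<comment> \<open>A crossing is recorded by its x-flag, and p and q are the only ones, so every
    other corner stays at its vertex.\<close>
  have same: "vtx (\<beta> u) = vtx u" if u: "u \<in> ?X" "u \<notin> {p, q, r, s}" for u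
  proof (rule ccontr)
    assume "vtx (\<beta> u) \<noteq> vtx u"
    then have "{vtx u, vtx (\<beta> u)} = {x, y}"
      using bv u by blast
    then have "u \<in> crossings x y D \<beta> \<or> \<beta> u \<in> crossings x y D \<beta>"
      using u(1) fpfD(1,2)[OF fb u(1)] unfolding crossings_def doubleton_eq_iff mem_Collect_eq by metis
    then have "\<beta> u \<in> {p, q}"
      using pq u by auto
    then show False
      using fpfD(2)[OF fb u(1)] u by (auto simp: r_def s_def)
  qed
  have v: "\<forall>u\<in>flags ?D. vtx (b2 u) = vtx u"
  proof
    fix u assume "u \<in> flags ?D"
    then consider "u \<in> {p, q, r, s}" | "u \<in> {e, e', f, f'}" | "u \<in> ?X" "u \<notin> {p, q, r, s}"
      unfolding XE by blast
    then show "vtx (b2 u) = vtx u"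
    proof cases
      case 1
      then show ?thesis
        using b2(1-8) p(2) q(2) rs(5,6) by (elim insertE) (auto simp: e_def e'_def f_def f'_def)
    next
      case 2
      then show ?thesis
        using b2(1-8) p(2) q(2) rs(5,6) by (elim insertE) (auto simp: e_def e'_def f_def f'_def)
    next
      case 3
      then show ?thesis using b2(9) same by simp
    qed
  qed
  have "num_verts ?D b2 \<le> num_verts D \<beta>"
    unfolding num_verts_def corner_rel_dart_map[OF v]
  proof (rule comps_le[where g = "\<lambda>u. u"])
    show "u \<in> flags ?D" if "u \<in> ?X" for u
      using that by auto
    fix u w assume uw: "(u, w) \<in> corner_rel D \<beta>" "u \<in> ?X" "w \<in> ?X"
    then consider "w = flip u" | "w = \<beta> u" "vtx (\<beta> u) = vtx u"
      using corner_rel_iff[of u w D \<beta>] by blast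
    then show "(u, w) \<in> conn (flags ?D) (gr (flags ?D) flip \<union> gr (flags ?D) b2)"
    proof cases
      case 1
      then show ?thesis using uw by (intro conn_base) (simp_all add: mem_Times_iff)
    next
      case 2
      then have "u \<notin> {p, q, r, s}"
        using p q rs \<open>x \<noteq> y\<close> by auto
      then show ?thesis using uw 2 b2(9) by (intro conn_base) (simp_all add: mem_Times_iff)
    qed
  next
    fix c assume c: "c \<in> flags ?D"
    show "\<exists>u\<in>?X. (u, c) \<in> conn (flags ?D) (gr (flags ?D) flip \<union> gr (flags ?D) b2)"
    proof (cases "c \<in> ?X")
      case True
      with c show ?thesis by (intro bexI[of _ c] conn_refl)
    next
      case False
      then have "c \<in> {e, e', f, f'}" using c unfolding XE by blast
      then have *: "b2 c \<in> ?X" "b2 (b2 c) = c"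
        using b2(1-8) p(1) q(1) rs(1,2) by auto
      then show ?thesis
        using c by (intro bexI[of _ "b2 c"] conn_base) (simp_all add: mem_Times_iff)
    qed
  qed (fact X)
  then have "num_verts ?D b2 = card (fst ` ?D)"
    using num_verts_ge[of ?D b2] K V dart_graphD(1)[OF dg'] by simp
  then have "dart_map ?D ?S tw' b2"
    unfolding dart_map_def using dg' s2(1) v by blast
  with F V show ?thesis by (intro that)
qed


section \<open>Separating two colours at the pinched vertex\<close>

text \<open>Only the corner matching varies; \<open>fl\<close> and \<open>al\<close> are fixed and
  stand for \<open>flip\<close> and \<open>traverse\<close>. Beyond being matchings, it matters only
  that \<open>fl\<close> keeps the vertex.\<close>

locale pinching =
  fixes X :: "'f set" and v :: "'f \<Rightarrow> 'v" and fl al :: "'f \<Rightarrow> 'f" and x y :: 'v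
  assumes finite_X: "finite X" and fpf_fl: "fpf X fl" and fpf_al: "fpf X al"
    and v_fl: "p \<in> X \<Longrightarrow> v (fl p) = v p" and x_ne_y: "x \<noteq> y"
begin

definition valid :: "('f \<Rightarrow> 'f) \<Rightarrow> bool" where
  "valid \<beta> \<longleftrightarrow> fpf X \<beta> \<and> (\<forall>p\<in>X. v (\<beta> p) = v p \<or> {v p, v (\<beta> p)} = {x, y})"

definition krel :: "('f \<Rightarrow> 'f) \<Rightarrow> 'f rel" where
  "krel \<beta> = gr X fl \<union> {(p, \<beta> p) | p. p \<in> X \<and> v (\<beta> p) = v p}"

definition kverts :: "('f \<Rightarrow> 'f) \<Rightarrow> nat" where
  "kverts \<beta> = comps X (krel \<beta>)"

definition nfaces :: "('f \<Rightarrow> 'f) \<Rightarrow> nat" where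
  "nfaces \<beta> = comps X (gr X al \<union> gr X \<beta>)"

definition cross :: "('f \<Rightarrow> 'f) \<Rightarrow> 'f set" where
  "cross \<beta> = {p \<in> X. v p = x \<and> v (\<beta> p) = y}"

text \<open>The number \<open>card (cross \<beta>)\<close> of crossing corners enters with weight one half; doubling
  keeps the potential integral.\<close>

definition potential :: "('f \<Rightarrow> 'f) \<Rightarrow> int" where
  "potential \<beta> = 2 * int (nfaces \<beta>) - 2 * int (kverts \<beta>) + int (card (cross \<beta>))"

text \<open>Symmetric in p and q, because after a re-pairing either flag of a pair may be the
  x-flag.\<close>

definition cr :: "'f \<Rightarrow> 'f \<Rightarrow> nat" where
  "cr p q = (if {v p, v q} = {x, y} then 1 else 0)"

lemma validD:
  assumes "valid \<beta>" "p \<in> X"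
  shows "\<beta> p \<in> X" "\<beta> (\<beta> p) = p" "\<beta> p \<noteq> p" "v (\<beta> p) = v p \<or> {v p, v (\<beta> p)} = {x, y}"
  using assms by (auto simp: valid_def fpf_def)

lemma krel_iff: "(p, q) \<in> krel \<beta> \<longleftrightarrow> p \<in> X \<and> (q = fl p \<or> q = \<beta> p \<and> v (\<beta> p) = v p)"
  by (auto simp: krel_def)

lemma finite_cross: "finite (cross \<beta>)"
  using finite_X by (simp add: cross_def)

lemma conn_krel_v: "(p, q) \<in> conn X (krel \<beta>) \<Longrightarrow> v p = v q"
  by (rule conn_invariant[where f = v]) (auto simp: krel_iff v_fl)

lemma switch_valid:
  assumes "valid \<beta>" "p \<in> X" "r \<in> X" "r \<noteq> p" "r \<noteq> \<beta> p"
    and "v r = v p \<or> {v p, v r} = {x, y}" "v (\<beta> r) = v (\<beta> p) \<or> {v (\<beta> p), v (\<beta> r)} = {x, y}"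
  shows "valid (switch \<beta> p r)"
  unfolding valid_def
proof (intro conjI ballI)
  have f: "fpf X \<beta>" using assms(1) by (simp add: valid_def)
  note sw = switch_simps[OF f assms(2-5)]
  show "fpf X (switch \<beta> p r)"
    using f assms(2-5) by (rule fpf_switch)
  fix u assume u: "u \<in> X"
  show "v (switch \<beta> p r u) = v u \<or> {v u, v (switch \<beta> p r u)} = {x, y}"
  proof (cases "u \<in> {p, r, \<beta> p, \<beta> r}")
    case True
    then show ?thesis using sw assms(6,7) by (elim insertE) (auto simp: insert_commute)
  next
    case False
    then show ?thesis using sw(5) validD(4)[OF assms(1) u] by simp
  qed
qed

section \<open>Effect of a re-pairing on the crossings\<close>

lemma card_cross_pair:
  assumes "valid \<beta>" "p \<in> X"
  shows "card (cross \<beta> \<inter> {p, \<beta> p}) = cr p (\<beta> p)"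
proof -
  note b = validD[OF assms]
  consider "v p = x" "v (\<beta> p) = y" | "v p = y" "v (\<beta> p) = x" | "{v p, v (\<beta> p)} \<noteq> {x, y}"
    by (auto simp: doubleton_eq_iff)
  then show ?thesis
  proof cases
    case 1
    then have "cross \<beta> \<inter> {p, \<beta> p} = {p}"
      using b assms(2) x_ne_y by (auto simp: cross_def)
    then show ?thesis using 1 by (simp add: cr_def)
  next
    case 2
    then have "cross \<beta> \<inter> {p, \<beta> p} = {\<beta> p}"
      using b assms(2) x_ne_y by (auto simp: cross_def)
    then show ?thesis using 2 by (simp add: cr_def insert_commute)
  next
    case 3
    then have "cross \<beta> \<inter> {p, \<beta> p} = {}"
      using b by (auto simp: cross_def)
    then show ?thesis using 3 by (simp add: cr_def)
  qed
qed

lemma card_cross_two_pairs: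
  assumes "valid \<beta>" "p \<in> X" "r \<in> X" "r \<noteq> p" "r \<noteq> \<beta> p"
  shows "card (cross \<beta>) = card (cross \<beta> - {p, \<beta> p, r, \<beta> r}) + cr p (\<beta> p) + cr r (\<beta> r)"
proof -
  have "\<beta> r \<noteq> \<beta> p"
    using assms validD(2)[OF assms(1)] by metis
  then have "{p, \<beta> p} \<inter> {r, \<beta> r} = {}"
    using assms validD[OF assms(1)] by auto
  then have disj: "(cross \<beta> \<inter> {p, \<beta> p}) \<inter> (cross \<beta> \<inter> {r, \<beta> r}) = {}"
    by blast
  have "cross \<beta> = (cross \<beta> - {p, \<beta> p, r, \<beta> r}) \<union> ((cross \<beta> \<inter> {p, \<beta> p}) \<union> (cross \<beta> \<inter> {r, \<beta> r}))"
    by blast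
  then have "card (cross \<beta>) = card (cross \<beta> - {p, \<beta> p, r, \<beta> r})
      + card ((cross \<beta> \<inter> {p, \<beta> p}) \<union> (cross \<beta> \<inter> {r, \<beta> r}))"
    using finite_cross[of \<beta>] card_Un_disjoint[of "cross \<beta> - {p, \<beta> p, r, \<beta> r}"
        "(cross \<beta> \<inter> {p, \<beta> p}) \<union> (cross \<beta> \<inter> {r, \<beta> r})"] by auto
  also have "card ((cross \<beta> \<inter> {p, \<beta> p}) \<union> (cross \<beta> \<inter> {r, \<beta> r})) = cr p (\<beta> p) + cr r (\<beta> r)"
    using disj card_cross_pair[OF assms(1,2)] card_cross_pair[OF assms(1,3)]
    by (simp add: card_Un_disjoint)
  finally show ?thesis by simp
qed

lemma card_cross_switch:
  assumes "valid \<beta>" "p \<in> X" "r \<in> X" "r \<noteq> p" "r \<noteq> \<beta> p" "valid (switch \<beta> p r)"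
  shows "card (cross (switch \<beta> p r)) + cr p (\<beta> p) + cr r (\<beta> r)
    = card (cross \<beta>) + cr p r + cr (\<beta> p) (\<beta> r)"
proof -
  let ?g = "switch \<beta> p r"
  have f: "fpf X \<beta>" using assms(1) by (simp add: valid_def)
  note sw = switch_simps[OF f assms(2-5)]
  note bp = validD[OF assms(1,2)] and br = validD[OF assms(1,3)]
  have "cross ?g - {p, r, \<beta> p, \<beta> r} = cross \<beta> - {p, \<beta> p, r, \<beta> r}"
    using sw(5) by (auto simp: cross_def)
  moreover have "\<beta> p \<noteq> r" "\<beta> p \<noteq> p"
    using assms(5) bp by auto
  ultimately show ?thesis
    using card_cross_two_pairs[OF assms(1-5)] card_cross_two_pairs[OF assms(6) assms(2) bp(1)] sw(1-4)
    by simp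
qed

text \<open>The loss of at most 2 is what one additional face will pay for. Restoring the removed
  non-crossing pairs to the new relation recovers all old connections, so K grows by at most the
  number of pairs that have to be restored.\<close>

lemma potential_cut:
  assumes "valid \<beta>" "p \<in> X" "r \<in> X" "r \<noteq> p" "r \<noteq> \<beta> p"
    and "v p \<in> {x, y}" "v (\<beta> p) \<in> {x, y}" "v r \<in> {x, y}" "v (\<beta> r) \<in> {x, y}"
  shows "valid (switch \<beta> p r)"
    and "2 * kverts (switch \<beta> p r) + card (cross \<beta>) \<le> 2 * kverts \<beta> + card (cross (switch \<beta> p r)) + 2"
proof -
  let ?g = "switch \<beta> p r"
  show val: "valid ?g"
    by (rule switch_valid) (use assms in auto)
  have f: "fpf X \<beta>" using assms(1) by (simp add: valid_def)
  note sw = switch_simps[OF f assms(2-5)]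
  note bp = validD[OF assms(1,2)] and br = validD[OF assms(1,3)]
  note cc = card_cross_switch[OF assms(1-5) val]
  let ?N = "krel ?g"
  have old: "(u, w) \<in> conn X R"
    if "(u, w) \<in> krel \<beta>" "u \<in> X" "w \<in> X" "?N \<subseteq> R"
      "v p = v (\<beta> p) \<Longrightarrow> (p, \<beta> p) \<in> conn X R" "v r = v (\<beta> r) \<Longrightarrow> (r, \<beta> r) \<in> conn X R" for u w R
  proof -
    from that(1) consider "w = fl u" | "w = \<beta> u" "v (\<beta> u) = v u" "u \<in> {p, r, \<beta> p, \<beta> r}"
      | "w = \<beta> u" "v (\<beta> u) = v u" "u \<notin> {p, r, \<beta> p, \<beta> r}"
      unfolding krel_iff by blast
    then show ?thesis
    proof cases
      case 1
      then have "(u, w) \<in> ?N" using that by (simp add: krel_iff)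
      then show ?thesis using that by (intro conn_base) auto
    next
      case 2
      then show ?thesis using that(5,6) bp br by (elim insertE) (auto intro: conn_sym)
    next
      case 3
      then have "(u, w) \<in> ?N" using that sw(5) by (simp add: krel_iff)
      then show ?thesis using that by (intro conn_base) auto
    qed
  qed
  have ins: "comps X R \<le> comps X (insert (a, b) R) + 1" if "a \<in> X" "b \<in> X" for a b R
    using finite_X that by (rule comps_insert_le)
  have v2: "v p = x \<or> v p = y" "v (\<beta> p) = x \<or> v (\<beta> p) = y" "v r = x \<or> v r = y" "v (\<beta> r) = x \<or> v (\<beta> r) = y"
    using assms(6-9) by auto
  have crs: "cr a b = (if v a = v b then 0 else 1)" if "v a = x \<or> v a = y" "v b = x \<or> v b = y" for a b
    using that x_ne_y by (auto simp: cr_def doubleton_eq_iff)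
  note crs = crs[OF v2(1,2)] crs[OF v2(3,4)] crs[OF v2(1,3)] crs[OF v2(2,4)]
  have le: "comps X R \<le> kverts \<beta>" if "?N \<subseteq> R"
    "v p = v (\<beta> p) \<Longrightarrow> (p, \<beta> p) \<in> conn X R" "v r = v (\<beta> r) \<Longrightarrow> (r, \<beta> r) \<in> conn X R" for R
    unfolding kverts_def using finite_X by (rule comps_antimono) (rule old, use that in auto)
  show "2 * kverts ?g + card (cross \<beta>) \<le> 2 * kverts \<beta> + card (cross ?g) + 2"
  proof (cases "v p = v (\<beta> p)"; cases "v r = v (\<beta> r)")
    assume A: "v p = v (\<beta> p)" "v r = v (\<beta> r)"
    show ?thesis
    proof (cases "v p = v r")
      case True
      \<comment> \<open>One pair is enough: both new pairs are non-crossing here, and together with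
        the pair of p they also connect r with \<beta> r.\<close>
      let ?R = "insert (p, \<beta> p) ?N"
      have base: "(p, \<beta> p) \<in> conn X ?R" "(p, r) \<in> conn X ?R" "(\<beta> p, \<beta> r) \<in> conn X ?R"
        using sw A True assms bp br by (auto intro!: conn_base simp: krel_iff)
      then have "(r, \<beta> r) \<in> conn X ?R"
        by (meson conn_sym conn_trans)
      then have "comps X ?R \<le> kverts \<beta>"
        using base by (intro le) auto
      then have "kverts ?g \<le> kverts \<beta> + 1"
        using ins[of p "\<beta> p" ?N] assms(2) bp by (simp add: kverts_def)
      then show ?thesis using cc crs A True by simp
    next
      case False
      \<comment> \<open>Two pairs may have to be restored, but both new pairs are crossings, and
        these compensate one of the two units of K.\<close>
      let ?R = "insert (r, \<beta> r) (insert (p, \<beta> p) ?N)"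
      have "comps X ?R \<le> kverts \<beta>"
        by (rule le) (use assms bp br in \<open>auto intro: conn_base\<close>)
      then have "kverts ?g \<le> kverts \<beta> + 2"
        using ins[of p "\<beta> p" ?N] ins[of r "\<beta> r" "insert (p, \<beta> p) ?N"] assms(2,3) bp br
        by (simp add: kverts_def)
      then show ?thesis using cc crs A False by simp
    qed
  next
    assume A: "v p = v (\<beta> p)" "v r \<noteq> v (\<beta> r)"
    have "comps X (insert (p, \<beta> p) ?N) \<le> kverts \<beta>"
      by (rule le) (use assms bp A in \<open>auto intro: conn_base\<close>)
    then have "kverts ?g \<le> kverts \<beta> + 1"
      using ins[of p "\<beta> p" ?N] assms(2) bp by (simp add: kverts_def)
    then show ?thesis using cc crs A v2 by (auto split: if_splits)
  next
    assume A: "v p \<noteq> v (\<beta> p)" "v r = v (\<beta> r)"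
    have "comps X (insert (r, \<beta> r) ?N) \<le> kverts \<beta>"
      by (rule le) (use assms br A in \<open>auto intro: conn_base\<close>)
    then have "kverts ?g \<le> kverts \<beta> + 1"
      using ins[of r "\<beta> r" ?N] assms(3) br by (simp add: kverts_def)
    then show ?thesis using cc crs A v2 by (auto split: if_splits)
  next
    \<comment> \<open>No non-crossing pair is removed, so K does not grow; at most two crossings are
      lost.\<close>
    assume A: "v p \<noteq> v (\<beta> p)" "v r \<noteq> v (\<beta> r)"
    have "comps X ?N \<le> kverts \<beta>"
      by (rule le) (use A in auto)
    then have "kverts ?g \<le> kverts \<beta>"
      by (simp add: kverts_def)
    then show ?thesis using cc crs A v2 by (auto split: if_splits)
  qed
qed

text \<open>A face that leaves C at p runs outside C until it enters C again, and Z is this stretch.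
  Matching its ends b and c closes Z to a face of its own, while \<beta> b and \<beta> c close the
  rest inside C.\<close>

lemma uncolour_step:
  assumes val: "valid \<beta>"
    and al_C: "\<And>p. p \<in> X \<Longrightarrow> al p \<in> C \<longleftrightarrow> p \<in> C"
    and C: "\<And>p. p \<in> X \<Longrightarrow> v p \<notin> {x, y} \<Longrightarrow> \<beta> p \<in> C \<longleftrightarrow> p \<in> C"
    and mixed: "p \<in> X" "p \<in> C" "\<beta> p \<notin> C"
  obtains \<beta>' where "valid \<beta>'" "\<And>p. p \<in> X \<Longrightarrow> v p \<notin> {x, y} \<Longrightarrow> \<beta>' p \<in> C \<longleftrightarrow> p \<in> C"
    "potential \<beta> \<le> potential \<beta>'"
    "card {p \<in> X. p \<in> C \<and> \<beta>' p \<notin> C} < card {p \<in> X. p \<in> C \<and> \<beta> p \<notin> C}"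
proof -
  have f: "fpf X \<beta>" using val by (simp add: valid_def)
  let ?Y = "X - C"
  \<comment> \<open>Corners are followed only between flags outside C, so the walk stops at mixed
    corners.\<close>
  define R where "R = gr ?Y al \<union> {(u, \<beta> u) | u. u \<in> ?Y \<and> \<beta> u \<in> ?Y}"
  define b where "b = \<beta> p"
  have b: "b \<in> ?Y" "\<beta> b = p"
    using validD[OF val mixed(1)] mixed by (auto simp: b_def)
  define Z where "Z = conn ?Y R `` {b}"
  have fin: "finite ?Y" using finite_X by simp
  have ZY: "Z \<subseteq> ?Y" by (auto simp: Z_def dest: conn_in)
  have bZ: "b \<in> Z" using b by (simp add: Z_def conn_refl)
  have alY: "fpf ?Y al"
    using fpf_al al_C by (auto simp: fpf_def)
  have al_conn: "(u, al u) \<in> conn ?Y R" if "u \<in> ?Y" for u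
    using that alY by (intro conn_base) (auto simp: R_def fpf_def)
  have b_conn: "(u, \<beta> u) \<in> conn ?Y R" if "u \<in> ?Y" "\<beta> u \<in> ?Y" for u
    using that by (intro conn_base) (auto simp: R_def)
  have alZ: "fpf Z al"
    unfolding Z_def using alY al_conn by (rule fpf_class)
  define E where "E = {u \<in> Z. \<beta> u \<in> C}"
  have closed: "\<beta> u \<in> Z" if "u \<in> Z - E" for u
  proof -
    have "u \<in> ?Y" "\<beta> u \<in> ?Y"
      using that ZY validD(1)[OF val] by (auto simp: E_def)
    then have "(u, \<beta> u) \<in> conn ?Y R" by (rule b_conn)
    with that show ?thesis by (auto simp: Z_def intro: conn_trans)
  qed
  have bE: "b \<in> E" using bZ b mixed by (simp add: E_def)
  have fE: "fpf (Z - E) \<beta>"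
    unfolding fpf_def
  proof
    fix u assume u: "u \<in> Z - E"
    then have "u \<in> X" using ZY by auto
    note bu = validD[OF val this]
    have "\<beta> u \<notin> E"
      using u ZY bu by (auto simp: E_def)
    with closed[OF u] bu show "\<beta> u \<in> Z - E \<and> \<beta> (\<beta> u) = u \<and> \<beta> u \<noteq> u" by simp
  qed
  have connZ: "(u, w) \<in> conn Z (gr Z al \<union> gr (Z - E) \<beta>)" if "u \<in> Z" "w \<in> Z" for u w
  proof -
    have *: "(b, u) \<in> conn Z (gr Z al \<union> gr (Z - E) \<beta>)" if "u \<in> Z" for u
    proof -
      have "(b, u) \<in> conn ?Y R" using that by (simp add: Z_def)
      then have "(b, u) \<in> conn Z R" unfolding Z_def by (rule conn_class)
      then show ?thesis
        by (rule conn_mono) (auto simp: R_def E_def intro!: conn_base)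
    qed
    from *[OF that(1)] *[OF that(2)] show ?thesis by (meson conn_sym conn_trans)
  qed
  have finZ: "finite Z" using fin ZY by (rule finite_subset[rotated])
  \<comment> \<open>E holds the ends of the stretch; it contains b, so there is exactly one further
    mixed corner c.\<close>
  have "card E = 0 \<or> card E = 2"
    by (rule path_two_ends[OF finZ _ alZ _ fE connZ]) (use bZ in \<open>auto simp: E_def\<close>)
  moreover have "finite E" using finZ by (simp add: E_def)
  ultimately have "card E = 2" using bE by auto
  then obtain c where c: "E = {b, c}" "c \<noteq> b"
    using bE unfolding card_2_iff by (metis doubleton_eq_iff insertE singletonD)
  then have cE: "c \<in> E" "c \<in> Z" "c \<in> X" "c \<notin> C" "\<beta> c \<in> C"
    using ZY by (auto simp: E_def)
  have bX: "b \<in> X" "b \<notin> C" using b by auto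
  have ne: "c \<noteq> b" "c \<noteq> \<beta> b" using c(2) cE b mixed by auto
  define g where "g = switch \<beta> b c"
  note sw = switch_simps[OF f bX(1) cE(3) ne, folded g_def]
  note bb = validD[OF val bX(1)] and bc = validD[OF val cE(3)]
  have vxy: "v u \<in> {x, y}" "v (\<beta> u) \<in> {x, y}" if "u \<in> X" "u \<notin> C" "\<beta> u \<in> C" for u
  proof -
    show "v u \<in> {x, y}" using C[OF that(1)] that by blast
    have "\<beta> u \<in> X" "\<beta> (\<beta> u) = u" using validD[OF val that(1)] by auto
    then show "v (\<beta> u) \<in> {x, y}" using C[of "\<beta> u"] that by auto
  qed
  have bC: "\<beta> b \<in> C" using b mixed by simp
  note cut = potential_cut[OF val bX(1) cE(3) ne vxy[OF bX bC] vxy[OF cE(3,4,5)], folded g_def]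
  have other: "u \<in> {b, c, \<beta> b, \<beta> c} \<Longrightarrow> g u \<in> C \<longleftrightarrow> u \<in> C" for u
    using sw(1-4) bX cE bC by (elim insertE) auto
  have "nfaces \<beta> + 1 \<le> nfaces g"
  proof -
    let ?G = "gr X al \<union> gr X g"
    have gZ: "u \<in> Z \<longleftrightarrow> g u \<in> Z" if "u \<in> X" for u
    proof (cases "u \<in> {b, c, \<beta> b, \<beta> c}")
      case True
      then show ?thesis using sw(1-4) bZ cE bC ZY by (elim insertE) auto
    next
      case False
      then have gu: "g u = \<beta> u" by (rule sw(5))
      show ?thesis
      proof
        assume "u \<in> Z"
        then show "g u \<in> Z" using False closed c gu by auto
      next
        assume "g u \<in> Z"
        moreover have "\<beta> u \<noteq> b" "\<beta> u \<noteq> c"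
          using False validD(2)[OF val that] by auto
        ultimately have "\<beta> (\<beta> u) \<in> Z" using gu closed c by auto
        then show "u \<in> Z" using validD(2)[OF val that] by simp
      qed
    qed
    have aZ: "u \<in> Z \<longleftrightarrow> al u \<in> Z" if "u \<in> X" for u
      using alZ fpfD(2)[OF fpf_al that] by (metis fpf_def)
    have "comps ((X - Z) \<union> Z) ?G = comps (X - Z) ?G + comps Z ?G"
      by (rule comps_disjoint) (use finite_X finZ gZ aZ in auto)
    moreover have "(X - Z) \<union> Z = X" using ZY by auto
    moreover have "comps Z ?G \<ge> 1" using finZ bZ by (intro comps_pos) auto
    \<comment> \<open>Every old face is still represented outside Z: the new pair of \<beta> b and
      \<beta> c bypasses the stretch, and \<beta> b stands for the flags of Z.\<close>
    moreover have "nfaces \<beta> \<le> comps (X - Z) ?G"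
      unfolding nfaces_def
    proof (rule comps_le[where g = "\<lambda>u. u"])
      let ?O = "gr X al \<union> gr X \<beta>"
      have ZX: "(u, w) \<in> conn X ?O" if "u \<in> Z" "w \<in> Z" for u w
        using connZ[OF that] by (rule conn_mono) (use ZY in \<open>auto intro!: conn_base\<close>)
      have bO: "(u, \<beta> u) \<in> conn X ?O" if "u \<in> X" for u
        using that validD(1)[OF val that] by (intro conn_base) auto
      fix u w assume uw: "(u, w) \<in> ?G" "u \<in> X - Z" "w \<in> X - Z"
      then consider "w = al u" | "w = g u" "u \<in> {b, c, \<beta> b, \<beta> c}" | "w = g u" "u \<notin> {b, c, \<beta> b, \<beta> c}"
        by auto
      then show "(u, w) \<in> conn X ?O"
      proof cases
        case 1
        then show ?thesis using uw by (intro conn_base) auto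
      next
        case 2
        have "(\<beta> b, \<beta> c) \<in> conn X ?O"
          using bO[OF bX(1)] bO[OF cE(3)] ZX[OF bZ cE(2)] by (meson conn_sym conn_trans)
        then show ?thesis using 2 uw bZ cE(2) sw(3,4) by (auto intro: conn_sym)
      next
        case 3
        then show ?thesis using uw sw(5)[of u] bO[of u] by auto
      qed
    next
      let ?O = "gr X al \<union> gr X \<beta>"
      fix w assume w: "w \<in> X"
      show "\<exists>u\<in>X - Z. (u, w) \<in> conn X ?O"
      proof (cases "w \<in> Z")
        case True
        then have "(b, w) \<in> conn X ?O"
          by (rule conn_mono[OF connZ[OF bZ]]) (use ZY in \<open>auto intro!: conn_base\<close>)
        moreover have "(\<beta> b, b) \<in> conn X ?O"
          using bX bb by (intro conn_base) auto
        ultimately have "(\<beta> b, w) \<in> conn X ?O" by (rule conn_trans[rotated])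
        moreover have "\<beta> b \<in> X - Z" using bb bC ZY by auto
        ultimately show ?thesis by blast
      next
        case False
        with w show ?thesis by (intro bexI[of _ w] conn_refl) auto
      qed
    qed (use finite_X in auto)
    ultimately show ?thesis by (simp add: nfaces_def)
  qed
  then have pot: "potential \<beta> \<le> potential g"
    using cut(2) unfolding potential_def by linarith
  have Cg: "g u \<in> C \<longleftrightarrow> u \<in> C" if "u \<in> X" "v u \<notin> {x, y}" for u
    using other[of u] sw(5)[of u] C[OF that] by (cases "u \<in> {b, c, \<beta> b, \<beta> c}") auto
  have "card {p \<in> X. p \<in> C \<and> g p \<notin> C} < card {p \<in> X. p \<in> C \<and> \<beta> p \<notin> C}"
  proof (rule psubset_card_mono)
    have "u \<in> {p \<in> X. p \<in> C \<and> \<beta> p \<notin> C}" if "u \<in> X" "u \<in> C" "g u \<notin> C" for u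
      using that other[of u] sw(5)[of u] by (cases "u \<in> {b, c, \<beta> b, \<beta> c}") auto
    moreover have "\<beta> b \<in> {p \<in> X. p \<in> C \<and> \<beta> p \<notin> C}"
      using bb bC bX by simp
    moreover have "g (\<beta> b) \<in> C"
      using sw(3) cE by simp
    ultimately show "{p \<in> X. p \<in> C \<and> g p \<notin> C} \<subset> {p \<in> X. p \<in> C \<and> \<beta> p \<notin> C}"
      by blast
  qed (use finite_X in simp)
  with cut(1) Cg pot show ?thesis by (intro that[of g])
qed

lemma uncolour:
  assumes "valid \<beta>"
    and "\<And>p. p \<in> X \<Longrightarrow> al p \<in> C \<longleftrightarrow> p \<in> C"
    and "\<And>p. p \<in> X \<Longrightarrow> v p \<notin> {x, y} \<Longrightarrow> \<beta> p \<in> C \<longleftrightarrow> p \<in> C"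
  shows "\<exists>\<beta>'. valid \<beta>' \<and> (\<forall>p\<in>X. \<beta>' p \<in> C \<longleftrightarrow> p \<in> C) \<and> potential \<beta> \<le> potential \<beta>'"
  using assms(1,3)
proof (induction "card {p \<in> X. p \<in> C \<and> \<beta> p \<notin> C}" arbitrary: \<beta> rule: less_induct)
  case less
  show ?case
  proof (cases "\<exists>p\<in>X. p \<in> C \<and> \<beta> p \<notin> C")
    case True
    then obtain p where p: "p \<in> X" "p \<in> C" "\<beta> p \<notin> C" by blast
    obtain \<beta>' where 1: "valid \<beta>'" "\<And>p. p \<in> X \<Longrightarrow> v p \<notin> {x, y} \<Longrightarrow> \<beta>' p \<in> C \<longleftrightarrow> p \<in> C"
      "potential \<beta> \<le> potential \<beta>'"
      "card {p \<in> X. p \<in> C \<and> \<beta>' p \<notin> C} < card {p \<in> X. p \<in> C \<and> \<beta> p \<notin> C}"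
      using uncolour_step[OF less.prems(1) assms(2) less.prems(2) p] by blast
    obtain \<beta>'' where "valid \<beta>''" "\<forall>p\<in>X. \<beta>'' p \<in> C \<longleftrightarrow> p \<in> C" "potential \<beta>' \<le> potential \<beta>''"
      using less.hyps[OF 1(4,1,2)] by blast
    with 1(3) show ?thesis by (intro exI[of _ \<beta>'']) auto
  next
    case False
    have "\<beta> p \<in> C \<longleftrightarrow> p \<in> C" if "p \<in> X" for p
      using False that validD[OF less.prems(1) that] by metis
    with less.prems show ?thesis by (intro exI[of _ \<beta>]) auto
  qed
qed

section \<open>Back to single vertices and exactly two crossings\<close>

lemma kverts_ge: "card (v ` X) \<le> kverts \<beta>"
  unfolding kverts_def using finite_X
  by (rule card_image_le_comps) (auto simp: krel_iff v_fl)

text \<open>Among the flags at x, \<open>fl\<close> matches all of them and \<beta> matches those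
  that are not crossings.\<close>

lemma even_card_cross:
  assumes "valid \<beta>"
  shows "even (card (cross \<beta>))"
proof -
  let ?A = "{u \<in> X. v u = x}"
  have fin: "finite ?A" using finite_X by simp
  have "fpf ?A fl"
    using fpf_fl v_fl by (auto simp: fpf_def)
  then have 1: "even (card ?A)" using fin by (rule fpf_even_card[rotated])
  have "fpf (?A - cross \<beta>) \<beta>"
    unfolding fpf_def
  proof
    fix u assume "u \<in> ?A - cross \<beta>"
    then have u: "u \<in> X" "v u = x" "v (\<beta> u) \<noteq> y" by (auto simp: cross_def)
    note bu = validD[OF assms u(1)]
    have "v (\<beta> u) = x" using u bu(4) by (auto simp: doubleton_eq_iff)
    then show "\<beta> u \<in> ?A - cross \<beta> \<and> \<beta> (\<beta> u) = u \<and> \<beta> u \<noteq> u"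
      using bu u x_ne_y by (auto simp: cross_def)
  qed
  then have "even (card (?A - cross \<beta>))" using fin by (intro fpf_even_card) auto
  moreover have "cross \<beta> \<subseteq> ?A" by (auto simp: cross_def)
  then have "card (?A - cross \<beta>) + card (cross \<beta>) = card ?A"
    using fin by (metis add.commute card_Diff_subset card_mono finite_cross le_add_diff_inverse)
  ultimately show ?thesis using 1 by (metis even_add)
qed

text \<open>A class of \<open>krel\<close> is a closed cycle or an arc of the pinched vertex. E
  holds the ends of the arc, that is, its flags at crossing corners.\<close>

lemma class_structure:
  assumes "valid \<beta>" "p \<in> X"
  defines "Z \<equiv> conn X (krel \<beta>) `` {p}"
  defines "E \<equiv> {u \<in> Z. v (\<beta> u) \<noteq> v u}"
  shows "Z \<subseteq> X" "p \<in> Z" "fpf Z fl" "fpf (Z - E) \<beta>" "card E = 0 \<or> card E = 2"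
proof -
  show ZX: "Z \<subseteq> X" by (auto simp: Z_def dest: conn_in)
  show pZ: "p \<in> Z" using assms(2) by (simp add: Z_def conn_refl)
  show fl: "fpf Z fl"
    unfolding Z_def using fpf_fl
  proof (rule fpf_class)
    fix u assume "u \<in> X"
    then show "(u, fl u) \<in> conn X (krel \<beta>)"
      using fpfD(1)[OF fpf_fl] by (intro conn_base) (auto simp: krel_iff)
  qed
  show b: "fpf (Z - E) \<beta>"
    unfolding fpf_def
  proof
    fix u assume u: "u \<in> Z - E"
    then have "u \<in> X" "v (\<beta> u) = v u" using ZX by (auto simp: E_def)
    note bu = validD[OF assms(1) this(1)]
    have "(u, \<beta> u) \<in> conn X (krel \<beta>)"
      using bu \<open>u \<in> X\<close> \<open>v (\<beta> u) = v u\<close> by (intro conn_base) (auto simp: krel_iff)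
    with u have "\<beta> u \<in> Z" by (auto simp: Z_def intro: conn_trans)
    then show "\<beta> u \<in> Z - E \<and> \<beta> (\<beta> u) = u \<and> \<beta> u \<noteq> u"
      using bu \<open>v (\<beta> u) = v u\<close> by (auto simp: E_def)
  qed
  have *: "(p, u) \<in> conn Z (gr Z fl \<union> gr (Z - E) \<beta>)" if "u \<in> Z" for u
  proof -
    have "(p, u) \<in> conn Z (krel \<beta>)"
      using that unfolding Z_def by (auto intro: conn_class)
    then show ?thesis
      by (rule conn_mono) (auto simp: krel_iff E_def intro!: conn_base)
  qed
  show "card E = 0 \<or> card E = 2"
  proof (rule path_two_ends[OF _ _ fl _ b])
    show "finite Z" using finite_X ZX by (rule finite_subset[rotated])
    fix u w assume "u \<in> Z" "w \<in> Z"
    from *[OF this(1)] *[OF this(2)] show "(u, w) \<in> conn Z (gr Z fl \<union> gr (Z - E) \<beta>)"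
      by (meson conn_sym conn_trans)
  qed (use pZ in \<open>auto simp: E_def\<close>)
qed

text \<open>In a closed cycle p and \<beta> p remain connected the long way round, as long as g
  alters no other corner of the cycle.\<close>

lemma class_detour:
  assumes "valid \<beta>" "p \<in> X"
    and "\<And>u. (p, u) \<in> conn X (krel \<beta>) \<Longrightarrow> v (\<beta> u) = v u"
    and "\<And>u. (p, u) \<in> conn X (krel \<beta>) \<Longrightarrow> u \<notin> {p, \<beta> p} \<Longrightarrow> g u = \<beta> u"
  shows "(p, \<beta> p) \<in> conn X (krel g)"
proof -
  let ?Z = "conn X (krel \<beta>) `` {p}"
  have "{u \<in> ?Z. v (\<beta> u) \<noteq> v u} = {}" using assms(3) by auto
  note Z = class_structure[OF assms(1,2), unfolded this]
  have b: "fpf ?Z \<beta>" using Z(4) by simp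
  have "(p, \<beta> p) \<in> conn ?Z (gr ?Z fl \<union> gr (?Z - {p, \<beta> p}) \<beta>)"
    using finite_subset[OF Z(1) finite_X] Z(3,2) fpf_diff[OF b Z(2)] by (rule path_ends_connected)
  then show ?thesis
  proof (rule conn_mono)
    fix u w assume uw: "(u, w) \<in> gr ?Z fl \<union> gr (?Z - {p, \<beta> p}) \<beta>" "u \<in> ?Z" "w \<in> ?Z"
    have "(u, w) \<in> krel g"
      using uw assms(3,4)[of u] Z(1) by (auto simp: krel_iff)
    then show "(u, w) \<in> conn X (krel g)"
      using uw Z(1) by (intro conn_base) auto
  qed (fact Z(1))
qed

lemma nfaces_switch:
  assumes "valid \<beta>" "p \<in> X" "r \<in> X" "r \<noteq> p" "r \<noteq> \<beta> p"
  shows "nfaces \<beta> \<le> nfaces (switch \<beta> p r) + 1"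
  unfolding nfaces_def using finite_X _ assms(2-)
  by (rule comps_switch_le) (use assms(1) in \<open>simp add: valid_def\<close>)

lemma krel_switch_cases:
  assumes "valid \<beta>" "p \<in> X" "r \<in> X" "r \<noteq> p" "r \<noteq> \<beta> p" "(u, w) \<in> krel \<beta>"
  obtains "(u, w) \<in> krel (switch \<beta> p r)"
  | "v (\<beta> p) = v p" "(u, w) = (p, \<beta> p) \<or> (u, w) = (\<beta> p, p)"
  | "v (\<beta> r) = v r" "(u, w) = (r, \<beta> r) \<or> (u, w) = (\<beta> r, r)"
proof -
  have f: "fpf X \<beta>" using assms(1) by (simp add: valid_def)
  note sw = switch_simps(5)[OF f assms(2-5), of u]
  note b = validD(2)[OF assms(1,2)] validD(2)[OF assms(1,3)]
  show ?thesis
  proof (cases "u \<in> {p, r, \<beta> p, \<beta> r} \<and> w = \<beta> u \<and> v (\<beta> u) = v u")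
    case True
    then show ?thesis using b that(2,3) by (elim conjE insertE) auto
  next
    case False
    then have "(u, w) \<in> krel (switch \<beta> p r)"
      using assms(6) sw by (auto simp: krel_iff)
    then show ?thesis by (rule that(1))
  qed
qed

text \<open>A corner at x and a corner at y are traded for two crossings. The two cycles are opened
  to arcs without falling apart, so K does not grow, and losing at most one face gives -2 + 2 =
  0.\<close>

lemma make_crossing:
  assumes "valid \<beta>" "cross \<beta> = {}" "x \<in> v ` X" "y \<in> v ` X"
  shows "\<exists>\<beta>'. valid \<beta>' \<and> potential \<beta> \<le> potential \<beta>' \<and> card (cross \<beta>') = 2"
proof -
  obtain p r where p: "p \<in> X" "v p = x" and r: "r \<in> X" "v r = y"
    using assms(3,4) by auto
  note b = validD[OF assms(1)]
  have same: "v (\<beta> u) = v u" if "u \<in> X" for u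
  proof (rule ccontr)
    assume "v (\<beta> u) \<noteq> v u"
    then have "u \<in> cross \<beta> \<or> \<beta> u \<in> cross \<beta>"
      using b[OF that] that by (auto simp: cross_def doubleton_eq_iff)
    then show False using assms(2) by simp
  qed
  have ne: "r \<noteq> p" "r \<noteq> \<beta> p" using p r same[OF p(1)] x_ne_y by auto
  let ?g = "switch \<beta> p r"
  have val: "valid ?g"
    using p r same[OF p(1)] same[OF r(1)] by (intro switch_valid[OF assms(1) p(1) r(1) ne]) auto
  have "card (cross ?g) = 2"
    using card_cross_switch[OF assms(1) p(1) r(1) ne val] assms(2) p r same x_ne_y
    by (simp add: cr_def)
  moreover have "kverts ?g \<le> kverts \<beta>"
    unfolding kverts_def using finite_X
  proof (rule comps_antimono)
    fix u w assume uw: "(u, w) \<in> krel \<beta>" "u \<in> X" "w \<in> X"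
    have f: "fpf X \<beta>" using assms(1) by (simp add: valid_def)
    note sw = switch_simps(5)[OF f p(1) r(1) ne]
    have "(p, \<beta> p) \<in> conn X (krel ?g)"
    proof (rule class_detour[OF assms(1) p(1)])
      fix u assume u: "(p, u) \<in> conn X (krel \<beta>)"
      then have "v u = x" "u \<in> X" using conn_krel_v[OF u] p conn_in[OF u] by auto
      then show "v (\<beta> u) = v u" by (intro same)
      assume "u \<notin> {p, \<beta> p}"
      then show "?g u = \<beta> u" using \<open>v u = x\<close> r same[OF r(1)] x_ne_y by (intro sw) auto
    qed
    moreover have "(r, \<beta> r) \<in> conn X (krel ?g)"
    proof (rule class_detour[OF assms(1) r(1)])
      fix u assume u: "(r, u) \<in> conn X (krel \<beta>)"
      then have "v u = y" "u \<in> X" using conn_krel_v[OF u] r conn_in[OF u] by auto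
      then show "v (\<beta> u) = v u" by (intro same)
      assume "u \<notin> {r, \<beta> r}"
      then show "?g u = \<beta> u" using \<open>v u = y\<close> p same[OF p(1)] x_ne_y by (intro sw) auto
    qed
    ultimately show "(u, w) \<in> conn X (krel ?g)"
      using uw by (cases rule: krel_switch_cases[OF assms(1) p(1) r(1) ne uw(1)])
        (auto intro: conn_base conn_sym)
  qed
  ultimately show ?thesis
    using val nfaces_switch[OF assms(1) p(1) r(1) ne] assms(2)
    by (intro exI[of _ ?g]) (auto simp: potential_def)
qed

text \<open>Matching the x-flags of two crossings, and likewise their y-flags, joins two arcs at x
  and two arcs at y. The saving in K pays for one lost face and two lost crossings: -2 + 4 - 2 =
  0.\<close>

lemma reduce_crossings_step:
  assumes "valid \<beta>" "2 < card (cross \<beta>)"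
  obtains \<beta>' where "valid \<beta>'" "potential \<beta> \<le> potential \<beta>'" "card (cross \<beta>') + 2 = card (cross \<beta>)"
proof -
  note b = validD[OF assms(1)]
  have "card (cross \<beta>) \<noteq> 3" using even_card_cross[OF assms(1)] by auto
  then have four: "4 \<le> card (cross \<beta>)" using assms(2) by simp
  obtain p where p: "p \<in> cross \<beta>"
    using assms(2) by (metis card.empty equals0I not_less_zero)
  then have pX: "p \<in> X" "v p = x" "v (\<beta> p) = y" by (auto simp: cross_def)
  let ?Z = "\<lambda>p. conn X (krel \<beta>) `` {p}" and ?E = "\<lambda>p. {u \<in> conn X (krel \<beta>) `` {p}. v (\<beta> u) \<noteq> v u}"
  let ?A = "{u \<in> cross \<beta>. u \<in> ?Z p}" and ?B = "{u \<in> cross \<beta>. \<beta> u \<in> ?Z (\<beta> p)}"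
  note bp = b[OF pX(1)]
  have finE: "finite (?E q)" for q
    by (rule finite_subset[OF _ finite_X]) (auto dest: conn_in)
  have "card ?A \<le> card (?E p)"
    using finE x_ne_y by (intro card_mono) (auto simp: cross_def)
  then have A: "card ?A \<le> 2" using class_structure(5)[OF assms(1) pX(1)] by linarith
  have "card ?B \<le> card (?E (\<beta> p))"
  proof (rule card_inj_on_le)
    show "inj_on \<beta> ?B"
      using b(2) by (intro inj_onI) (metis (no_types, lifting) cross_def mem_Collect_eq)
    show "\<beta> ` ?B \<subseteq> ?E (\<beta> p)"
      using b(2) x_ne_y by (auto simp: cross_def)
  qed (fact finE)
  then have B: "card ?B \<le> 2" using class_structure(5)[OF assms(1) bp(1)] by linarith
  have fin: "finite ?A" "finite ?B" using finite_cross by auto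
  \<comment> \<open>An arc has at most two ends, so at most two crossings touch the arc of p and at
    most two that of \<beta> p. Since p touches both, at most three crossings are excluded, and
    there are at least four.\<close>
  have "\<exists>r\<in>cross \<beta>. r \<notin> ?A \<and> r \<notin> ?B"
  proof -
    define A where "A = ?A"
    define B where "B = ?B"
    have "p \<in> A" "p \<in> B" using p pX bp by (simp_all add: A_def B_def conn_refl)
    moreover have fin': "finite A" "finite B" using fin by (simp_all only: A_def B_def)
    ultimately have "card {p} \<le> card (A \<inter> B)" by (intro card_mono) auto
    then have "card (A \<union> B) \<le> 3"
      using card_Un_Int[OF fin'] A B unfolding A_def[symmetric] B_def[symmetric] by simp
    then have "\<not> card (cross \<beta>) \<le> card (A \<union> B)" using four by simp
    then have "\<not> cross \<beta> \<subseteq> A \<union> B" using card_mono[of "A \<union> B" "cross \<beta>"] finite_UnI[OF fin'] by meson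
    then show ?thesis unfolding A_def[symmetric] B_def[symmetric] by blast
  qed
  then obtain r where r: "r \<in> cross \<beta>" "(p, r) \<notin> conn X (krel \<beta>)" "(\<beta> p, \<beta> r) \<notin> conn X (krel \<beta>)"
    by auto
  then have rX: "r \<in> X" "v r = x" "v (\<beta> r) = y" by (auto simp: cross_def)
  note br = b[OF rX(1)]
  have ne: "r \<noteq> p" "r \<noteq> \<beta> p" using r conn_refl[OF pX(1)] pX rX x_ne_y by auto
  let ?g = "switch \<beta> p r"
  have f: "fpf X \<beta>" using assms(1) by (simp add: valid_def)
  note sw = switch_simps[OF f pX(1) rX(1) ne]
  have val: "valid ?g"
    using pX rX by (intro switch_valid[OF assms(1) pX(1) rX(1) ne]) auto
  have card: "card (cross ?g) + 2 = card (cross \<beta>)"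
    using card_cross_switch[OF assms(1) pX(1) rX(1) ne val] pX rX x_ne_y
    by (simp add: cr_def)
  let ?R = "insert (p, r) (krel \<beta>)"
  \<comment> \<open>Joining arcs at x does not affect those at y, because a class never mixes vertex
    names.\<close>
  have "(\<beta> p, \<beta> r) \<notin> conn X ?R"
  proof
    assume "(\<beta> p, \<beta> r) \<in> conn X ?R"
    then have "(\<beta> p, p) \<in> conn X (krel \<beta>) \<or> (\<beta> p, r) \<in> conn X (krel \<beta>)"
      using conn_insert[OF _ pX(1) rX(1)] r(3) by blast
    then show False
      using conn_krel_v pX rX x_ne_y by metis
  qed
  then have "comps X (insert (\<beta> p, \<beta> r) ?R) + 1 \<le> comps X ?R"
    using finite_X bp br by (intro comps_insert_less)
  moreover have "comps X ?R + 1 \<le> kverts \<beta>"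
    unfolding kverts_def using finite_X pX(1) rX(1) r(2) by (rule comps_insert_less)
  moreover have "kverts ?g \<le> comps X (insert (\<beta> p, \<beta> r) ?R)"
    unfolding kverts_def using finite_X
  proof (rule comps_antimono)
    fix u w assume uw: "(u, w) \<in> insert (\<beta> p, \<beta> r) ?R" "u \<in> X" "w \<in> X"
    have "(u, w) \<in> krel ?g"
    proof (cases "(u, w) \<in> krel \<beta>")
      case True
      then show ?thesis
        by (cases rule: krel_switch_cases[OF assms(1) pX(1) rX(1) ne]) (use pX rX x_ne_y in auto)
    next
      case False
      then show ?thesis using uw sw pX rX by (auto simp: krel_iff)
    qed
    then show "(u, w) \<in> conn X (krel ?g)" using uw by (intro conn_base)
  qed
  ultimately have "kverts ?g + 2 \<le> kverts \<beta>" by linarith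
  then have "potential \<beta> \<le> potential ?g"
    using nfaces_switch[OF assms(1) pX(1) rX(1) ne] card unfolding potential_def by linarith
  with val card show ?thesis by (intro that)
qed

lemma reduce_crossings:
  assumes "valid \<beta>" "2 \<le> card (cross \<beta>)"
  shows "\<exists>\<beta>'. valid \<beta>' \<and> potential \<beta> \<le> potential \<beta>' \<and> card (cross \<beta>') = 2"
  using assms
proof (induction "card (cross \<beta>)" arbitrary: \<beta> rule: less_induct)
  case less
  show ?case
  proof (cases "card (cross \<beta>) = 2")
    case False
    then have "2 < card (cross \<beta>)" using less.prems by simp
    with less.prems(1) obtain \<beta>\<^sub>1 where 1: "valid \<beta>\<^sub>1" "potential \<beta> \<le> potential \<beta>\<^sub>1"
      "card (cross \<beta>\<^sub>1) + 2 = card (cross \<beta>)"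
      by (rule reduce_crossings_step)
    have "card (cross \<beta>) \<noteq> 3" using even_card_cross[OF less.prems(1)] by auto
    then have "2 \<le> card (cross \<beta>\<^sub>1)" using 1(3) \<open>2 < card (cross \<beta>)\<close> by simp
    moreover have "card (cross \<beta>\<^sub>1) < card (cross \<beta>)" using 1(3) by simp
    ultimately obtain \<beta>' where "valid \<beta>'" "potential \<beta>\<^sub>1 \<le> potential \<beta>'" "card (cross \<beta>') = 2"
      using less.hyps 1(1) by blast
    with 1(2) show ?thesis by (intro exI[of _ \<beta>']) auto
  qed (use less.prems in blast)
qed

text \<open>If two classes at one vertex were both arcs, they would have four ends, too many for two
  crossings. So one of them is a closed cycle; re-pairing it with the other merges them, and the
  drop of K makes up for a lost face.\<close>

lemma merge_vertices_step:
  assumes "valid \<beta>" "card (cross \<beta>) = 2" "card (v ` X) < kverts \<beta>"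
  obtains \<beta>' where "valid \<beta>'" "potential \<beta> \<le> potential \<beta>'" "card (cross \<beta>') = 2" "kverts \<beta>' < kverts \<beta>"
proof -
  note b = validD[OF assms(1)]
  let ?E = "\<lambda>p. {u \<in> conn X (krel \<beta>) `` {p}. v (\<beta> u) \<noteq> v u}"
  have "\<exists>p\<in>X. \<exists>r\<in>X. v p = v r \<and> (p, r) \<notin> conn X (krel \<beta>)"
  proof (rule ccontr)
    assume "\<not> ?thesis"
    then have *: "\<And>p r. p \<in> X \<Longrightarrow> r \<in> X \<Longrightarrow> v p = v r \<Longrightarrow> (p, r) \<in> conn X (krel \<beta>)" by blast
    have "comps X (krel \<beta>) \<le> comps (v ` X) {}"
    proof (rule comps_le[where g = "inv_into X v"])
      show "finite (v ` X)" using finite_X by simp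
      show "\<And>u. u \<in> v ` X \<Longrightarrow> inv_into X v u \<in> X" by (rule inv_into_into)
      fix c assume "c \<in> X"
      then show "\<exists>u\<in>v ` X. (inv_into X v u, c) \<in> conn X (krel \<beta>)"
        by (intro bexI[of _ "v c"] *) (auto simp: inv_into_into f_inv_into_f)
    qed simp
    then show False using assms(3) by (simp add: comps_empty_rel kverts_def)
  qed
  then obtain p0 r0 where pr0: "p0 \<in> X" "r0 \<in> X" "v p0 = v r0" "(p0, r0) \<notin> conn X (krel \<beta>)" by blast
  have "?E p0 = {} \<or> ?E r0 = {}"
  proof (rule ccontr)
    assume ne: "\<not> ?thesis"
    have fin: "finite (?E q)" for q
      by (rule finite_subset[OF _ finite_X]) (auto dest: conn_in)
    have "card (?E p0) = 2" "card (?E r0) = 2"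
      using ne class_structure(5)[OF assms(1) pr0(1)] class_structure(5)[OF assms(1) pr0(2)] fin by auto
    moreover have disj: "?E p0 \<inter> ?E r0 = {}"
      using pr0(4) by (auto dest: conn_sym intro: conn_trans)
    ultimately have four: "card (?E p0 \<union> ?E r0) = 4"
      using fin by (simp add: card_Un_disjoint)
    have ev: "v u = v p0 \<and> u \<in> X \<and> v (\<beta> u) \<noteq> v u" if "u \<in> ?E p0 \<union> ?E r0" for u
      using that pr0(3) by (auto dest: conn_krel_v conn_in)
    obtain u0 where u0: "u0 \<in> ?E p0" using ne by blast
    have xy: "v p0 = x \<or> v p0 = y"
      using ev[of u0] u0 b(4)[of u0] by (auto simp: doubleton_eq_iff)
    \<comment> \<open>Crossings are listed by x-flags. If the classes are at y, \<beta> carries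
      their ends to these x-flags.\<close>
    define h where "h = (if v p0 = x then id else \<beta>)"
    have "card (?E p0 \<union> ?E r0) \<le> card (cross \<beta>)"
    proof (rule card_inj_on_le)
      show "inj_on h (?E p0 \<union> ?E r0)"
      proof (rule inj_onI)
        fix u w assume uw: "u \<in> ?E p0 \<union> ?E r0" "w \<in> ?E p0 \<union> ?E r0" "h u = h w"
        have *: "\<beta> (\<beta> u) = u" "\<beta> (\<beta> w) = w" using ev[OF uw(1)] ev[OF uw(2)] b(2) by blast+
        show "u = w"
        proof (cases "v p0 = x")
          case False
          then have "\<beta> u = \<beta> w" using uw(3) by (simp add: h_def)
          then show ?thesis using * by metis
        qed (use uw(3) in \<open>simp add: h_def\<close>)
      qed
      show "h ` (?E p0 \<union> ?E r0) \<subseteq> cross \<beta>"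
      proof (rule image_subsetI)
        fix u assume uE: "u \<in> ?E p0 \<union> ?E r0"
        have u: "v u = v p0" "u \<in> X" "v (\<beta> u) \<noteq> v u" using ev[OF uE] by blast+
        then show "h u \<in> cross \<beta>"
          using xy b[OF u(2)] x_ne_y unfolding h_def cross_def by (auto simp: doubleton_eq_iff)
      qed
    qed (rule finite_cross)
    with four assms(2) show False by simp
  qed
  then obtain p r where p: "p \<in> X" "?E p = {}" and r: "r \<in> X" "v r = v p" "(p, r) \<notin> conn X (krel \<beta>)"
  proof (elim disjE)
    assume "?E p0 = {}"
    from that[OF pr0(1) this pr0(2) pr0(3)[symmetric] pr0(4)] show ?thesis .
  next
    assume E: "?E r0 = {}"
    have "(r0, p0) \<notin> conn X (krel \<beta>)" using pr0(4) conn_sym[of r0 p0 X "krel \<beta>"] by blast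
    from that[OF pr0(2) E pr0(1,3) this] show ?thesis .
  qed
  have closed: "v (\<beta> u) = v u" if "(p, u) \<in> conn X (krel \<beta>)" for u
    using p(2) that by auto
  have bconn: "(p, \<beta> u) \<in> conn X (krel \<beta>)" if "(p, u) \<in> conn X (krel \<beta>)" for u
  proof -
    have "u \<in> X" using conn_in[OF that] by simp
    then have "(u, \<beta> u) \<in> conn X (krel \<beta>)"
      using closed[OF that] b(1) by (intro conn_base) (auto simp: krel_iff)
    with that show ?thesis by (rule conn_trans)
  qed
  note bp = b[OF p(1)] and br = b[OF r(1)]
  have vb: "v (\<beta> p) = v p" using closed conn_refl[OF p(1)] by blast
  have pp: "(p, p) \<in> conn X (krel \<beta>)" using p(1) by (rule conn_refl)
  have ne: "r \<noteq> p" "r \<noteq> \<beta> p" using r(3) pp bconn[OF pp] by auto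
  let ?g = "switch \<beta> p r"
  have f: "fpf X \<beta>" using assms(1) by (simp add: valid_def)
  note sw = switch_simps[OF f p(1) r(1) ne]
  have val: "valid ?g"
    using vb r br by (intro switch_valid[OF assms(1) p(1) r(1) ne]) auto
  have card: "card (cross ?g) = 2"
    using card_cross_switch[OF assms(1) p(1) r(1) ne val] assms(2) vb r x_ne_y
    by (simp add: cr_def)
  have det: "(p, \<beta> p) \<in> conn X (krel ?g)"
    using assms(1) p(1) closed
  proof (rule class_detour)
    fix u assume u: "(p, u) \<in> conn X (krel \<beta>)" "u \<notin> {p, \<beta> p}"
    have "u \<noteq> r" using u(1) r(3) by auto
    moreover have "u \<noteq> \<beta> r" using bconn[OF u(1)] br(2) r(3) by auto
    ultimately show "?g u = \<beta> u" using u(2) by (intro sw(5)) auto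
  qed
  have prg: "(p, r) \<in> conn X (krel ?g)"
    using sw p r by (intro conn_base) (auto simp: krel_iff)
  have detr: "(r, \<beta> r) \<in> conn X (krel ?g)" if "v (\<beta> r) = v r"
  proof -
    have "(\<beta> p, \<beta> r) \<in> conn X (krel ?g)"
      using sw bp br that vb r by (intro conn_base) (auto simp: krel_iff)
    with det prg show ?thesis by (meson conn_sym conn_trans)
  qed
  have "kverts ?g \<le> comps X (insert (p, r) (krel \<beta>))"
    unfolding kverts_def using finite_X
  proof (rule comps_antimono)
    fix u w assume uw: "(u, w) \<in> insert (p, r) (krel \<beta>)" "u \<in> X" "w \<in> X"
    show "(u, w) \<in> conn X (krel ?g)"
    proof (cases "(u, w) \<in> krel \<beta>")
      case True
      then show ?thesis
        by (cases rule: krel_switch_cases[OF assms(1) p(1) r(1) ne])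
          (use uw det detr in \<open>auto intro: conn_base conn_sym\<close>)
    next
      case False
      then show ?thesis using uw prg by auto
    qed
  qed
  moreover have "comps X (insert (p, r) (krel \<beta>)) + 1 \<le> kverts \<beta>"
    unfolding kverts_def using finite_X p(1) r(1,3) by (rule comps_insert_less)
  ultimately have K: "kverts ?g + 1 \<le> kverts \<beta>" by linarith
  then have "potential \<beta> \<le> potential ?g"
    using nfaces_switch[OF assms(1) p(1) r(1) ne] card assms(2) unfolding potential_def by linarith
  with val card K show ?thesis by (intro that[of ?g]) auto
qed

lemma merge_vertices:
  assumes "valid \<beta>" "card (cross \<beta>) = 2"
  shows "\<exists>\<beta>'. valid \<beta>' \<and> potential \<beta> \<le> potential \<beta>' \<and> card (cross \<beta>') = 2 \<and> kverts \<beta>' = card (v ` X)"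
  using assms
proof (induction "kverts \<beta>" arbitrary: \<beta> rule: less_induct)
  case less
  show ?case
  proof (cases "kverts \<beta> = card (v ` X)")
    case False
    then have "card (v ` X) < kverts \<beta>" using kverts_ge[of \<beta>] by simp
    with less.prems obtain \<beta>\<^sub>1 where 1: "valid \<beta>\<^sub>1" "potential \<beta> \<le> potential \<beta>\<^sub>1"
      "card (cross \<beta>\<^sub>1) = 2" "kverts \<beta>\<^sub>1 < kverts \<beta>"
      by (rule merge_vertices_step)
    obtain \<beta>' where "valid \<beta>'" "potential \<beta>\<^sub>1 \<le> potential \<beta>'" "card (cross \<beta>') = 2" "kverts \<beta>' = card (v ` X)"
      using less.hyps[OF 1(4,1,3)] by blast
    with 1(2) show ?thesis by (intro exI[of _ \<beta>']) auto
  qed (use less.prems in blast)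
qed

lemma normalise:
  assumes "valid \<beta>" "x \<in> v ` X" "y \<in> v ` X"
  shows "\<exists>\<beta>'. valid \<beta>' \<and> potential \<beta> \<le> potential \<beta>' \<and> card (cross \<beta>') = 2 \<and> kverts \<beta>' = card (v ` X)"
proof -
  obtain \<beta>\<^sub>1 where 1: "valid \<beta>\<^sub>1" "potential \<beta> \<le> potential \<beta>\<^sub>1" "card (cross \<beta>\<^sub>1) = 2"
  proof (cases "cross \<beta> = {}")
    case True
    then show ?thesis using make_crossing[OF assms(1) _ assms(2,3)] that by blast
  next
    case False
    then have "card (cross \<beta>) \<noteq> 0" using finite_cross by simp
    moreover have "card (cross \<beta>) \<noteq> 1" using even_card_cross[OF assms(1)] by auto
    ultimately have "2 \<le> card (cross \<beta>)" by simp
    then show ?thesis using reduce_crossings[OF assms(1)] that by blast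
  qed
  obtain \<beta>' where "valid \<beta>'" "potential \<beta>\<^sub>1 \<le> potential \<beta>'" "card (cross \<beta>') = 2" "kverts \<beta>' = card (v ` X)"
    using merge_vertices[OF 1(1,3)] by blast
  with 1(2) show ?thesis by (intro exI[of _ \<beta>']) auto
qed

end


section \<open>Splitting and joining maps along an edge\<close>

text \<open>The \<open>potential\<close> of the locale \<open>pinching\<close>, restated outside it
  because it is compared across different sets of darts.\<close>

definition flag_potential ::
  "'v \<Rightarrow> 'v \<Rightarrow> ('v \<times> 'v) set \<Rightarrow> ('v \<times> 'v) set \<Rightarrow> ('v \<times> 'v \<Rightarrow> bool) \<Rightarrow> ('v flag \<Rightarrow> 'v flag) \<Rightarrow> int" where
  "flag_potential x y D S tw \<beta> = 2 * int (map_faces D S tw \<beta>) - 2 * int (num_verts D \<beta>)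
     + int (card (crossings x y D \<beta>))"

lemma pinched_mapD:
  assumes "pinched_map x y D S tw \<beta>"
  shows "x \<noteq> y" "dart_graph D S tw" "fpf (flags D) \<beta>"
    "p \<in> flags D \<Longrightarrow> vtx (\<beta> p) = vtx p \<or> {vtx p, vtx (\<beta> p)} = {x, y}"
  using assms unfolding pinched_map_def by blast+

lemma pinching_flags:
  assumes "dart_graph D S tw" "x \<noteq> y"
  shows "pinching (flags D) vtx flip (traverse S tw) x y"
  by unfold_locales (use assms fpf_flip fpf_traverse flags_finite in simp_all)

lemma pinching_flags_simps:
  assumes "dart_graph D S tw" "x \<noteq> y"
  shows "pinching.valid (flags D) vtx x y \<beta> \<longleftrightarrow> pinched_map x y D S tw \<beta>"
    "pinching.kverts (flags D) vtx flip \<beta> = num_verts D \<beta>"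
    "pinching.cross (flags D) vtx x y \<beta> = crossings x y D \<beta>"
    "pinching.potential (flags D) vtx flip (traverse S tw) x y \<beta> = flag_potential x y D S tw \<beta>"
proof -
  interpret pinching "flags D" vtx flip "traverse S tw" x y
    using assms by (rule pinching_flags)
  show v: "valid \<beta> \<longleftrightarrow> pinched_map x y D S tw \<beta>"
    using assms unfolding valid_def pinched_map_def by blast
  show k: "kverts \<beta> = num_verts D \<beta>"
    by (simp only: kverts_def krel_def num_verts_def corner_rel_def)
  show c: "cross \<beta> = crossings x y D \<beta>"
    by (simp only: cross_def crossings_def)
  show "potential \<beta> = flag_potential x y D S tw \<beta>"
    by (simp only: potential_def flag_potential_def nfaces_def map_faces_def k c)
qed

lemma pinched_normalise:
  assumes "pinched_map x y D S tw \<beta>" "x \<in> fst ` D" "y \<in> fst ` D"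
  shows "\<exists>\<beta>'. contracted_map x y D S tw \<beta>' \<and> flag_potential x y D S tw \<beta> \<le> flag_potential x y D S tw \<beta>'"
proof -
  note pm = pinched_mapD[OF assms(1)]
  interpret pinching "flags D" vtx flip "traverse S tw" x y
    using pm(2,1) by (rule pinching_flags)
  note eq = pinching_flags_simps[OF pm(2,1)]
  have "x \<in> vtx ` flags D" "y \<in> vtx ` flags D"
    using assms(2,3) unfolding vtx_image_flags .
  with assms(1) obtain \<beta>' where "valid \<beta>'" "potential \<beta> \<le> potential \<beta>'" "card (cross \<beta>') = 2"
    "kverts \<beta>' = card (vtx ` flags D)"
    using normalise[of \<beta>] eq(1) by blast
  then show ?thesis
    unfolding eq vtx_image_flags contracted_map_def by blast
qed

lemma pinched_uncolour:
  assumes "pinched_map x y D S tw \<beta>" "\<And>d. d \<in> S \<Longrightarrow> prod.swap d \<in> C \<longleftrightarrow> d \<in> C"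
    and "\<And>p. p \<in> flags D \<Longrightarrow> vtx p \<notin> {x, y} \<Longrightarrow> fst (\<beta> p) \<in> C \<longleftrightarrow> fst p \<in> C"
  shows "\<exists>\<beta>'. pinched_map x y D S tw \<beta>' \<and> (\<forall>p\<in>flags D. fst (\<beta>' p) \<in> C \<longleftrightarrow> fst p \<in> C) \<and>
    flag_potential x y D S tw \<beta> \<le> flag_potential x y D S tw \<beta>'"
proof -
  note pm = pinched_mapD[OF assms(1)]
  interpret pinching "flags D" vtx flip "traverse S tw" x y
    using pm(2,1) by (rule pinching_flags)
  note eq = pinching_flags_simps[OF pm(2,1)]
  have "\<exists>\<beta>'. valid \<beta>' \<and> (\<forall>p\<in>flags D. \<beta>' p \<in> flags C \<longleftrightarrow> p \<in> flags C) \<and> potential \<beta> \<le> potential \<beta>'"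
  proof (rule uncolour)
    show "valid \<beta>" using assms(1) eq(1) by blast
    show "traverse S tw p \<in> flags C \<longleftrightarrow> p \<in> flags C" if "p \<in> flags D" for p
      using assms(2)[of "fst p"] by (simp add: traverse_def mem_Times_iff)
    show "\<beta> p \<in> flags C \<longleftrightarrow> p \<in> flags C" if "p \<in> flags D" "vtx p \<notin> {x, y}" for p
      using assms(3)[OF that] by (simp add: mem_Times_iff)
  qed
  then show ?thesis
    unfolding eq by (simp add: mem_Times_iff)
qed

lemma comps_split:
  assumes "finite X" "Y \<subseteq> X" "\<And>u. u \<in> X \<Longrightarrow> a u \<in> Y \<longleftrightarrow> u \<in> Y" "\<And>u. u \<in> X \<Longrightarrow> b u \<in> Y \<longleftrightarrow> u \<in> Y"
  shows "comps X (gr X a \<union> {(p, b p) | p. p \<in> X \<and> P p})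
    = comps Y (gr Y a \<union> {(p, b p) | p. p \<in> Y \<and> P p})
      + comps (X - Y) (gr (X - Y) a \<union> {(p, b p) | p. p \<in> X - Y \<and> P p})"
proof -
  let ?R = "\<lambda>X. gr X a \<union> {(p, b p) | p. p \<in> X \<and> P p}"
  have R: "comps Z (?R X) = comps Z (?R Z)" if "Z \<subseteq> X" for Z
    by (rule comps_cong_conn) (use that assms(1) in \<open>auto intro!: conn_base intro: finite_subset\<close>)
  have XY: "Y \<union> (X - Y) = X" using assms(2) by blast
  have "comps (Y \<union> (X - Y)) (?R X) = comps Y (?R X) + comps (X - Y) (?R X)"
    by (rule comps_disjoint) (use assms in \<open>auto intro: finite_subset\<close>)
  then show ?thesis
    unfolding XY R[OF assms(2)] R[OF Diff_subset[of X Y]] .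
qed

lemma pinched_restrict:
  assumes "pinched_map x y D S tw \<beta>" "D' \<subseteq> D"
    and "\<And>d. d \<in> S \<Longrightarrow> prod.swap d \<in> D' \<longleftrightarrow> d \<in> D'"
    and "\<And>p. p \<in> flags D \<Longrightarrow> fst (\<beta> p) \<in> D' \<longleftrightarrow> fst p \<in> D'"
  shows "pinched_map x y D' (S \<inter> D') tw \<beta>"
  unfolding pinched_map_def
proof (intro conjI ballI)
  note pm = pinched_mapD[OF assms(1)]
  show "x \<noteq> y" by (fact pm(1))
  show "dart_graph D' (S \<inter> D') tw"
    using pm(2) by (rule dart_graph_subset) (use assms(2,3) dart_graph_dartD(3)[OF pm(2)] in auto)
  have sub: "flags D' \<subseteq> flags D" using assms(2) by blast
  show "fpf (flags D') \<beta>"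
    unfolding fpf_def
  proof
    fix p assume p: "p \<in> flags D'"
    then have pD: "p \<in> flags D" using sub by blast
    have "fst (\<beta> p) \<in> D'" using assms(4)[OF pD] p by (simp add: mem_Times_iff)
    then show "\<beta> p \<in> flags D' \<and> \<beta> (\<beta> p) = p \<and> \<beta> p \<noteq> p"
      using fpfD[OF pm(3) pD] by (simp add: mem_Times_iff)
  qed
  fix p assume "p \<in> flags D'"
  then show "vtx (\<beta> p) = vtx p \<or> {vtx p, vtx (\<beta> p)} = {x, y}"
    using sub by (intro pm(4)) blast
qed

lemma map_faces_cong:
  assumes "\<And>d. d \<in> D \<Longrightarrow> d \<in> S \<longleftrightarrow> d \<in> S'" "\<And>d. d \<in> S \<Longrightarrow> d \<in> D \<Longrightarrow> tw d = tw' d"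
    and "\<And>p. p \<in> flags D \<Longrightarrow> \<beta> p = \<beta>' p"
  shows "map_faces D S tw \<beta> = map_faces D S' tw' \<beta>'"
proof -
  have "traverse S tw p = traverse S' tw' p" if "p \<in> flags D" for p
    using that assms(1,2)[of "fst p"] by (simp add: traverse_def mem_Times_iff)
  then have "gr (flags D) (traverse S tw) = gr (flags D) (traverse S' tw')"
    by (rule gr_cong)
  moreover have "gr (flags D) \<beta> = gr (flags D) \<beta>'"
    using assms(3) by (rule gr_cong)
  ultimately show ?thesis by (simp only: map_faces_def)
qed

lemma corner_rel_cong:
  assumes "\<And>p. p \<in> flags D \<Longrightarrow> \<beta> p = \<beta>' p"
  shows "corner_rel D \<beta> = corner_rel D \<beta>'"
proof -
  have "(p, q) \<in> corner_rel D \<beta> \<longleftrightarrow> (p, q) \<in> corner_rel D \<beta>'" for p q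
    using assms[of p] unfolding corner_rel_iff by (cases "p \<in> flags D") simp_all
  then show ?thesis by (intro set_eqI) (metis surj_pair)
qed

lemma crossings_cong:
  assumes "\<And>p. p \<in> flags D \<Longrightarrow> \<beta> p = \<beta>' p"
  shows "crossings x y D \<beta> = crossings x y D \<beta>'"
  unfolding crossings_def by (rule Collect_cong) (metis assms)

lemma flag_potential_cong:
  assumes "\<And>d. d \<in> D \<Longrightarrow> d \<in> S \<longleftrightarrow> d \<in> S'" "\<And>d. d \<in> S \<Longrightarrow> d \<in> D \<Longrightarrow> tw d = tw' d"
    and "\<And>p. p \<in> flags D \<Longrightarrow> \<beta> p = \<beta>' p"
  shows "flag_potential x y D S tw \<beta> = flag_potential x y D S' tw' \<beta>'"
  unfolding flag_potential_def num_verts_def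
  by (simp only: map_faces_cong[OF assms] corner_rel_cong[OF assms(3)] crossings_cong[OF assms(3)])

text \<open>No edge and no corner leads from D' to the rest, so each face, each vertex class and
  each crossing lies on one side.\<close>

lemma flag_potential_split:
  assumes "pinched_map x y D S tw \<beta>" "D' \<subseteq> D"
    and "\<And>d. d \<in> S \<Longrightarrow> prod.swap d \<in> D' \<longleftrightarrow> d \<in> D'"
    and "\<And>p. p \<in> flags D \<Longrightarrow> fst (\<beta> p) \<in> D' \<longleftrightarrow> fst p \<in> D'"
  shows "flag_potential x y D S tw \<beta> = flag_potential x y D' (S \<inter> D') tw \<beta>
    + flag_potential x y (D - D') (S - D') tw \<beta>"
proof -
  note pm = pinched_mapD[OF assms(1)]
  let ?X = "flags D" and ?Y = "flags D'"
  have X: "finite ?X" using pm(2) by (rule flags_finite)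
  have Y: "?Y \<subseteq> ?X" using assms(2) by blast
  have XY: "?X - ?Y = flags (D - D')" by blast
  have tr: "traverse S tw u \<in> ?Y \<longleftrightarrow> u \<in> ?Y" for u
    using assms(3)[of "fst u"] by (simp add: traverse_def mem_Times_iff)
  have fl: "flip u \<in> ?Y \<longleftrightarrow> u \<in> ?Y" for u
    by (simp add: mem_Times_iff)
  have be: "\<beta> u \<in> ?Y \<longleftrightarrow> u \<in> ?Y" if "u \<in> ?X" for u
    using assms(4)[OF that] by (simp add: mem_Times_iff)
  have gr_alt: "gr Z \<beta> = {(p, \<beta> p) | p. p \<in> Z \<and> True}" for Z
    unfolding gr_def by simp
  have "map_faces D S tw \<beta> = map_faces D' S tw \<beta> + map_faces (D - D') S tw \<beta>"
    unfolding map_faces_def gr_alt XY[symmetric]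
    using X Y tr be by (rule comps_split)
  moreover have "map_faces D' S tw \<beta> = map_faces D' (S \<inter> D') tw \<beta>"
    by (rule map_faces_cong) auto
  moreover have "map_faces (D - D') S tw \<beta> = map_faces (D - D') (S - D') tw \<beta>"
    by (rule map_faces_cong) auto
  moreover have "num_verts D \<beta> = num_verts D' \<beta> + num_verts (D - D') \<beta>"
    unfolding num_verts_def corner_rel_def XY[symmetric]
    using X Y fl be by (rule comps_split)
  moreover have "card (crossings x y D \<beta>) = card (crossings x y D' \<beta>) + card (crossings x y (D - D') \<beta>)"
  proof -
    have "crossings x y D \<beta> = crossings x y D' \<beta> \<union> crossings x y (D - D') \<beta>"
      unfolding crossings_def XY[symmetric] using Y by blast
    moreover have "crossings x y D' \<beta> \<inter> crossings x y (D - D') \<beta> = {}"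
      unfolding crossings_def by blast
    moreover have "finite (crossings x y D \<beta>)"
      unfolding crossings_def using X by simp
    ultimately show ?thesis by (metis card_Un_disjoint finite_Un)
  qed
  ultimately show ?thesis
    unfolding flag_potential_def by simp
qed

text \<open>After normalisation the potential equals 2F - 2|V| + 2, and reinserting xy does not
  change F.\<close>

lemma pinched_uncontract:
  assumes "pinched_map x y D S tw \<beta>" "x \<in> fst ` D" "y \<in> fst ` D" "(x, y) \<notin> D" "(y, x) \<notin> D"
  obtains D' tw' \<beta>' where "dart_map D' (S \<union> {(x, y), (y, x)}) tw' \<beta>'" "fst ` D' = fst ` D"
    "flag_potential x y D S tw \<beta> \<le> 2 * int (map_faces D' (S \<union> {(x, y), (y, x)}) tw' \<beta>') - 2 * int (card (fst ` D)) + 2"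
proof -
  obtain \<beta>\<^sub>1 where 1: "contracted_map x y D S tw \<beta>\<^sub>1"
    "flag_potential x y D S tw \<beta> \<le> flag_potential x y D S tw \<beta>\<^sub>1"
    using pinched_normalise[OF assms(1-3)] by blast
  obtain \<beta>' tw' where 2: "dart_map (D \<union> {(x, y), (y, x)}) (S \<union> {(x, y), (y, x)}) tw' \<beta>'"
    "map_faces (D \<union> {(x, y), (y, x)}) (S \<union> {(x, y), (y, x)}) tw' \<beta>' = map_faces D S tw \<beta>\<^sub>1"
    "fst ` (D \<union> {(x, y), (y, x)}) = fst ` D"
    using uncontract_edge_map[OF 1(1) assms(4,5)] by blast
  have "num_verts D \<beta>\<^sub>1 = card (fst ` D)" "card (crossings x y D \<beta>\<^sub>1) = 2"
    using 1(1) by (simp_all add: contracted_map_def)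
  then have "flag_potential x y D S tw \<beta>\<^sub>1
      = 2 * int (map_faces (D \<union> {(x, y), (y, x)}) (S \<union> {(x, y), (y, x)}) tw' \<beta>') - 2 * int (card (fst ` D)) + 2"
    unfolding flag_potential_def 2(2) by simp
  with 1(2) have "flag_potential x y D S tw \<beta>
      \<le> 2 * int (map_faces (D \<union> {(x, y), (y, x)}) (S \<union> {(x, y), (y, x)}) tw' \<beta>') - 2 * int (card (fst ` D)) + 2"
    by simp
  with 2(1,3) show ?thesis by (rule that)
qed

text \<open>The half-edges towards l keep x and y among the vertices even if xy was their only dart.
  Since l is no vertex, they differ from the darts of xy.\<close>

lemma contract_with_hairs:
  assumes "dart_map D S tw \<beta>" "(x, y) \<in> S" "l \<notin> fst ` D"
  obtains D' \<beta>' where "contracted_map x y D' (S - {(x, y), (y, x)}) tw \<beta>'"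
    "map_faces D' (S - {(x, y), (y, x)}) tw \<beta>' = map_faces D S tw \<beta>" "fst ` D' = fst ` D"
    "D' = insert (x, l) (insert (y, l) D) - {(x, y), (y, x)}"
proof -
  note dg = dart_mapD(1)[OF assms(1)]
  have "(y, x) \<in> S" using dart_graph_dartD(3)[OF dg assms(2)] by simp
  then have xy: "(x, y) \<in> D" "(y, x) \<in> D" using assms(2) dart_graphD(2)[OF dg] by auto
  then have V: "x \<in> fst ` D" "y \<in> fst ` D" by force+
  then have ne: "x \<noteq> l" "y \<noteq> l" using assms(3) by auto
  obtain \<beta>\<^sub>1 where 1: "dart_map (insert (y, l) D) S tw \<beta>\<^sub>1"
    "map_faces (insert (y, l) D) S tw \<beta>\<^sub>1 = map_faces D S tw \<beta>"
    using dart_map_insert[OF assms(1), of "(y, l)"] V ne by auto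
  obtain \<beta>\<^sub>2 where 2: "dart_map (insert (x, l) (insert (y, l) D)) S tw \<beta>\<^sub>2"
    "map_faces (insert (x, l) (insert (y, l) D)) S tw \<beta>\<^sub>2 = map_faces D S tw \<beta>"
    using dart_map_insert[OF 1(1), of "(x, l)"] 1(2) V ne by auto
  let ?D = "insert (x, l) (insert (y, l) D)"
  obtain \<beta>' where "contracted_map x y (?D - {(x, y), (y, x)}) (S - {(x, y), (y, x)}) tw \<beta>'"
    "map_faces (?D - {(x, y), (y, x)}) (S - {(x, y), (y, x)}) tw \<beta>' = map_faces ?D S tw \<beta>\<^sub>2"
    "fst ` (?D - {(x, y), (y, x)}) = fst ` ?D"
    by (rule contract_edge_map[OF 2(1) assms(2), of "(x, l)" "(y, l)"]) (use ne in auto)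
  moreover have "fst ` ?D = fst ` D" using V by auto
  ultimately show ?thesis using 2(2) that by auto
qed

text \<open>The hard inequality, in terms of faces. The potential starts at 2F - 2|V| + 2 for the
  contracted map, is not lowered by uncolouring, splits into a sum over the two sides, and ends on
  each side at the same expression for that side. Since the two vertex counts add up to |V| + 2,
  this leaves an offset of one in the face counts.\<close>

lemma dart_map_split:
  fixes D S :: "(nat \<times> nat) set"
  assumes dm: "dart_map D (S\<^sub>1 \<union> S\<^sub>2) tw \<beta>"
    and V: "fst ` D = V\<^sub>1 \<union> V\<^sub>2" "V\<^sub>1 \<inter> V\<^sub>2 = {x, y}"
    and S: "S\<^sub>1 \<subseteq> V\<^sub>1 \<times> V\<^sub>1" "S\<^sub>2 \<subseteq> V\<^sub>2 \<times> V\<^sub>2" "(x, y) \<in> S\<^sub>1" "(x, y) \<in> S\<^sub>2"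
    and sym: "\<And>d. d \<in> S\<^sub>1 \<Longrightarrow> prod.swap d \<in> S\<^sub>1" "\<And>d. d \<in> S\<^sub>2 \<Longrightarrow> prod.swap d \<in> S\<^sub>2"
  obtains D\<^sub>1 tw\<^sub>1 \<beta>\<^sub>1 D\<^sub>2 tw\<^sub>2 \<beta>\<^sub>2 where
    "dart_map D\<^sub>1 S\<^sub>1 tw\<^sub>1 \<beta>\<^sub>1" "fst ` D\<^sub>1 = V\<^sub>1" "dart_map D\<^sub>2 S\<^sub>2 tw\<^sub>2 \<beta>\<^sub>2" "fst ` D\<^sub>2 = V\<^sub>2"
    "map_faces D (S\<^sub>1 \<union> S\<^sub>2) tw \<beta> + 1 \<le> map_faces D\<^sub>1 S\<^sub>1 tw\<^sub>1 \<beta>\<^sub>1 + map_faces D\<^sub>2 S\<^sub>2 tw\<^sub>2 \<beta>\<^sub>2"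
proof -
  let ?S = "S\<^sub>1 \<union> S\<^sub>2" and ?e = "{(x, y), (y, x)}"
  note dg = dart_mapD(1)[OF dm]
  have finV: "finite (V\<^sub>1 \<union> V\<^sub>2)"
    using dart_graphD(1)[OF dg] V(1) by (metis finite_imageI)
  obtain l where l: "l \<notin> V\<^sub>1 \<union> V\<^sub>2"
    using ex_new_if_finite[OF infinite_UNIV_nat finV] by blast
  obtain l' where l': "l' \<notin> insert l (V\<^sub>1 \<union> V\<^sub>2)"
    using ex_new_if_finite[OF infinite_UNIV_nat, of "insert l (V\<^sub>1 \<union> V\<^sub>2)"] finV by auto
  have xy: "x \<in> V\<^sub>1" "x \<in> V\<^sub>2" "y \<in> V\<^sub>1" "y \<in> V\<^sub>2" using V(2) by auto
  then have ne: "x \<noteq> l'" "y \<noteq> l'" "x \<noteq> l" "y \<noteq> l" "l \<noteq> l'" using l l' by auto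
  have "x \<noteq> y"
    using dart_graph_dartD(2)[OF dg, of "(x, y)"] dart_graphD(2)[OF dg] S(3) by auto
  obtain \<beta>\<^sub>a where a: "dart_map (insert (x, l') D) ?S tw \<beta>\<^sub>a"
    "map_faces (insert (x, l') D) ?S tw \<beta>\<^sub>a = map_faces D ?S tw \<beta>"
    using dart_map_insert[OF dm, of "(x, l')"] V xy ne by auto
  \<comment> \<open>The vertices of a side are read off its darts, so each side needs its own darts
    at x and y: l' provides them for the second side, and l, added with the contraction, for the
    first.\<close>
  let ?D0 = "insert (y, l') (insert (x, l') D)"
  obtain \<beta>\<^sub>b where b: "dart_map ?D0 ?S tw \<beta>\<^sub>b" "map_faces ?D0 ?S tw \<beta>\<^sub>b = map_faces D ?S tw \<beta>"
    using dart_map_insert[OF a(1), of "(y, l')"] a(2) V xy ne by auto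
  have V0: "fst ` ?D0 = V\<^sub>1 \<union> V\<^sub>2" using V xy by auto
  obtain D' \<beta>\<^sub>c where c: "contracted_map x y D' (?S - ?e) tw \<beta>\<^sub>c"
    "map_faces D' (?S - ?e) tw \<beta>\<^sub>c = map_faces D ?S tw \<beta>" "fst ` D' = V\<^sub>1 \<union> V\<^sub>2"
    "D' = insert (x, l) (insert (y, l) ?D0) - ?e"
    using contract_with_hairs[OF b(1), of x y l] S(3) l b(2) unfolding V0 by auto
  have pm: "pinched_map x y D' (?S - ?e) tw \<beta>\<^sub>c"
    using c(1) by (simp add: contracted_map_def)
  \<comment> \<open>C is the colour of the first side. Away from x and y it depends on the vertex
    alone, so no corner is mixed there; at x and y the other end of the dart decides.\<close>
  define C where "C = {d. fst d \<in> V\<^sub>1 - {x, y} \<or> fst d \<in> {x, y} \<and> snd d \<in> insert l V\<^sub>1}"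
  have C1: "d \<in> C" if "d \<in> S\<^sub>1" for d
    using that S(1) unfolding C_def by auto
  have C2: "d \<notin> C" if d: "d \<in> S\<^sub>2" "d \<notin> ?e" for d
  proof
    assume dC: "d \<in> C"
    have mem: "fst d \<in> V\<^sub>2" "snd d \<in> V\<^sub>2" using d(1) S(2) by auto
    have "fst d \<in> {x, y}" using dC mem(1) V(2) unfolding C_def by blast
    moreover have "snd d \<in> {x, y}"
      using dC mem V(2) l unfolding C_def by blast
    moreover have "fst d \<noteq> snd d"
      using dart_graph_dartD(2)[OF dg, of d] dart_graphD(2)[OF dg] d(1) by blast
    ultimately show False using d(2) by (cases d) auto
  qed
  have swapC: "prod.swap d \<in> C \<longleftrightarrow> d \<in> C" if d: "d \<in> ?S - ?e" for d
  proof -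
    have "prod.swap d \<notin> ?e" using d by (cases d) auto
    then show ?thesis using d C1 C2 sym by blast
  qed
  obtain \<beta>' where \<beta>': "pinched_map x y D' (?S - ?e) tw \<beta>'" "\<forall>p\<in>flags D'. fst (\<beta>' p) \<in> C \<longleftrightarrow> fst p \<in> C"
    "flag_potential x y D' (?S - ?e) tw \<beta>\<^sub>c \<le> flag_potential x y D' (?S - ?e) tw \<beta>'"
  proof -
    have "\<exists>\<beta>'. pinched_map x y D' (?S - ?e) tw \<beta>' \<and> (\<forall>p\<in>flags D'. fst (\<beta>' p) \<in> C \<longleftrightarrow> fst p \<in> C) \<and>
      flag_potential x y D' (?S - ?e) tw \<beta>\<^sub>c \<le> flag_potential x y D' (?S - ?e) tw \<beta>'"
    proof (rule pinched_uncolour[OF pm swapC])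
      fix p :: "nat flag" assume p: "p \<in> flags D'" "vtx p \<notin> {x, y}"
      then have "vtx (\<beta>\<^sub>c p) = vtx p"
        using pinched_mapD(4)[OF pm p(1)] by auto
      then show "fst (\<beta>\<^sub>c p) \<in> C \<longleftrightarrow> fst p \<in> C"
        using p(2) by (simp add: C_def)
    qed
    then show ?thesis using that by blast
  qed
  let ?D1 = "D' \<inter> C" and ?D2 = "D' - D' \<inter> C"
  have SD: "?S - ?e \<subseteq> D'"
    using dart_graphD(2)[OF pinched_mapD(2)[OF pm]] .
  have swap1: "prod.swap d \<in> ?D1 \<longleftrightarrow> d \<in> ?D1" if d: "d \<in> ?S - ?e" for d
    using swapC[OF d] d SD dart_graph_dartD(3)[OF pinched_mapD(2)[OF pm] d] by blast
  have inD: "fst (\<beta>' p) \<in> D'" if "p \<in> flags D'" for p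
    using fpfD(1)[OF pinched_mapD(3)[OF \<beta>'(1)] that] by (simp add: mem_Times_iff)
  have b1: "fst (\<beta>' p) \<in> ?D1 \<longleftrightarrow> fst p \<in> ?D1" if "p \<in> flags D'" for p
    using bspec[OF \<beta>'(2) that] inD[OF that] that by (simp add: mem_Times_iff)
  have b2: "fst (\<beta>' p) \<in> ?D2 \<longleftrightarrow> fst p \<in> ?D2" if "p \<in> flags D'" for p
    using bspec[OF \<beta>'(2) that] inD[OF that] that by (simp add: mem_Times_iff)
  have swap2: "prod.swap d \<in> ?D2 \<longleftrightarrow> d \<in> ?D2" if d: "d \<in> ?S - ?e" for d
    using swapC[OF d] d SD dart_graph_dartD(3)[OF pinched_mapD(2)[OF pm] d] by blast
  have S1: "(?S - ?e) \<inter> ?D1 = S\<^sub>1 - ?e"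
    using C1 C2 SD by blast
  have S2: "(?S - ?e) - ?D1 = S\<^sub>2 - ?e" "(?S - ?e) \<inter> ?D2 = S\<^sub>2 - ?e"
  proof -
    have "d \<in> ?e" if "d \<in> S\<^sub>1" "d \<in> S\<^sub>2" for d
      using C1[OF that(1)] C2[OF that(2)] by blast
    then show "(?S - ?e) - ?D1 = S\<^sub>2 - ?e" "(?S - ?e) \<inter> ?D2 = S\<^sub>2 - ?e"
      using C1 C2 SD by blast+
  qed
  have pm1: "pinched_map x y ?D1 (S\<^sub>1 - ?e) tw \<beta>'"
    using pinched_restrict[OF \<beta>'(1) _ swap1 b1] S1 by auto
  have pm2: "pinched_map x y ?D2 (S\<^sub>2 - ?e) tw \<beta>'"
    using pinched_restrict[OF \<beta>'(1) _ swap2 b2] S2 by auto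
  have pot: "flag_potential x y D' (?S - ?e) tw \<beta>' = flag_potential x y ?D1 (S\<^sub>1 - ?e) tw \<beta>'
      + flag_potential x y ?D2 (S\<^sub>2 - ?e) tw \<beta>'"
    using flag_potential_split[OF \<beta>'(1) _ swap1 b1] S1 S2 by auto
  have hairs: "(x, l) \<in> D'" "(y, l) \<in> D'" "(x, l') \<in> D'" "(y, l') \<in> D'"
    using ne unfolding c(4) by auto
  have V1: "fst ` ?D1 = V\<^sub>1"
  proof
    show "fst ` ?D1 \<subseteq> V\<^sub>1" using xy unfolding C_def by auto
    show "V\<^sub>1 \<subseteq> fst ` ?D1"
    proof
      fix u assume u: "u \<in> V\<^sub>1"
      show "u \<in> fst ` ?D1"
      proof (cases "u \<in> {x, y}")
        case True
        then have "(u, l) \<in> ?D1" using hairs unfolding C_def by auto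
        then show ?thesis by force
      next
        case False
        obtain d where "d \<in> D'" "fst d = u" using u c(3) by (metis UnCI imageE)
        then have "d \<in> ?D1" using u False unfolding C_def by auto
        with \<open>fst d = u\<close> show ?thesis by blast
      qed
    qed
  qed
  have V2: "fst ` ?D2 = V\<^sub>2"
  proof
    show "fst ` ?D2 \<subseteq> V\<^sub>2"
    proof (rule image_subsetI)
      fix d assume d: "d \<in> ?D2"
      then have "fst d \<in> V\<^sub>1 \<union> V\<^sub>2" using c(3) by blast
      moreover have "fst d \<notin> V\<^sub>1 - {x, y}" using d unfolding C_def by blast
      ultimately show "fst d \<in> V\<^sub>2" using xy by blast
    qed
    show "V\<^sub>2 \<subseteq> fst ` ?D2"
    proof
      fix u assume u: "u \<in> V\<^sub>2"
      show "u \<in> fst ` ?D2"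
      proof (cases "u \<in> {x, y}")
        case True
        then have "(u, l') \<in> ?D2" using hairs l' ne unfolding C_def by auto
        then show ?thesis by force
      next
        case False
        obtain d where "d \<in> D'" "fst d = u" using u c(3) by (metis UnCI imageE)
        moreover have "u \<notin> V\<^sub>1" using u False V(2) by blast
        ultimately have "d \<in> ?D2" using False unfolding C_def by auto
        with \<open>fst d = u\<close> show ?thesis by blast
      qed
    qed
  qed
  have ex1: "x \<in> fst ` ?D1" "y \<in> fst ` ?D1" and ex2: "x \<in> fst ` ?D2" "y \<in> fst ` ?D2"
    unfolding V1 V2 using xy by auto
  have nin1: "(x, y) \<notin> ?D1" "(y, x) \<notin> ?D1" and nin2: "(x, y) \<notin> ?D2" "(y, x) \<notin> ?D2"
    unfolding c(4) by auto
  have "(y, x) \<in> S\<^sub>1" "(y, x) \<in> S\<^sub>2" using sym[of "(x, y)"] S(3,4) by auto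
  then have e1: "S\<^sub>1 - ?e \<union> ?e = S\<^sub>1" and e2: "S\<^sub>2 - ?e \<union> ?e = S\<^sub>2" using S(3,4) by auto
  obtain D\<^sub>1 tw\<^sub>1 \<beta>\<^sub>1 where 1: "dart_map D\<^sub>1 S\<^sub>1 tw\<^sub>1 \<beta>\<^sub>1" "fst ` D\<^sub>1 = V\<^sub>1"
    "flag_potential x y ?D1 (S\<^sub>1 - ?e) tw \<beta>' \<le> 2 * int (map_faces D\<^sub>1 S\<^sub>1 tw\<^sub>1 \<beta>\<^sub>1) - 2 * int (card V\<^sub>1) + 2"
    using pinched_uncontract[OF pm1 ex1 nin1] unfolding e1 V1 by blast
  obtain D\<^sub>2 tw\<^sub>2 \<beta>\<^sub>2 where 2: "dart_map D\<^sub>2 S\<^sub>2 tw\<^sub>2 \<beta>\<^sub>2" "fst ` D\<^sub>2 = V\<^sub>2"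
    "flag_potential x y ?D2 (S\<^sub>2 - ?e) tw \<beta>' \<le> 2 * int (map_faces D\<^sub>2 S\<^sub>2 tw\<^sub>2 \<beta>\<^sub>2) - 2 * int (card V\<^sub>2) + 2"
    using pinched_uncontract[OF pm2 ex2 nin2] unfolding e2 V2 by blast
  have "flag_potential x y D' (?S - ?e) tw \<beta>\<^sub>c = 2 * int (map_faces D ?S tw \<beta>) - 2 * int (card (V\<^sub>1 \<union> V\<^sub>2)) + 2"
    using c(1-3) by (simp add: flag_potential_def contracted_map_def)
  moreover have "card V\<^sub>1 + card V\<^sub>2 = card (V\<^sub>1 \<union> V\<^sub>2) + 2"
    using card_Un_Int[of V\<^sub>1 V\<^sub>2] finV V(2) \<open>x \<noteq> y\<close> by simp
  ultimately have "map_faces D ?S tw \<beta> + 1 \<le> map_faces D\<^sub>1 S\<^sub>1 tw\<^sub>1 \<beta>\<^sub>1 + map_faces D\<^sub>2 S\<^sub>2 tw\<^sub>2 \<beta>\<^sub>2"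
    using \<beta>'(3) pot 1(3) 2(3) by linarith
  with 1(1,2) 2(1,2) show ?thesis by (intro that)
qed

text \<open>The union of the two contracted maps is a pinched map with four crossings and two arcs
  at each of x and y. Normalising it produces the common vertex without lowering the sum of the two
  potentials.\<close>

lemma dart_map_join:
  fixes D\<^sub>1 D\<^sub>2 S\<^sub>1 S\<^sub>2 :: "(nat \<times> nat) set"
  assumes dm1: "dart_map D\<^sub>1 S\<^sub>1 tw\<^sub>1 \<beta>\<^sub>1" and dm2: "dart_map D\<^sub>2 S\<^sub>2 tw\<^sub>2 \<beta>\<^sub>2"
    and V: "fst ` D\<^sub>1 \<inter> fst ` D\<^sub>2 = {x, y}" and xy: "(x, y) \<in> S\<^sub>1" "(x, y) \<in> S\<^sub>2"
    and D: "D\<^sub>1 \<inter> D\<^sub>2 \<subseteq> {(x, y), (y, x)}"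
  obtains D tw \<beta> where "dart_map D (S\<^sub>1 \<union> S\<^sub>2) tw \<beta>" "fst ` D = fst ` D\<^sub>1 \<union> fst ` D\<^sub>2"
    "map_faces D\<^sub>1 S\<^sub>1 tw\<^sub>1 \<beta>\<^sub>1 + map_faces D\<^sub>2 S\<^sub>2 tw\<^sub>2 \<beta>\<^sub>2 \<le> map_faces D (S\<^sub>1 \<union> S\<^sub>2) tw \<beta> + 1"
proof -
  let ?V = "fst ` D\<^sub>1 \<union> fst ` D\<^sub>2" and ?e = "{(x, y), (y, x)}"
  let ?S1 = "S\<^sub>1 - ?e" and ?S2 = "S\<^sub>2 - ?e"
  \<comment> \<open>The hairs must avoid second components as well, because the two sets of darts
    have to be disjoint.\<close>
  let ?W = "?V \<union> snd ` D\<^sub>1 \<union> snd ` D\<^sub>2"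
  note dg1 = dart_mapD(1)[OF dm1] and dg2 = dart_mapD(1)[OF dm2]
  have fin: "finite ?W" using dart_graphD(1)[OF dg1] dart_graphD(1)[OF dg2] by simp
  obtain l where l: "l \<notin> ?W"
    using ex_new_if_finite[OF infinite_UNIV_nat fin] by blast
  obtain l' where l': "l' \<notin> insert l ?W"
    using ex_new_if_finite[OF infinite_UNIV_nat, of "insert l ?W"] fin by auto
  have "x \<noteq> y"
    using dart_graph_dartD(2)[OF dg1, of "(x, y)"] dart_graphD(2)[OF dg1] xy(1) by auto
  obtain A a where A: "contracted_map x y A ?S1 tw\<^sub>1 a" "map_faces A ?S1 tw\<^sub>1 a = map_faces D\<^sub>1 S\<^sub>1 tw\<^sub>1 \<beta>\<^sub>1"
    "fst ` A = fst ` D\<^sub>1" "A = insert (x, l) (insert (y, l) D\<^sub>1) - ?e"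
    using contract_with_hairs[OF dm1 xy(1), of l] l by auto
  obtain B b where B: "contracted_map x y B ?S2 tw\<^sub>2 b" "map_faces B ?S2 tw\<^sub>2 b = map_faces D\<^sub>2 S\<^sub>2 tw\<^sub>2 \<beta>\<^sub>2"
    "fst ` B = fst ` D\<^sub>2" "B = insert (x, l') (insert (y, l') D\<^sub>2) - ?e"
    using contract_with_hairs[OF dm2 xy(2), of l'] l' by auto
  have disj: "A \<inter> B = {}"
  proof -
    have "d \<notin> B" if d: "d \<in> A" for d
    proof
      assume dB: "d \<in> B"
      have "d \<notin> ?e" using d A(4) by blast
      have 1: "d \<in> D\<^sub>1 \<or> snd d = l" using d unfolding A(4) by auto
      have 2: "d \<in> D\<^sub>2 \<or> snd d = l'" using dB unfolding B(4) by auto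
      have 3: "snd d \<in> ?W" if "d \<in> D\<^sub>1 \<or> d \<in> D\<^sub>2"
        using that by (elim disjE) simp_all
      have "d \<in> D\<^sub>1" using 1 2 3 l l' by (metis insertCI)
      moreover have "d \<in> D\<^sub>2" using 1 2 3 l l' by (metis insertCI)
      ultimately show False using D \<open>d \<notin> ?e\<close> by blast
    qed
    then show ?thesis by blast
  qed
  have pA: "pinched_map x y A ?S1 tw\<^sub>1 a" and pB: "pinched_map x y B ?S2 tw\<^sub>2 b"
    using A(1) B(1) by (simp_all add: contracted_map_def)
  note pA = pinched_mapD[OF pA] and pB = pinched_mapD[OF pB]
  define tw where "tw d = (d \<in> ?S1 \<and> tw\<^sub>1 d \<or> d \<in> ?S2 \<and> tw\<^sub>2 d)" for d
  define \<beta> where "\<beta> p = (if fst p \<in> A then a p else b p)" for p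
  have SA: "?S1 \<subseteq> A" and SB: "?S2 \<subseteq> B"
    using dart_graphD(2)[OF pA(2)] dart_graphD(2)[OF pB(2)] by auto
  have in_A: "a p \<in> flags A \<and> a (a p) = p \<and> a p \<noteq> p" if "p \<in> flags A" for p
    using fpfD[OF pA(3) that] by blast
  have in_B: "b p \<in> flags B \<and> b (b p) = p \<and> b p \<noteq> p" if "p \<in> flags B" for p
    using fpfD[OF pB(3) that] by blast
  have cases: "p \<in> flags A \<and> \<beta> p = a p \<and> fst (\<beta> p) \<in> A \<or> p \<in> flags B \<and> \<beta> p = b p \<and> fst (\<beta> p) \<in> B \<and> fst (\<beta> p) \<notin> A"
    if "p \<in> flags (A \<union> B)" for p
  proof (cases "fst p \<in> A")
    case True
    then show ?thesis using in_A[of p] by (simp add: \<beta>_def mem_Times_iff)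
  next
    case False
    then have "p \<in> flags B" using that by (simp add: mem_Times_iff)
    then show ?thesis using in_B[of p] False disj by (auto simp: \<beta>_def mem_Times_iff)
  qed
  have pm: "pinched_map x y (A \<union> B) (?S1 \<union> ?S2) tw \<beta>"
    unfolding pinched_map_def
  proof (intro conjI ballI)
    have sw1: "prod.swap d \<in> ?S1 \<longleftrightarrow> d \<in> ?S1" for d
      using dart_graph_dartD(3)[OF pA(2), of d] dart_graph_dartD(3)[OF pA(2), of "prod.swap d"] unfolding swap_swap by blast
    have sw2: "prod.swap d \<in> ?S2 \<longleftrightarrow> d \<in> ?S2" for d
      using dart_graph_dartD(3)[OF pB(2), of d] dart_graph_dartD(3)[OF pB(2), of "prod.swap d"] unfolding swap_swap by blast
    show "dart_graph (A \<union> B) (?S1 \<union> ?S2) tw"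
      unfolding dart_graph_def
    proof (intro conjI ballI allI)
      show "finite (A \<union> B)" using dart_graphD(1)[OF pA(2)] dart_graphD(1)[OF pB(2)] by simp
      show "?S1 \<union> ?S2 \<subseteq> A \<union> B" using SA SB by blast
      show "fst d \<noteq> snd d" if "d \<in> A \<union> B" for d
        using that dart_graph_dartD(2)[OF pA(2)] dart_graph_dartD(2)[OF pB(2)] by blast
      show "prod.swap d \<in> ?S1 \<union> ?S2" if "d \<in> ?S1 \<union> ?S2" for d
        using that sw1 sw2 by blast
      show "tw (prod.swap d) = tw d" for d
        unfolding tw_def sw1 sw2 using dart_graph_dartD(1)[OF pA(2)] dart_graph_dartD(1)[OF pB(2)] by simp
    qed
    show "fpf (flags (A \<union> B)) \<beta>"
      unfolding fpf_def
    proof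
      fix p assume "p \<in> flags (A \<union> B)"
      from cases[OF this] show "\<beta> p \<in> flags (A \<union> B) \<and> \<beta> (\<beta> p) = p \<and> \<beta> p \<noteq> p"
      proof (elim disjE conjE)
        assume *: "p \<in> flags A" "\<beta> p = a p"
        then show ?thesis using in_A[OF *(1)] by (simp add: \<beta>_def mem_Times_iff)
      next
        assume *: "p \<in> flags B" "\<beta> p = b p" "fst (\<beta> p) \<notin> A"
        then show ?thesis using in_B[OF *(1)] by (simp add: \<beta>_def mem_Times_iff)
      qed
    qed
    show "vtx (\<beta> p) = vtx p \<or> {vtx p, vtx (\<beta> p)} = {x, y}" if "p \<in> flags (A \<union> B)" for p
      using cases[OF that] pA(4)[of p] pB(4)[of p] by (elim disjE conjE) simp_all
  qed (fact \<open>x \<noteq> y\<close>)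
  have "flag_potential x y (A \<union> B) (?S1 \<union> ?S2) tw \<beta>
    = flag_potential x y A ((?S1 \<union> ?S2) \<inter> A) tw \<beta> + flag_potential x y (A \<union> B - A) ((?S1 \<union> ?S2) - A) tw \<beta>"
  proof (rule flag_potential_split[OF pm])
    show "prod.swap d \<in> A \<longleftrightarrow> d \<in> A" if "d \<in> ?S1 \<union> ?S2" for d
      using that SA SB disj dart_graph_dartD(3)[OF pA(2), of d] dart_graph_dartD(3)[OF pB(2), of d] by blast
    show "fst (\<beta> p) \<in> A \<longleftrightarrow> fst p \<in> A" if "p \<in> flags (A \<union> B)" for p
      using cases[OF that] disj by (elim disjE conjE) (auto simp: mem_Times_iff)
  qed blast
  also have "flag_potential x y A ((?S1 \<union> ?S2) \<inter> A) tw \<beta> = flag_potential x y A ?S1 tw\<^sub>1 a"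
  proof (rule flag_potential_cong)
    show "d \<in> (?S1 \<union> ?S2) \<inter> A \<longleftrightarrow> d \<in> ?S1" if "d \<in> A" for d
      using that SB disj by blast
    show "tw d = tw\<^sub>1 d" if "d \<in> (?S1 \<union> ?S2) \<inter> A" "d \<in> A" for d
      using that SB disj unfolding tw_def by blast
    show "\<beta> p = a p" if "p \<in> flags A" for p
      using that by (simp add: \<beta>_def mem_Times_iff)
  qed
  also have "A \<union> B - A = B" using disj by blast
  also have "flag_potential x y B ((?S1 \<union> ?S2) - A) tw \<beta> = flag_potential x y B ?S2 tw\<^sub>2 b"
  proof (rule flag_potential_cong)
    show "d \<in> (?S1 \<union> ?S2) - A \<longleftrightarrow> d \<in> ?S2" if "d \<in> B" for d
      using that SA disj by blast
    show "tw d = tw\<^sub>2 d" if "d \<in> (?S1 \<union> ?S2) - A" "d \<in> B" for d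
      using that SA disj unfolding tw_def by blast
    show "\<beta> p = b p" if "p \<in> flags B" for p
      using that disj by (auto simp: \<beta>_def mem_Times_iff)
  qed
  finally have pot: "flag_potential x y (A \<union> B) (?S1 \<union> ?S2) tw \<beta>
    = flag_potential x y A ?S1 tw\<^sub>1 a + flag_potential x y B ?S2 tw\<^sub>2 b" .
  have VAB: "fst ` (A \<union> B) = ?V" using A(3) B(3) by blast
  have ex: "x \<in> fst ` (A \<union> B)" "y \<in> fst ` (A \<union> B)" unfolding VAB using V by blast+
  have nin: "(x, y) \<notin> A \<union> B" "(y, x) \<notin> A \<union> B" using A(4) B(4) by blast+
  have "(y, x) \<in> S\<^sub>1" using dart_graph_dartD(3)[OF dg1 xy(1)] by simp
  then have e: "?S1 \<union> ?S2 \<union> ?e = S\<^sub>1 \<union> S\<^sub>2" using xy dart_graph_dartD(3)[OF dg2 xy(2)] by auto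
  obtain D' tw' \<beta>' where R: "dart_map D' (S\<^sub>1 \<union> S\<^sub>2) tw' \<beta>'" "fst ` D' = ?V"
    "flag_potential x y (A \<union> B) (?S1 \<union> ?S2) tw \<beta>
      \<le> 2 * int (map_faces D' (S\<^sub>1 \<union> S\<^sub>2) tw' \<beta>') - 2 * int (card ?V) + 2"
    using pinched_uncontract[OF pm ex nin] unfolding e VAB by blast
  have "flag_potential x y A ?S1 tw\<^sub>1 a = 2 * int (map_faces D\<^sub>1 S\<^sub>1 tw\<^sub>1 \<beta>\<^sub>1) - 2 * int (card (fst ` D\<^sub>1)) + 2"
    using A by (simp add: flag_potential_def contracted_map_def)
  moreover have "flag_potential x y B ?S2 tw\<^sub>2 b = 2 * int (map_faces D\<^sub>2 S\<^sub>2 tw\<^sub>2 \<beta>\<^sub>2) - 2 * int (card (fst ` D\<^sub>2)) + 2"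
    using B by (simp add: flag_potential_def contracted_map_def)
  moreover have "card (fst ` D\<^sub>1) + card (fst ` D\<^sub>2) = card ?V + 2"
    using card_Un_Int[of "fst ` D\<^sub>1" "fst ` D\<^sub>2"] fin V \<open>x \<noteq> y\<close> by simp
  ultimately have "map_faces D\<^sub>1 S\<^sub>1 tw\<^sub>1 \<beta>\<^sub>1 + map_faces D\<^sub>2 S\<^sub>2 tw\<^sub>2 \<beta>\<^sub>2 \<le> map_faces D' (S\<^sub>1 \<union> S\<^sub>2) tw' \<beta>' + 1"
    using R(3) pot by linarith
  with R(1,2) show ?thesis by (intro that)
qed

text \<open>Disjoint copies, tagged by a Boolean, are joined at x by one pair, which costs exactly
  one component. The two copies of y are then joined too, through the edge xy in both sides.\<close>

lemma comps_glue:
  assumes "finite V\<^sub>1" "finite V\<^sub>2" "V\<^sub>1 \<inter> V\<^sub>2 = {x, y}"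
    and "S\<^sub>1 \<subseteq> V\<^sub>1 \<times> V\<^sub>1" "S\<^sub>2 \<subseteq> V\<^sub>2 \<times> V\<^sub>2" "(x, y) \<in> S\<^sub>1" "(x, y) \<in> S\<^sub>2"
  shows "comps (V\<^sub>1 \<union> V\<^sub>2) (S\<^sub>1 \<union> S\<^sub>2) + 1 = comps V\<^sub>1 S\<^sub>1 + comps V\<^sub>2 S\<^sub>2"
proof -
  let ?L = "(\<lambda>u. (u, True)) ` V\<^sub>1" and ?R = "(\<lambda>u. (u, False)) ` V\<^sub>2"
  let ?T = "{((u, True), (w, True)) | u w. (u, w) \<in> S\<^sub>1} \<union> {((u, False), (w, False)) | u w. (u, w) \<in> S\<^sub>2}"
  let ?X = "?L \<union> ?R" and ?T' = "insert ((x, True), (x, False)) ?T"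
  have fin: "finite ?X" using assms(1,2) by simp
  have xy: "x \<in> V\<^sub>1" "x \<in> V\<^sub>2" "y \<in> V\<^sub>1" "y \<in> V\<^sub>2" using assms(3) by auto
  have L: "comps ?L ?T = comps V\<^sub>1 S\<^sub>1"
  proof (rule antisym)
    show "comps ?L ?T \<le> comps V\<^sub>1 S\<^sub>1"
    proof (rule comps_le[where g = "\<lambda>u. (u, True)"])
      fix c assume "c \<in> ?L"
      then obtain u where "c = (u, True)" "u \<in> V\<^sub>1" by blast
      then show "\<exists>u\<in>V\<^sub>1. ((u, True), c) \<in> conn ?L ?T" by (auto intro: conn_refl)
    qed (use assms(1) in \<open>auto intro: conn_base\<close>)
    show "comps V\<^sub>1 S\<^sub>1 \<le> comps ?L ?T"
    proof (rule comps_le[where g = fst])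
      fix c assume "c \<in> V\<^sub>1"
      then show "\<exists>u\<in>?L. (fst u, c) \<in> conn V\<^sub>1 S\<^sub>1"
        by (intro bexI[of _ "(c, True)"]) (simp_all add: conn_refl)
    qed (use assms(1) in \<open>auto intro: conn_base\<close>)
  qed
  have R: "comps ?R ?T = comps V\<^sub>2 S\<^sub>2"
  proof (rule antisym)
    show "comps ?R ?T \<le> comps V\<^sub>2 S\<^sub>2"
    proof (rule comps_le[where g = "\<lambda>u. (u, False)"])
      fix c assume "c \<in> ?R"
      then obtain u where "c = (u, False)" "u \<in> V\<^sub>2" by blast
      then show "\<exists>u\<in>V\<^sub>2. ((u, False), c) \<in> conn ?R ?T" by (auto intro: conn_refl)
    qed (use assms(2) in \<open>auto intro: conn_base\<close>)
    show "comps V\<^sub>2 S\<^sub>2 \<le> comps ?R ?T"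
    proof (rule comps_le[where g = fst])
      fix c assume "c \<in> V\<^sub>2"
      then show "\<exists>u\<in>?R. (fst u, c) \<in> conn V\<^sub>2 S\<^sub>2"
        by (intro bexI[of _ "(c, False)"]) (simp_all add: conn_refl)
    qed (use assms(2) in \<open>auto intro: conn_base\<close>)
  qed
  have D: "comps ?X ?T = comps ?L ?T + comps ?R ?T"
    by (rule comps_disjoint) (use assms(1,2) in auto)
  have "((x, True), (x, False)) \<notin> conn ?X ?T"
  proof
    assume "((x, True), (x, False)) \<in> conn ?X ?T"
    then have "snd (x, True) = snd (x, False)"
      by (rule conn_invariant) auto
    then show False by simp
  qed
  then have I: "comps ?X ?T' + 1 = comps ?X ?T"
    using comps_insert_le[OF fin, of "(x, True)" "(x, False)" ?T]
      comps_insert_less[OF fin, of "(x, True)" "(x, False)" ?T] xy by auto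
  have glue: "((z, True), (z, False)) \<in> conn ?X ?T'" if "z \<in> {x, y}" for z
  proof -
    have 1: "((x, True), (x, False)) \<in> conn ?X ?T'"
      using xy by (intro conn_base) auto
    have "((x, True), (y, True)) \<in> conn ?X ?T'" "((x, False), (y, False)) \<in> conn ?X ?T'"
      using xy assms(6,7) by (intro conn_base; auto)+
    then have "((y, True), (y, False)) \<in> conn ?X ?T'"
      using 1 by (meson conn_sym conn_trans)
    with 1 that show ?thesis by auto
  qed
  have "comps (V\<^sub>1 \<union> V\<^sub>2) (S\<^sub>1 \<union> S\<^sub>2) \<le> comps ?X ?T'"
  proof (rule comps_le[where g = fst])
    fix c assume c: "c \<in> V\<^sub>1 \<union> V\<^sub>2"
    then have "(c, c \<in> V\<^sub>1) \<in> ?X" by auto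
    then show "\<exists>u\<in>?X. (fst u, c) \<in> conn (V\<^sub>1 \<union> V\<^sub>2) (S\<^sub>1 \<union> S\<^sub>2)"
      by (rule bexI[rotated]) (use c in \<open>simp add: conn_refl\<close>)
  qed (use fin xy in \<open>auto intro: conn_base conn_refl\<close>)
  moreover have "comps ?X ?T' \<le> comps (V\<^sub>1 \<union> V\<^sub>2) (S\<^sub>1 \<union> S\<^sub>2)"
  proof (rule comps_le[where g = "\<lambda>u. (u, u \<in> V\<^sub>1)"])
    have flag: "((u, u \<in> V\<^sub>1), (u, s)) \<in> conn ?X ?T'" if "(u, s) \<in> ?X" for u s
    proof (cases "s = (u \<in> V\<^sub>1)")
      case True
      then show ?thesis using that by (simp add: conn_refl)
    next
      case False
      then have "\<not> s" "u \<in> V\<^sub>1" "u \<in> V\<^sub>2" using that by auto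
      then have "u \<in> {x, y}" using assms(3) by blast
      then show ?thesis using glue \<open>\<not> s\<close> \<open>u \<in> V\<^sub>1\<close> by simp
    qed
    fix u w assume uw: "(u, w) \<in> S\<^sub>1 \<union> S\<^sub>2" "u \<in> V\<^sub>1 \<union> V\<^sub>2" "w \<in> V\<^sub>1 \<union> V\<^sub>2"
    then obtain s where s: "(u, s) \<in> ?X" "(w, s) \<in> ?X" "((u, s), (w, s)) \<in> ?T"
      using assms(4,5) by blast
    have "((u, s), (w, s)) \<in> conn ?X ?T'"
      using s by (intro conn_base) blast+
    then show "((u, u \<in> V\<^sub>1), (w, w \<in> V\<^sub>1)) \<in> conn ?X ?T'"
      using flag[OF s(1)] flag[OF s(2)] by (meson conn_sym conn_trans)
  next
    fix c assume c: "c \<in> ?X"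
    obtain u s where us: "c = (u, s)" by (cases c)
    show "\<exists>u\<in>V\<^sub>1 \<union> V\<^sub>2. ((u, u \<in> V\<^sub>1), c) \<in> conn ?X ?T'"
    proof (cases "s = (u \<in> V\<^sub>1)")
      case True
      then show ?thesis using c us by (intro bexI[of _ u]) (auto intro: conn_refl)
    next
      case False
      then have "\<not> s" "u \<in> V\<^sub>1" "u \<in> V\<^sub>2" using c us by auto
      moreover from this have "u \<in> {x, y}" using assms(3) by blast
      ultimately show ?thesis using glue us by (intro bexI[of _ u]) auto
    qed
  qed (use assms(1,2) in auto)
  ultimately show ?thesis using L R D I by simp
qed


section \<open>Surfaces as maps\<close>

lemma orbit_in:
  assumes "\<And>q. q \<in> X \<Longrightarrow> f q \<in> X" "p \<in> X" "q \<in> orbit f p"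
  shows "q \<in> X"
  using assms(3) by induction (use assms(1,2) in auto)

lemma self_in_orbit_finite:
  assumes "finite X" "\<And>q. q \<in> X \<Longrightarrow> f q \<in> X" "inj_on f X" "p \<in> X"
  shows "p \<in> orbit f p"
proof -
  let ?O = "orbit f p"
  have O: "?O \<subseteq> X" using orbit_in[of X f p] assms(2,4) by blast
  have "f ` ?O = ?O"
    by (rule endo_inj_surj) (use finite_subset[OF O assms(1)] inj_on_subset[OF assms(3) O] orbit.step in auto)
  then obtain q where "q \<in> ?O" "f p = f q"
    using orbit.base[of f p] by (metis imageE)
  then show ?thesis
    using inj_onD[OF assms(3)] O assms(4) by (metis subsetD)
qed

text \<open>Rotation systems describe faces and vertices by orbits of a composite of a and b, maps
  by components of the union of a and b. This locale translates between the two.\<close>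

locale two_matchings =
  fixes X :: "'a set" and a b f :: "'a \<Rightarrow> 'a"
  assumes fin: "finite X" and a: "fpf X a" and b: "fpf X b" and f: "\<And>p. p \<in> X \<Longrightarrow> f p = b (a p)"
begin

lemma f_in: "p \<in> X \<Longrightarrow> f p \<in> X"
  using a b f by (simp add: fpf_def)

lemma inj_f: "inj_on f X"
proof (rule inj_onI)
  fix p q assume "p \<in> X" "q \<in> X" "f p = f q"
  then show "p = q"
    using f fpf_inj[OF b] fpf_inj[OF a] fpfD(1)[OF a] by metis
qed

lemma self_in_orbit: "p \<in> X \<Longrightarrow> p \<in> orbit f p"
  using fin f_in inj_f by (rule self_in_orbit_finite)

lemma orbit_X: "p \<in> X \<Longrightarrow> q \<in> orbit f p \<Longrightarrow> q \<in> X"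
  using f_in by (rule orbit_in)

text \<open>Conjugation by a inverts f, as \<open>f (a (f u)) = a u\<close>, and orbits on a finite
  set are closed under the inverse.\<close>

lemma reflect_orbit:
  assumes "p \<in> X" "q \<in> orbit f p"
  shows "a q \<in> orbit f (a p)"
proof -
  let ?O = "orbit f (a p)"
  have ap: "a p \<in> X" using fpfD(1)[OF a assms(1)] .
  have O: "?O \<subseteq> X" using orbit_X[OF ap] by blast
  have surj: "f ` ?O = ?O"
    by (rule endo_inj_surj) (use finite_subset[OF O fin] inj_on_subset[OF inj_f O] orbit.step in auto)
  have step: "a (f u) \<in> ?O" if u: "u \<in> X" "a u \<in> ?O" for u
  proof -
    note au = fpfD[OF a u(1)] and fu = f_in[OF u(1)]
    have "f (a (f u)) = a u"
      using f[OF fpfD(1)[OF a fu]] fpfD(2)[OF a fu] f[OF u(1)] fpfD(2)[OF b au(1)] by simp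
    moreover obtain r where "r \<in> ?O" "f r = a u" using u(2) surj by (metis imageE)
    ultimately have "a (f u) = r"
      using inj_onD[OF inj_f, of "a (f u)" r] fpfD(1)[OF a fu] O by auto
    then show ?thesis using \<open>r \<in> ?O\<close> by simp
  qed
  from assms(2) show ?thesis
  proof induction
    case base
    show ?case using assms(1) self_in_orbit[OF ap] by (rule step)
  next
    case (step y)
    show ?case using orbit_X[OF assms(1) step.hyps] step.IH by (rule \<open>\<And>u. \<lbrakk>u \<in> X; a u \<in> ?O\<rbrakk> \<Longrightarrow> a (f u) \<in> ?O\<close>)
  qed
qed

text \<open>The union of the two orbits is closed under a by reflection, and under b because
  \<open>b q = f (a q)\<close>.\<close>

lemma class_eq_orbits:
  assumes "p \<in> X"
  shows "conn X (gr X a \<union> gr X b) `` {p} = orbit f p \<union> orbit f (a p)"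
proof -
  let ?R = "gr X a \<union> gr X b" and ?W = "orbit f p \<union> orbit f (a p)"
  have ap: "a p \<in> X" "a (a p) = p" using fpfD[OF a assms] by simp_all
  have aW: "a q \<in> ?W" if "q \<in> ?W" for q
    using that reflect_orbit[OF assms, of q] reflect_orbit[OF ap(1), of q] ap(2) by auto
  have WX: "q \<in> X" if "q \<in> ?W" for q
    using that orbit_X[OF assms] orbit_X[OF ap(1)] by blast
  have bW: "b q \<in> ?W" if "q \<in> ?W" for q
  proof -
    have eq: "f (a q) = b q"
      using f[OF fpfD(1)[OF a WX[OF that]]] fpfD(2)[OF a WX[OF that]] by simp
    have "f (a q) \<in> ?W"
      using aW[OF that] by (elim UnE) (simp_all add: orbit.step)
    then show ?thesis unfolding eq .
  qed
  have a_conn: "(q, a q) \<in> conn X ?R" "(q, b q) \<in> conn X ?R" if "q \<in> X" for q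
    using that fpfD(1)[OF a that] fpfD(1)[OF b that] by (auto intro: conn_base)
  have f_conn: "(q, f q) \<in> conn X ?R" if "q \<in> X" for q
    unfolding f[OF that] using a_conn(1)[OF that] a_conn(2)[OF fpfD(1)[OF a that]] by (rule conn_trans)
  have orb: "(r, q) \<in> conn X ?R" if "q \<in> orbit f r" "r \<in> X" for q r
    using that(1)
  proof induction
    case base
    show ?case using that(2) by (rule f_conn)
  next
    case (step y)
    show ?case using step.IH f_conn[OF orbit_X[OF that(2) step.hyps]] by (rule conn_trans)
  qed
  show ?thesis
  proof
    show "?W \<subseteq> conn X ?R `` {p}"
      using orb[OF _ assms] conn_trans[OF a_conn(1)[OF assms] orb[OF _ ap(1)]] by auto
    show "conn X ?R `` {p} \<subseteq> ?W"
    proof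
      fix q assume "q \<in> conn X ?R `` {p}"
      then have "(p, q) \<in> conn X ?R" by simp
      then have "(p \<in> ?W) = (q \<in> ?W)"
      proof (rule conn_invariant[where f = "\<lambda>u. u \<in> ?W"])
        fix u v assume uv: "(u, v) \<in> ?R" "u \<in> X" "v \<in> X"
        have "a u \<in> ?W \<longleftrightarrow> u \<in> ?W" using aW[of u] aW[of "a u"] fpfD(2)[OF a uv(2)] by auto
        moreover have "b u \<in> ?W \<longleftrightarrow> u \<in> ?W" using bW[of u] bW[of "b u"] fpfD(2)[OF b uv(2)] by auto
        ultimately show "(u \<in> ?W) = (v \<in> ?W)" using uv(1) by auto
      qed
      then show "q \<in> ?W" using self_in_orbit[OF assms] by blast
    qed
  qed
qed

text \<open>Cancelling one f at each end of \<open>(f ^^ n) q = a q\<close> gives the same equation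
  for f q with n - 2 in place of n. The descent ends at 0 or 1, where a or b would have a fixed
  point. So the two directions of a cycle never coincide, which makes orientations possible.\<close>

lemma funpow_ne_reflect:
  "q \<in> X \<Longrightarrow> (f ^^ n) q \<noteq> a q"
proof (induction n arbitrary: q rule: less_induct)
  case (less n)
  note aq = fpfD[OF a less.prems]
  consider "n = 0" | "n = 1" | m where "n = Suc (Suc m)"
    by (metis One_nat_def old.nat.exhaust)
  then show ?case
  proof cases
    case 1
    then show ?thesis using aq by auto
  next
    case 2
    then show ?thesis using f[OF less.prems] fpfD(3)[OF b aq(1)] by simp
  next
    case 3
    note fq = f_in[OF less.prems]
    have pow: "(f ^^ k) u \<in> X" if "u \<in> X" for k u
      using that f_in by (induction k) auto
    show ?thesis
    proof
      assume eq: "(f ^^ n) q = a q"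
      have "f ((f ^^ m) (f q)) = f (a (f q))"
      proof -
        have "f ((f ^^ m) (f q)) = (f ^^ n) q" using 3 by (simp add: funpow_swap1)
        also have "\<dots> = b (b (a q))" using eq fpfD(2)[OF b aq(1)] by simp
        also have "\<dots> = f (a (f q))"
          using f[OF fpfD(1)[OF a fq]] fpfD(2)[OF a fq] f[OF less.prems] by simp
        finally show ?thesis .
      qed
      then have "(f ^^ m) (f q) = a (f q)"
        using inj_onD[OF inj_f] pow[OF fq] fpfD(1)[OF a fq] by blast
      then show False using less.IH[of m "f q"] 3 fq by simp
    qed
  qed
qed

lemma orbit_ne_reflect: "p \<in> X \<Longrightarrow> a p \<notin> orbit f p"
  using funpow_ne_reflect by (fastforce simp: orbit_altdef)

end

text \<open>\<open>(d, False)\<close> is the side of d that faces \<pi> d, and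
  \<open>(d, True)\<close> the side that faces its predecessor.\<close>

definition corner :: "('v \<times> 'v \<Rightarrow> 'v \<times> 'v) \<Rightarrow> 'v flag \<Rightarrow> 'v flag" where
  "corner \<pi> = (\<lambda>(d, s). if s then (inv \<pi> d, False) else (\<pi> d, True))"

section \<open>Graphs, connectedness and rotation systems in terms of flags\<close>

lemma pair_graphD:
  assumes "pair_graph G"
  shows "finite (pverts G)" "finite (parcs G)" "parcs G \<subseteq> pverts G \<times> pverts G"
    "(u, w) \<in> parcs G \<Longrightarrow> (w, u) \<in> parcs G" "(u, w) \<in> parcs G \<Longrightarrow> u \<noteq> w"
proof -
  interpret pair_graph G by fact
  show "finite (pverts G)" "finite (parcs G)" by (fact pair_finite_verts, fact pair_finite_arcs)
  show "parcs G \<subseteq> pverts G \<times> pverts G" using in_arcsD1 in_arcsD2 by auto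
  show "(u, w) \<in> parcs G \<Longrightarrow> (w, u) \<in> parcs G"
    using pair_sym_arcs by (auto simp: symmetric_def sym_def)
  show "(u, w) \<in> parcs G \<Longrightarrow> u \<noteq> w"
    using pair_no_loops by fastforce
qed

lemma pair_graphI:
  assumes "finite (pverts G)" "parcs G \<subseteq> pverts G \<times> pverts G"
    "\<And>u w. (u, w) \<in> parcs G \<Longrightarrow> (w, u) \<in> parcs G" "\<And>u w. (u, w) \<in> parcs G \<Longrightarrow> u \<noteq> w"
  shows "pair_graph G"
proof
  show "finite (parcs G)"
    using assms(1,2) finite_subset by blast
  show "symmetric (with_proj G)"
    using assms(3) by (auto simp: symmetric_def sym_def)
qed (use assms in auto)

lemma connected_conn:
  assumes "parcs G \<subseteq> pverts G \<times> pverts G"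
  shows "Digraph_Component.connected (with_proj G) \<longleftrightarrow>
    pverts G \<noteq> {} \<and> (\<forall>u\<in>pverts G. \<forall>w\<in>pverts G. (u, w) \<in> conn (pverts G) (parcs G))"
proof -
  let ?V = "pverts G" and ?R = "parcs G"
  let ?M = "mk_symmetric (with_proj G)"
  have M: "pverts ?M = ?V" "parcs ?M = ?R \<union> ?R\<inverse>"
    by (auto simp: mk_symmetric_def)
  have "u \<rightarrow>\<^sup>*\<^bsub>with_proj ?M\<^esub> w \<longleftrightarrow> (u, w) \<in> conn ?V ?R" for u w
  proof -
    have "u \<rightarrow>\<^sup>*\<^bsub>with_proj ?M\<^esub> w \<longleftrightarrow> (u, w) \<in> rtrancl_on ?V (?R \<union> ?R\<inverse>)"
      by (simp add: reachable_def M)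
    also have "\<dots> \<longleftrightarrow> (u, w) \<in> conn ?V ?R"
    proof
      assume "(u, w) \<in> rtrancl_on ?V (?R \<union> ?R\<inverse>)"
      then show "(u, w) \<in> conn ?V ?R"
      proof (induction rule: rtrancl_on_induct)
        case (step y z)
        then have "(y, z) \<in> conn ?V ?R" by (auto intro: conn_base conn_sym)
        with step.IH show ?case by (rule conn_trans)
      qed (rule conn_refl)
    next
      assume c: "(u, w) \<in> conn ?V ?R"
      then have "u \<in> ?V" and "(u, w) \<in> (Restr (?R \<union> ?R\<inverse>) ?V)\<^sup>*"
        by (auto simp: conn_def)
      from this(2) show "(u, w) \<in> rtrancl_on ?V (?R \<union> ?R\<inverse>)"
        by (induction rule: rtrancl_induct) (use \<open>u \<in> ?V\<close> in \<open>auto intro: rtrancl_on_into_rtrancl_on\<close>)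
    qed
    finally show ?thesis .
  qed
  then show ?thesis
    by (simp add: Digraph_Component.connected_def strongly_connected_def M)
qed

lemma comps_eq_1:
  assumes "V \<noteq> {}" "\<forall>u\<in>V. \<forall>w\<in>V. (u, w) \<in> conn V R"
  shows "comps V R = 1"
proof -
  obtain v where v: "v \<in> V" using assms(1) by blast
  have "conn V R `` {u} = V" if "u \<in> V" for u
    using that assms(2) by (auto dest: conn_in)
  then have "V // conn V R = {V}"
    using v by (auto simp: quotient_def)
  then show ?thesis by (simp add: comps_def)
qed

text \<open>\<open>face_step\<close> is \<open>face_reverse\<close> followed by
  \<open>corner\<close>, so an orbit together with the orbit of the reversed state is one component
  of two matchings.\<close>

lemma num_faces_eq_comps:
  assumes "comb_surface H \<pi> tw" "parcs H \<noteq> {}"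
  defines "X \<equiv> parcs H \<times> UNIV"
  shows "fpf X (face_reverse tw)" "fpf X (corner \<pi>)"
    "num_faces H \<pi> tw = comps X (gr X (face_reverse tw) \<union> gr X (corner \<pi>))"
proof -
  have H: "pair_graph H" "\<pi> permutes parcs H" "edge_signature H tw"
    using assms(1) by (auto simp: comb_surface_def rotation_system_def)
  note pg = pair_graphD[OF H(1)]
  have tw: "tw (w, u) = tw (u, w)" if "(u, w) \<in> parcs H" for u w
    using H(3) that by (auto simp: edge_signature_def)
  show a: "fpf X (face_reverse tw)"
    unfolding fpf_def
  proof
    fix p assume "p \<in> X"
    then obtain u w s where p: "p = ((u, w), s)" "(u, w) \<in> parcs H" by (auto simp: X_def)
    show "face_reverse tw p \<in> X \<and> face_reverse tw (face_reverse tw p) = p \<and> face_reverse tw p \<noteq> p"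
      using p pg(4)[OF p(2)] pg(5)[OF p(2)] tw[OF p(2)] by (auto simp: face_reverse_def X_def)
  qed
  show b: "fpf X (corner \<pi>)"
    unfolding fpf_def
  proof
    fix p assume "p \<in> X"
    then obtain d s where p: "p = (d, s)" "d \<in> parcs H" by (auto simp: X_def)
    have "\<pi> d \<in> parcs H" "inv \<pi> d \<in> parcs H" "\<pi> (inv \<pi> d) = d" "inv \<pi> (\<pi> d) = d"
      using permutes_in_image[OF H(2)] permutes_in_image[OF permutes_inv[OF H(2)]] p(2)
        permutes_inverses[OF H(2)] by auto
    with p show "corner \<pi> p \<in> X \<and> corner \<pi> (corner \<pi> p) = p \<and> corner \<pi> p \<noteq> p"
      by (auto simp: corner_def X_def)
  qed
  have fs: "face_step \<pi> tw p = corner \<pi> (face_reverse tw p)" for p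
    by (cases p) (auto simp: face_step_def corner_def face_reverse_def Let_def)
  interpret two_matchings X "face_reverse tw" "corner \<pi>" "face_step \<pi> tw"
    by unfold_locales (use a b fs pg(2) in \<open>auto simp: X_def\<close>)
  let ?R = "gr X (face_reverse tw) \<union> gr X (corner \<pi>)"
  have "X // conn X ?R = (\<lambda>p. conn X ?R `` {p}) ` X"
    by (auto simp: quotient_def)
  also have "\<dots> = (\<lambda>p. orbit (face_step \<pi> tw) p \<union> orbit (face_step \<pi> tw) (face_reverse tw p)) ` X"
    using class_eq_orbits by (intro image_cong) auto
  finally have "X // conn X ?R = faces H \<pi> tw"
    by (simp add: faces_def X_def)
  then show "num_faces H \<pi> tw = comps X ?R"
    using assms(2) by (simp add: num_faces_def comps_def)
qed

text \<open>A surface is a connected map without half-edges: \<open>traverse\<close> agrees with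
  \<open>face_reverse\<close> on its flags, and cyclic rotations make each vertex one class. The
  signature is set to false outside the arcs because \<open>dart_graph\<close> demands symmetry for
  all pairs.\<close>

lemma comb_surface_dart_map:
  assumes cs: "comb_surface H \<pi> tw" and ne: "parcs H \<noteq> {}"
  defines "tw' \<equiv> \<lambda>d. d \<in> parcs H \<and> tw d"
  shows "dart_map (parcs H) (parcs H) tw' (corner \<pi>)" "fst ` parcs H = pverts H"
    "map_genus (parcs H) (parcs H) tw' (corner \<pi>) = surface_euler_genus H \<pi> tw"
proof -
  let ?D = "parcs H" and ?X = "flags (parcs H)"
  have H: "pair_graph H" "Digraph_Component.connected (with_proj H)" "\<pi> permutes parcs H" "edge_signature H tw"
    and cyc: "\<And>v. v \<in> pverts H \<Longrightarrow> out_arcs (with_proj H) v \<noteq> {} \<Longrightarrow> cyclic_on \<pi> (out_arcs (with_proj H) v)"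
    using cs by (auto simp: comb_surface_def rotation_system_def)
  note pg = pair_graphD[OF H(1)]
  note F = num_faces_eq_comps[OF cs ne]
  have co: "pverts H \<noteq> {}" "\<forall>u\<in>pverts H. \<forall>w\<in>pverts H. (u, w) \<in> conn (pverts H) (parcs H)"
    using H(2) connected_conn[OF pg(3)] by auto
  \<comment> \<open>As the graph is connected and has an arc, no vertex is without arcs.\<close>
  show V: "fst ` ?D = pverts H"
  proof
    show "fst ` ?D \<subseteq> pverts H" using pg(3) by auto
    show "pverts H \<subseteq> fst ` ?D"
    proof
      fix v assume v: "v \<in> pverts H"
      obtain u w where uw: "(u, w) \<in> ?D" using ne by auto
      then have "u \<noteq> w" "u \<in> pverts H" "w \<in> pverts H" using pg(3,5) by auto
      then obtain z where z: "z \<in> pverts H" "z \<noteq> v" by metis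
      show "v \<in> fst ` ?D"
      proof (rule ccontr)
        assume nv: "v \<notin> fst ` ?D"
        have "(v, z) \<in> conn (pverts H) ?D" using co(2) v z(1) by blast
        then have "(v = v) = (z = v)"
        proof (rule conn_invariant[where f = "\<lambda>q. q = v"])
          fix p q assume pq: "(p, q) \<in> ?D"
          have "p \<noteq> v" "q \<noteq> v" using nv pq pg(4)[OF pq] by force+
          then show "(p = v) = (q = v)" by simp
        qed
        with z(2) show False by simp
      qed
    qed
  qed
  have oa: "out_arcs (with_proj H) v = {d \<in> ?D. fst d = v}" for v
    by (auto simp: out_arcs_def)
  have cycD: "cyclic_on \<pi> {d \<in> ?D. fst d = fst e}" if "e \<in> ?D" for e
  proof -
    have "fst e \<in> pverts H" using V that by blast
    moreover have "{d \<in> ?D. fst d = fst e} \<noteq> {}" using that by blast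
    ultimately show ?thesis using cyc[of "fst e"] unfolding oa by blast
  qed
  have fst_pi: "fst (\<pi> d) = fst d" if "d \<in> ?D" for d
    using cyclic_on_inI[OF cycD[OF that], of d] that by auto
  have inv_pi: "inv \<pi> d \<in> ?D" "\<pi> (inv \<pi> d) = d" if "d \<in> ?D" for d
    using that permutes_in_image[OF permutes_inv[OF H(3)]] permutes_inverses[OF H(3)] by auto
  have v: "\<forall>p\<in>?X. vtx (corner \<pi> p) = vtx p"
  proof
    fix p assume "p \<in> ?X"
    then obtain d s where p: "p = (d, s)" "d \<in> ?D" by auto
    have "fst (inv \<pi> d) = fst d"
      using fst_pi[OF inv_pi(1)[OF p(2)]] inv_pi(2)[OF p(2)] by simp
    with fst_pi[OF p(2)] p(1) show "vtx (corner \<pi> p) = vtx p" by (simp add: corner_def)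
  qed
  have dg: "dart_graph ?D ?D tw'"
    unfolding dart_graph_def
  proof (intro conjI ballI allI)
    have sw: "prod.swap d \<in> ?D" if "d \<in> ?D" for d
      using that pg(4)[of "fst d" "snd d"] by (simp add: prod.swap_def)
    show "prod.swap d \<in> ?D" if "d \<in> ?D" for d using sw[OF that] .
    show "fst d \<noteq> snd d" if "d \<in> ?D" for d using pg(5)[of "fst d" "snd d"] that by simp
    show "tw' (prod.swap d) = tw' d" for d
    proof (cases "d \<in> ?D")
      case True
      then have "tw (prod.swap d) = tw d"
        using H(4) by (cases d) (auto simp: edge_signature_def)
      then show ?thesis using True sw[OF True] by (simp add: tw'_def)
    next
      case False
      then have "prod.swap d \<notin> ?D" using sw[of "prod.swap d"] by auto
      with False show ?thesis by (simp add: tw'_def)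
    qed
  qed (use pg(2) in auto)
  have X: "finite ?X" using dg by (rule flags_finite)
  have cr: "corner_rel ?D (corner \<pi>) = gr ?X flip \<union> gr ?X (corner \<pi>)"
    using v by (rule corner_rel_dart_map)
  let ?R = "gr ?X flip \<union> gr ?X (corner \<pi>)"
  have flip_conn: "((d, s), (d, s')) \<in> conn ?X ?R" if "d \<in> ?D" for d s s'
  proof (cases "s = s'")
    case True
    then show ?thesis using that by (simp add: conn_refl)
  next
    case False
    then have "(d, s') = flip (d, s)" by (auto simp: flip_def)
    then show ?thesis using that by (intro conn_base) (auto simp: flip_def)
  qed
  have orb: "((d, False), (e, False)) \<in> conn ?X ?R" if "e \<in> orbit \<pi> d" "d \<in> ?D" for d e
    using that(1)
  proof induction
    case base
    have pd: "\<pi> d \<in> ?D" using that(2) permutes_in_image[OF H(3)] by blast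
    have "((d, False), (\<pi> d, True)) \<in> conn ?X ?R"
      using that(2) pd by (intro conn_base) (auto simp: corner_def)
    then show ?case using flip_conn[OF pd] by (rule conn_trans)
  next
    case (step y)
    have y: "y \<in> ?D" using conn_in[OF step.IH] by simp
    have pd: "\<pi> y \<in> ?D" using y permutes_in_image[OF H(3)] by blast
    have "((y, False), (\<pi> y, True)) \<in> conn ?X ?R"
      using y pd by (intro conn_base) (auto simp: corner_def)
    then have "((y, False), (\<pi> y, False)) \<in> conn ?X ?R" using flip_conn[OF pd] by (rule conn_trans)
    with step.IH show ?case by (rule conn_trans)
  qed
  have "num_verts ?D (corner \<pi>) \<le> card (fst ` ?D)"
  proof -
    define g where "g v = (SOME d. d \<in> ?D \<and> fst d = v)" for v
    have g: "g v \<in> ?D" "fst (g v) = v" if "v \<in> fst ` ?D" for v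
    proof -
      have "\<exists>d. d \<in> ?D \<and> fst d = v" using that by blast
      then have "g v \<in> ?D \<and> fst (g v) = v" unfolding g_def by (rule someI_ex)
      then show "g v \<in> ?D" "fst (g v) = v" by blast+
    qed
    have "comps ?X ?R \<le> comps (fst ` ?D) {}"
    proof (rule comps_le[where g = "\<lambda>v. (g v, False)"])
      show "finite (fst ` ?D)" using pg(2) by simp
      fix c assume "c \<in> ?X"
      then obtain e s where c: "c = (e, s)" "e \<in> ?D" by auto
      have fe: "fst e \<in> fst ` ?D" using c(2) by blast
      have "g (fst e) \<in> {d \<in> ?D. fst d = fst e}" using g[OF fe] by blast
      moreover have "e \<in> {d \<in> ?D. fst d = fst e}" using c(2) by blast
      ultimately have "e \<in> orbit \<pi> (g (fst e))"
        using cycD[OF c(2)] unfolding cyclic_on_alldef by blast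
      then have "((g (fst e), False), (e, False)) \<in> conn ?X ?R" using g(1)[OF fe] by (rule orb)
      then have "((g (fst e), False), c) \<in> conn ?X ?R"
        unfolding c(1) using flip_conn[OF c(2)] by (rule conn_trans)
      then show "\<exists>u\<in>fst ` ?D. ((g u, False), c) \<in> conn ?X ?R" using fe by blast
    qed (use g(1) in auto)
    then show ?thesis by (simp only: num_verts_def cr comps_empty_rel)
  qed
  then have "num_verts ?D (corner \<pi>) = card (fst ` ?D)"
    using num_verts_ge[OF pg(2)] by (intro antisym)
  with dg F(2) v show "dart_map ?D ?D tw' (corner \<pi>)"
    unfolding dart_map_def by blast
  have "traverse ?D tw' p = face_reverse tw p" if "p \<in> ?X" for p
    using that by (cases p) (auto simp: traverse_def face_reverse_def tw'_def)
  then have "gr ?X (traverse ?D tw') = gr ?X (face_reverse tw)" by (rule gr_cong)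
  then have "map_faces ?D ?D tw' (corner \<pi>) = num_faces H \<pi> tw"
    unfolding map_faces_def F(3) by (simp only:)
  then show "map_genus ?D ?D tw' (corner \<pi>) = surface_euler_genus H \<pi> tw"
    using comps_eq_1[OF co] unfolding map_genus_def V surface_euler_genus_def surface_euler_char_def by simp
qed

lemma surface_euler_genus_nonneg:
  assumes "comb_surface H \<pi> tw" "parcs H \<noteq> {}"
  shows "0 \<le> surface_euler_genus H \<pi> tw"
  using map_genus_nonneg[OF comb_surface_dart_map(1)[OF assms]] comb_surface_dart_map(3)[OF assms] by simp

text \<open>An embedding in Euler genus \<open>k\<close>, read off the surface graph by turning all edges outside \<open>G\<close>
  into half-edges.\<close>

definition map_embeds :: "'a pair_pre_digraph \<Rightarrow> nat \<Rightarrow> bool" where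
  "map_embeds G k \<longleftrightarrow> (\<exists>(D :: (nat \<times> nat) set) tw \<beta> f.
     dart_map D (map_prod f f ` parcs G) tw \<beta> \<and> inj_on f (pverts G) \<and> f ` pverts G \<subseteq> fst ` D \<and>
     map_genus D (map_prod f f ` parcs G) tw \<beta> \<le> int k)"

lemma map_embeds_if_embeds:
  assumes "pair_graph G" "parcs G \<noteq> {}" "embeds_in_euler_genus G k"
  shows "map_embeds G k"
proof -
  obtain H :: "nat pair_pre_digraph" and \<pi> tw f where H: "comb_surface H \<pi> tw" "surface_euler_genus H \<pi> tw = int k"
    "inj_on f (pverts G)" "f ` pverts G \<subseteq> pverts H" "map_prod f f ` parcs G \<subseteq> parcs H"
    using assms(3) unfolding embeds_in_euler_genus_def by (elim exE conjE) (rule that)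
  have ne: "parcs H \<noteq> {}" using H(5) assms(2) by auto
  let ?S = "map_prod f f ` parcs G" and ?tw = "\<lambda>d. d \<in> parcs H \<and> tw d"
  note cs = comb_surface_dart_map[OF H(1) ne]
  have sym: "prod.swap d \<in> ?S" if d: "d \<in> ?S" for d
  proof -
    obtain u w where uw: "(u, w) \<in> parcs G" "d = (f u, f w)" using d by auto
    have "prod.swap d = map_prod f f (w, u)" using uw(2) by simp
    then show ?thesis
      using pair_graphD(4)[OF assms(1) uw(1)] by (rule image_eqI)
  qed
  have dg: "dart_graph (parcs H) ?S ?tw"
    using dart_mapD(1)[OF cs(1)] by (rule dart_graph_subset) (use H(5) sym in auto)
  have "dart_map (parcs H) ?S ?tw (corner \<pi>)"
    using dg dart_mapD[OF cs(1)] unfolding dart_map_def by blast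
  moreover have "map_genus (parcs H) ?S ?tw (corner \<pi>) \<le> int k"
    using map_genus_mono[OF cs(1) H(5)] sym cs(3) H(2) by simp
  ultimately show ?thesis
    unfolding map_embeds_def cs(2)[symmetric] using H(3,4) unfolding cs(2)[symmetric]
    by (intro exI[of _ "parcs H"] exI[of _ ?tw] exI[of _ "corner \<pi>"] exI[of _ f] conjI)
qed


section \<open>Maps as surfaces\<close>

text \<open>\<beta> gives each vertex a cycle without direction. The two directions are two disjoint
  orbits of \<open>flip\<close> followed by \<beta>. The orbit of one chosen flag fixes the
  direction at its vertex, and \<open>or d\<close> is the bit of the flag of d on that
  orbit.\<close>

lemma dart_map_orientation:
  assumes dm: "dart_map D S tw \<beta>"
  obtains or \<pi> where "\<pi> permutes D" "\<And>d. d \<in> D \<Longrightarrow> fst (\<pi> d) = fst d"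
    "\<And>d. d \<in> D \<Longrightarrow> \<beta> (d, \<not> or d) = (\<pi> d, or (\<pi> d))"
    "\<And>v. v \<in> fst ` D \<Longrightarrow> cyclic_on \<pi> {d \<in> D. fst d = v}"
proof -
  let ?X = "flags D"
  note dg = dart_mapD[OF dm]
  have X: "finite ?X" using dg(1) by (rule flags_finite)
  define \<phi> where "\<phi> p = \<beta> (flip p)" for p
  interpret two_matchings ?X flip \<beta> \<phi>
    by unfold_locales (use X fpf_flip dg(2) in \<open>simp_all add: \<phi>_def\<close>)
  define g where "g v = (SOME d. d \<in> D \<and> fst d = v)" for v
  have g: "g v \<in> D" "fst (g v) = v" if "v \<in> fst ` D" for v
  proof -
    have "\<exists>d. d \<in> D \<and> fst d = v" using that by blast
    then have "g v \<in> D \<and> fst (g v) = v" unfolding g_def by (rule someI_ex)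
    then show "g v \<in> D" "fst (g v) = v" by blast+
  qed
  define Or where "Or v = orbit \<phi> (g v, True)" for v
  have gX: "(g v, True) \<in> ?X" if "v \<in> fst ` D" for v
    using g(1)[OF that] by simp
  have cov: "p \<in> Or (vtx p) \<or> flip p \<in> Or (vtx p)" if p: "p \<in> ?X" for p
  proof -
    have v: "vtx p \<in> fst ` D" using p by (metis imageI mem_Times_iff)
    have "((g (vtx p), True), p) \<in> conn ?X (corner_rel D \<beta>)"
      using dart_graphD(1)[OF dg(1)] dg(4) gX[OF v] p
      by (rule corner_connected) (simp add: g(2)[OF v])
    then have "p \<in> conn ?X (gr ?X flip \<union> gr ?X \<beta>) `` {(g (vtx p), True)}"
      unfolding corner_rel_dart_map[OF dg(3)] by simp
    then have "p \<in> Or (vtx p) \<or> p \<in> orbit \<phi> (flip (g (vtx p), True))"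
      unfolding class_eq_orbits[OF gX[OF v]] Or_def by blast
    moreover have "flip p \<in> Or (vtx p)" if "p \<in> orbit \<phi> (flip (g (vtx p), True))"
      using reflect_orbit[OF fpfD(1)[OF fpf_flip gX[OF v]] that] by (simp add: Or_def)
    ultimately show ?thesis by blast
  qed
  \<comment> \<open>With \<open>cov\<close>, exactly one of the two flags of each dart lies on the
    chosen orbit at its vertex.\<close>
  have excl: "\<not> (p \<in> Or v \<and> flip p \<in> Or v)" if p: "p \<in> ?X" and v: "v \<in> fst ` D" for p v
  proof
    assume A: "p \<in> Or v \<and> flip p \<in> Or v"
    then have A: "p \<in> orbit \<phi> (g v, True)" "flip p \<in> orbit \<phi> (g v, True)"
      unfolding Or_def by blast+
    have "(g v, True) \<in> orbit \<phi> p"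
      using self_in_orbit[OF gX[OF v]] A(1) by (rule orbit_swap)
    with A(2) have "flip p \<in> orbit \<phi> p" by (rule orbit_trans)
    then show False using orbit_ne_reflect[OF p] by blast
  qed
  define or where "or d = ((d, True) \<in> Or (fst d))" for d
  have or: "(d, s) \<in> Or (fst d) \<longleftrightarrow> s = or d" if "d \<in> D" for d s
  proof -
    have "(d, True) \<in> ?X" "fst d \<in> fst ` D" using that by auto
    then show ?thesis
      using cov[of "(d, True)"] excl[of "(d, True)" "fst d"] unfolding or_def
      by (cases s) (auto simp: flip_def)
  qed
  have OrX: "p \<in> ?X" "vtx p = v" if "p \<in> Or v" "v \<in> fst ` D" for p v
  proof -
    have "p \<in> conn ?X (gr ?X flip \<union> gr ?X \<beta>) `` {(g v, True)}"
      using that(1) unfolding class_eq_orbits[OF gX[OF that(2)]] Or_def by blast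
    then have c: "((g v, True), p) \<in> conn ?X (gr ?X flip \<union> gr ?X \<beta>)" by simp
    show "p \<in> ?X" using conn_in[OF c] by (rule conjunct2)
    have "vtx (g v, True) = vtx p"
      using c
    proof (rule conn_invariant[where f = vtx])
      fix u w assume uw: "(u, w) \<in> gr ?X flip \<union> gr ?X \<beta>" "u \<in> ?X"
      then consider "w = flip u" | "w = \<beta> u" unfolding Un_iff gr_iff by blast
      then show "vtx u = vtx w" using bspec[OF dg(3) uw(2)] by cases simp_all
    qed
    then show "vtx p = v" using g(2)[OF that(2)] by simp
  qed
  define \<pi> where "\<pi> d = (if d \<in> D then fst (\<beta> (d, \<not> or d)) else d)" for d
  have step: "\<pi> d \<in> D" "fst (\<pi> d) = fst d" "\<beta> (d, \<not> or d) = (\<pi> d, or (\<pi> d))" "\<phi> (d, or d) = (\<pi> d, or (\<pi> d))"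
    if d: "d \<in> D" for d
  proof -
    have v: "fst d \<in> fst ` D" using d by blast
    have "(d, or d) \<in> Or (fst d)" using or[OF d] by blast
    then have in_Or: "\<phi> (d, or d) \<in> Or (fst d)" unfolding Or_def by (rule orbit.step)
    have \<phi>: "\<phi> (d, or d) = \<beta> (d, \<not> or d)" by (simp add: \<phi>_def flip_def)
    obtain d' s where d': "\<beta> (d, \<not> or d) = (d', s)" by (cases "\<beta> (d, \<not> or d)")
    have "(d', s) \<in> Or (fst d)" using in_Or unfolding \<phi> d' .
    note * = OrX[OF this v] this
    have "d' \<in> D" "fst d' = fst d" using *(1,2) by simp_all
    then have "s = or d'" using *(3) or[of d' s] by simp
    moreover have "\<pi> d = d'" using d d' by (simp add: \<pi>_def)
    ultimately show "\<pi> d \<in> D" "fst (\<pi> d) = fst d" "\<beta> (d, \<not> or d) = (\<pi> d, or (\<pi> d))" "\<phi> (d, or d) = (\<pi> d, or (\<pi> d))"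
      using \<open>d' \<in> D\<close> \<open>fst d' = fst d\<close> d' \<phi> by simp_all
  qed
  have inj: "inj_on \<pi> D"
  proof (rule inj_onI)
    fix d e assume de: "d \<in> D" "e \<in> D" "\<pi> d = \<pi> e"
    then have "\<beta> (d, \<not> or d) = \<beta> (e, \<not> or e)" using step(3) by simp
    then have "(d, \<not> or d) = (e, \<not> or e)"
      using fpf_inj[OF dg(2), of "(d, \<not> or d)" "(e, \<not> or e)"] de by simp
    then show "d = e" by simp
  qed
  have perm: "\<pi> permutes D"
  proof (rule bij_imp_permutes)
    have "\<pi> ` D = D"
      using dart_graphD(1)[OF dg(1)] _ inj by (rule endo_inj_surj) (use step(1) in blast)
    with inj show "bij_betw \<pi> D D" by (simp add: bij_betw_def)
  qed (simp add: \<pi>_def)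
  have cyc: "cyclic_on \<pi> {d \<in> D. fst d = v}" if v: "v \<in> fst ` D" for v
  proof -
    have "cyclic_on \<phi> (Or v)"
      using self_in_orbit[OF gX[OF v]] unfolding cyclic_on_def Or_def by blast
    then have "cyclic_on \<pi> (fst ` Or v)"
    proof (rule cyclic_on_image)
      fix p assume p: "p \<in> Or v"
      obtain d s where ds: "p = (d, s)" by (cases p)
      have "d \<in> D" "fst d = v" using OrX[OF p v] ds by simp_all
      then have "s = or d" using or[of d s] p ds by simp
      then show "\<pi> (fst p) = fst (\<phi> p)" using step(4)[OF \<open>d \<in> D\<close>] ds by simp
    qed
    moreover have "fst ` Or v = {d \<in> D. fst d = v}"
    proof
      show "fst ` Or v \<subseteq> {d \<in> D. fst d = v}"
        using OrX[OF _ v] by (auto simp: mem_Times_iff)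
      show "{d \<in> D. fst d = v} \<subseteq> fst ` Or v"
      proof
        fix d assume "d \<in> {d \<in> D. fst d = v}"
        then have "(d, or d) \<in> Or v" using or[of d "or d"] by auto
        then show "d \<in> fst ` Or v" by force
      qed
    qed
    ultimately show ?thesis by simp
  qed
  show ?thesis using perm step(2,3) cyc by (rule that)
qed

text \<open>Half-edges become pendant edges.  Vertices \<open>v\<close> are renamed to \<open>2 * v\<close> to make room for the
  new leaves.\<close>

lemma dart_map_realise:
  fixes D :: "(nat \<times> nat) set"
  assumes dm: "dart_map D S tw \<beta>" and ne: "D \<noteq> {}" and con: "comps (fst ` D) S = 1"
  obtains H \<pi> tw' where "comb_surface H \<pi> tw'" "parcs H \<noteq> {}"
    "surface_euler_genus H \<pi> tw' \<le> map_genus D S tw \<beta>"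
    "(\<lambda>v. 2 * v) ` fst ` D \<subseteq> pverts H" "map_prod (\<lambda>v. 2 * v) (\<lambda>v. 2 * v) ` S \<subseteq> parcs H"
proof -
  note dg = dart_mapD[OF dm] note gD = dart_graphD[OF dg(1)] note gd = dart_graph_dartD[OF dg(1)]
  from dm obtain or \<pi> where \<pi>: "\<pi> permutes D" "\<And>d. d \<in> D \<Longrightarrow> fst (\<pi> d) = fst d"
    "\<And>d. d \<in> D \<Longrightarrow> \<beta> (d, \<not> or d) = (\<pi> d, or (\<pi> d))"
    "\<And>v. v \<in> fst ` D \<Longrightarrow> cyclic_on \<pi> {d \<in> D. fst d = v}"
    by (rule dart_map_orientation) (rule that, assumption+)
  \<comment> \<open>Leaves are odd and old vertices even; the pairing function keeps the leaves of
    different half-edges apart.\<close>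
  define leaf where "leaf d = 2 * prod_encode d + 1" for d
  define j where "j d = (2 * fst d, if d \<in> S then 2 * snd d else leaf d)" for d
  let ?h = "D - S"
  have jS: "j d = (2 * fst d, 2 * snd d)" if "d \<in> S" for d using that by (simp add: j_def)
  have jh: "j d = (2 * fst d, leaf d)" if "d \<notin> S" for d using that by (simp add: j_def)
  have odd_leaf: "odd (leaf d)" for d by (simp add: leaf_def)
  have leaf_inj: "leaf d = leaf e \<longleftrightarrow> d = e" for d e
    by (simp add: leaf_def prod_encode_eq)
  have injj: "inj j"
  proof (rule injI)
    fix d e assume eq: "j d = j e"
    then have eq': "snd (j d) = snd (j e)" "fst d = fst e" by (simp_all add: j_def)
    show "d = e"
    proof (cases "d \<in> S"; cases "e \<in> S")
      assume "d \<in> S" "e \<in> S"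
      then show ?thesis using eq' jS by (simp add: prod_eq_iff)
    next
      assume "d \<in> S" "e \<notin> S"
      then show ?thesis using eq'(1) jS[of d] jh[of e] odd_leaf[of e] by (metis dvd_triv_left snd_conv)
    next
      assume "d \<notin> S" "e \<in> S"
      then show ?thesis using eq'(1) jS[of e] jh[of d] odd_leaf[of d] by (metis dvd_triv_left snd_conv)
    next
      assume "d \<notin> S" "e \<notin> S"
      then show ?thesis using eq'(1) jh leaf_inj by simp
    qed
  qed
  have inv_j: "inv j (j d) = d" for d using injj by (rule inv_f_f)
  have swapj: "prod.swap (j d) = j (prod.swap d)" if "d \<in> S" for d
    using jS[OF that] jS[OF gd(3)[OF that]] by simp
  let ?sj = "\<lambda>d. prod.swap (j d)"
  have fst_j: "even (fst (j d))" for d by (simp add: j_def)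
  have fst_sj: "odd (fst (?sj d))" if "d \<notin> S" for d using jh[OF that] odd_leaf by simp
  define P where "P = j ` D \<union> ?sj ` ?h"
  define V where "V = (\<lambda>v. 2 * v) ` fst ` D \<union> leaf ` ?h"
  define H where "H = \<lparr>pverts = V, parcs = P\<rparr>"
  have H: "pverts H = V" "parcs H = P" by (simp_all add: H_def)
  have sj_notin: "?sj d \<notin> j ` D" if "d \<in> ?h" for d
    using fst_sj[of d] fst_j that by (metis DiffD2 imageE)
  have fin: "finite D" "finite ?h" using gD by simp_all
  have leafV: "leaf d \<in> V" if "d \<in> ?h" for d using that by (simp add: V_def)
  have evenV: "2 * v \<in> V" if "v \<in> fst ` D" for v using that by (simp add: V_def)
  have jV: "j d \<in> V \<times> V" if "d \<in> D" for d
  proof (cases "d \<in> S")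
    case True
    have "fst d \<in> fst ` D" using that by blast
    moreover have "fst (prod.swap d) \<in> fst ` D" using gd(3)[OF True] gD(2) by blast
    ultimately show ?thesis using evenV unfolding jS[OF True] by simp
  next
    case False
    then show ?thesis using that evenV leafV unfolding jh[OF False] by simp
  qed
  have PV: "P \<subseteq> V \<times> V"
  proof
    fix e assume "e \<in> P"
    then consider d where "d \<in> D" "e = j d" | d where "d \<in> ?h" "e = ?sj d" by (auto simp: P_def)
    then show "e \<in> V \<times> V" using jV by cases (auto simp: mem_Times_iff)
  qed
  have symP: "prod.swap e \<in> P" if "e \<in> P" for e
  proof -
    from that consider d where "d \<in> D" "d \<in> S" "e = j d" | d where "d \<in> ?h" "e = j d" | d where "d \<in> ?h" "e = ?sj d"
      by (auto simp: P_def)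
    then show ?thesis
    proof cases
      case 1
      then show ?thesis using swapj[OF 1(2)] gd(3)[OF 1(2)] gD(2) by (auto simp: P_def)
    next
      case 2
      then show ?thesis by (auto simp: P_def)
    next
      case 3
      then show ?thesis by (auto simp: P_def)
    qed
  qed
  have neq: "fst (j d) \<noteq> snd (j d)" if "d \<in> D" for d
  proof (cases "d \<in> S")
    case True
    then show ?thesis using gd(2)[OF that] jS by simp
  next
    case False
    then show ?thesis using jh odd_leaf[of d] by (metis dvd_triv_left fst_conv snd_conv)
  qed
  have pg: "pair_graph H"
  proof (rule pair_graphI, unfold H)
    show "finite V" using fin by (simp add: V_def)
    show "(w, u) \<in> P" if "(u, w) \<in> P" for u w using symP[OF that] by simp
    show "u \<noteq> w" if "(u, w) \<in> P" for u w
    proof -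
      from that consider d where "d \<in> D" "(u, w) = j d" | d where "d \<in> ?h" "(u, w) = ?sj d" by (auto simp: P_def)
      then show ?thesis
      proof cases
        case 1
        then show ?thesis using neq[OF 1(1)] by (metis fst_conv snd_conv)
      next
        case 2
        then have "(w, u) = j d" by (metis swap_simp swap_swap)
        then show ?thesis using neq[of d] 2(1) by (metis DiffD1 fst_conv snd_conv)
      qed
    qed
  qed (fact PV)
  have P_ne: "P \<noteq> {}" using ne by (simp add: P_def)
  have conV: "(u, w) \<in> conn (fst ` D) S" if "u \<in> fst ` D" "w \<in> fst ` D" for u w
  proof (rule conn_if_comps_eq[where f = "\<lambda>_. ()"])
    have eq: "(\<lambda>_. ()) ` fst ` D = {()}" using ne by blast
    show "comps (fst ` D) S \<le> card ((\<lambda>_. ()) ` fst ` D)" unfolding con eq by simp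
    show "finite (fst ` D)" using fin(1) by simp
  qed (use that in simp_all)
  have con2: "(2 * u, 2 * w) \<in> conn V P" if "u \<in> fst ` D" "w \<in> fst ` D" for u w
    using conV[OF that]
  proof (rule conn_map)
    fix a b assume ab: "(a, b) \<in> S" "a \<in> fst ` D" "b \<in> fst ` D"
    have "(2 * a, 2 * b) = j (a, b)" using jS[OF ab(1)] by simp
    moreover have "(a, b) \<in> D" using ab(1) gD(2) by blast
    ultimately have "(2 * a, 2 * b) \<in> P" by (simp add: P_def)
    then show "(2 * a, 2 * b) \<in> conn V P" using evenV ab(2,3) by (intro conn_base)
  qed (use evenV in blast)
  obtain v\<^sub>0 where v0: "v\<^sub>0 \<in> fst ` D" using ne by blast
  have con3: "(2 * v\<^sub>0, u) \<in> conn V P" if "u \<in> V" for u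
  proof -
    from that consider w where "w \<in> fst ` D" "u = 2 * w" | d where "d \<in> ?h" "u = leaf d" unfolding V_def by blast
    then show ?thesis
    proof cases
      case 1
      then show ?thesis using con2[OF v0] by simp
    next
      case 2
      have d: "fst d \<in> fst ` D" using 2(1) by blast
      have "(2 * fst d, leaf d) = j d" using jh 2(1) by simp
      then have "(2 * fst d, leaf d) \<in> P" using 2(1) by (simp add: P_def)
      then have "(2 * fst d, u) \<in> conn V P" unfolding 2(2) using evenV[OF d] leafV[OF 2(1)] by (rule conn_base)
      with con2[OF v0 d] show ?thesis by (rule conn_trans)
    qed
  qed
  have connH: "Digraph_Component.connected (with_proj H)"
    unfolding connected_conn[OF pair_graphD(3)[OF pg]] H
  proof (intro conjI ballI)
    show "V \<noteq> {}" using ne by (simp add: V_def)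
    fix u w assume "u \<in> V" "w \<in> V"
    show "(u, w) \<in> conn V P"
      using conn_sym[OF con3[OF \<open>u \<in> V\<close>]] con3[OF \<open>w \<in> V\<close>] by (rule conn_trans)
  qed
  \<comment> \<open>A leaf has only one outgoing arc, which the rotation must fix.\<close>
  define rot where "rot e = (if e \<in> j ` D then j (\<pi> (inv j e)) else e)" for e
  have rot_j: "rot (j d) = j (\<pi> d)" if "d \<in> D" for d using that by (simp add: rot_def inv_j)
  have rot_sj: "rot (?sj d) = ?sj d" if "d \<in> ?h" for d using sj_notin[OF that] by (simp add: rot_def)
  have \<pi>D: "\<pi> d \<in> D" if "d \<in> D" for d using that permutes_in_image[OF \<pi>(1)] by blast
  have permD: "rot permutes j ` D"
  proof (rule bij_imp_permutes)
    have "rot ` j ` D = j ` \<pi> ` D"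
      unfolding image_image by (rule image_cong) (simp_all add: rot_j)
    then have "rot ` j ` D = j ` D" using permutes_image[OF \<pi>(1)] by simp
    moreover have "inj_on rot (j ` D)"
    proof (rule inj_onI)
      fix e e' assume ee: "e \<in> j ` D" "e' \<in> j ` D" "rot e = rot e'"
      then obtain d d' where d: "d \<in> D" "e = j d" "d' \<in> D" "e' = j d'" by blast
      then have "j (\<pi> d) = j (\<pi> d')" using ee(3) rot_j by simp
      then have "\<pi> d = \<pi> d'" using injj by (simp add: inj_eq)
      then have "d = d'" using permutes_inj[OF \<pi>(1)] by (simp add: inj_eq)
      then show "e = e'" using d by simp
    qed
    ultimately show "bij_betw rot (j ` D) (j ` D)" by (simp add: bij_betw_def)
  qed (simp add: rot_def)
  have perm: "rot permutes P"
    using permD by (rule permutes_subset) (simp add: P_def)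
  \<comment> \<open>Reading flags relative to the chosen directions replaces the bit s by
    \<open>s = or d\<close>. The signature of an edge changes exactly when \<open>or\<close> differs
    at its two ends.\<close>
  define tw2 where "tw2 d = ((or d = tw d) = or (prod.swap d))" for d
  define twH where "twH e = (e \<in> j ` S \<and> tw2 (inv j e))" for e
  have twH_S: "twH (j d) = tw2 d" if "d \<in> S" for d using that by (simp add: twH_def inv_j)
  have notS: "j d \<notin> j ` S" "?sj d \<notin> j ` S" if "d \<notin> S" for d
  proof -
    show "j d \<notin> j ` S" using that injj by (simp add: inj_image_mem_iff)
    show "?sj d \<notin> j ` S" using fst_sj[OF that] fst_j by (metis imageE)
  qed
  have twH_h: "\<not> twH (j d)" "\<not> twH (?sj d)" if "d \<notin> S" for d using notS[OF that] by (simp_all add: twH_def)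
  have sig: "edge_signature H twH"
  proof -
    have "twH (prod.swap e) = twH e" if "e \<in> P" for e
    proof -
      from that consider d where "d \<in> S" "e = j d" | d where "d \<in> ?h" "e = j d" | d where "d \<in> ?h" "e = ?sj d"
        by (auto simp: P_def)
      then show ?thesis
      proof cases
        case 1
        have "tw2 (prod.swap d) = tw2 d" using gd(1)[of d] by (auto simp: tw2_def)
        then show ?thesis using twH_S[OF 1(1)] twH_S[OF gd(3)[OF 1(1)]] swapj[OF 1(1)] 1(2) by simp
      qed (use twH_h in auto)
    qed
    then show ?thesis unfolding edge_signature_def H by force
  qed
  have rotH: "rotation_system H rot"
    unfolding rotation_system_def H
  proof (intro conjI ballI impI)
    show "rot permutes P" by (fact perm)
    fix v assume "v \<in> V"
    have oa: "out_arcs (with_proj H) v = {e \<in> P. fst e = v}"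
      by (auto simp: out_arcs_def H)
    from \<open>v \<in> V\<close> consider w where "w \<in> fst ` D" "v = 2 * w" | d where "d \<in> ?h" "v = leaf d" unfolding V_def by blast
    then show "cyclic_on rot (out_arcs (with_proj H) v)"
    proof cases
      case 1
      have "{e \<in> P. fst e = v} = j ` {d \<in> D. fst d = w}"
      proof
        show "{e \<in> P. fst e = v} \<subseteq> j ` {d \<in> D. fst d = w}"
        proof
          fix e assume "e \<in> {e \<in> P. fst e = v}"
          then have e: "e \<in> P" "fst e = 2 * w" using 1(2) by auto
          have "e \<noteq> ?sj d" if "d \<in> ?h" for d
            using fst_sj[of d] that e(2) by (metis DiffD2 dvd_triv_left)
          then obtain d where d: "d \<in> D" "e = j d" using e(1) unfolding P_def by blast
          then have "fst d = w" using e(2) by (simp add: j_def)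
          with d show "e \<in> j ` {d \<in> D. fst d = w}" by blast
        qed
        show "j ` {d \<in> D. fst d = w} \<subseteq> {e \<in> P. fst e = v}"
          using 1(2) by (auto simp: P_def j_def)
      qed
      moreover have "cyclic_on rot (j ` {d \<in> D. fst d = w})"
        using \<pi>(4)[OF 1(1)] by (rule cyclic_on_image) (simp add: rot_j)
      ultimately show ?thesis unfolding oa by simp
    next
      case 2
      have "{e \<in> P. fst e = v} = {?sj d}"
      proof
        show "{?sj d} \<subseteq> {e \<in> P. fst e = v}" using 2 jh by (auto simp: P_def)
        show "{e \<in> P. fst e = v} \<subseteq> {?sj d}"
        proof
          fix e assume "e \<in> {e \<in> P. fst e = v}"
          then have e: "e \<in> P" "fst e = leaf d" using 2(2) by auto
          then have "e \<notin> j ` D" using fst_j odd_leaf by (metis imageE)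
          then obtain d' where d': "d' \<in> ?h" "e = ?sj d'" using e(1) by (auto simp: P_def)
          then have "leaf d' = leaf d" using jh e(2) by simp
          then show "e \<in> {?sj d}" using leaf_inj d' by simp
        qed
      qed
      moreover have "orbit rot (?sj d) = {?sj d}"
        using rot_sj[OF 2(1)] by (simp add: orbit_eq_singleton_iff)
      ultimately show ?thesis unfolding oa cyclic_on_def by simp
    qed
  qed
  have cs: "comb_surface H rot twH"
    unfolding comb_surface_def using pg connH rotH sig by blast
  note F = num_faces_eq_comps(3)[OF cs, unfolded H, OF P_ne]
  let ?X = "P \<times> (UNIV :: bool set)"
  let ?R = "gr (flags D) (traverse S tw) \<union> gr (flags D) \<beta>"
  \<comment> \<open>Undoes this renaming and folds each pendant edge back: its four flags go to the
    two flags of the half-edge, just as a face runs to the leaf and returns.\<close>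
  define g where "g p = (if fst p \<in> j ` D then (inv j (fst p), snd p = or (inv j (fst p)))
    else (inv j (prod.swap (fst p)), (\<not> snd p) = or (inv j (prod.swap (fst p)))))" for p
  have g_j: "g (j d, s) = (d, s = or d)" if "d \<in> D" for d s using that by (simp add: g_def inv_j)
  have g_sj: "g (?sj d, s) = (d, (\<not> s) = or d)" if "d \<in> ?h" for d s
    using sj_notin[OF that] by (simp add: g_def inv_j)
  have cases: thesis'
    if "p \<in> ?X" "\<And>d s. p = (j d, s) \<Longrightarrow> d \<in> S \<Longrightarrow> d \<in> D \<Longrightarrow> thesis'"
      "\<And>d s. p = (j d, s) \<Longrightarrow> d \<in> ?h \<Longrightarrow> thesis'" "\<And>d s. p = (?sj d, s) \<Longrightarrow> d \<in> ?h \<Longrightarrow> thesis'" for p thesis'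
  proof -
    from that(1) obtain e s where p: "p = (e, s)" "e \<in> P" by auto
    show ?thesis
    proof (cases "e \<in> j ` D")
      case True
      then obtain d where "d \<in> D" "e = j d" by blast
      then show ?thesis using that(2,3) p(1) by (cases "d \<in> S") auto
    next
      case False
      then obtain d where "d \<in> ?h" "e = ?sj d" using p(2) by (auto simp: P_def)
      then show ?thesis using that(4) p(1) by auto
    qed
  qed
  have g_in: "g p \<in> flags D" if "p \<in> ?X" for p
    using that by (rule cases) (simp_all add: g_j g_sj)
  have beta_conn: "((d, \<not> or d), (\<pi> d, or (\<pi> d))) \<in> conn (flags D) ?R" if "d \<in> D" for d
    using that \<pi>D[OF that] \<pi>(3)[OF that] by (intro conn_base) auto
  have rot_conn: "(g (e, False), g (rot e, True)) \<in> conn (flags D) ?R" if "e \<in> P" for e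
  proof (cases "e \<in> j ` D")
    case True
    then obtain d where d: "d \<in> D" "e = j d" by blast
    then have "g (e, False) = (d, \<not> or d)" "g (rot e, True) = (\<pi> d, or (\<pi> d))"
      using rot_j[OF d(1)] g_j[OF d(1)] g_j[OF \<pi>D[OF d(1)]] by simp_all
    then show ?thesis using beta_conn[OF d(1)] by simp
  next
    case False
    with that obtain d where d: "d \<in> ?h" "e = ?sj d" by (auto simp: P_def)
    have "g (e, False) = (d, or d)" "g (rot e, True) = (d, \<not> or d)"
      using rot_sj[OF d(1)] g_sj[OF d(1)] d(2) by simp_all
    moreover have "traverse S tw (d, or d) = (d, \<not> or d)"
      using d(1) by (simp add: traverse_def flip_def)
    then have "((d, or d), (d, \<not> or d)) \<in> conn (flags D) ?R"
      using d(1) by (intro conn_base) auto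
    ultimately show ?thesis by simp
  qed
  have "map_faces D S tw \<beta> \<le> comps ?X (gr ?X (face_reverse twH) \<union> gr ?X (corner rot))"
    unfolding map_faces_def
  proof (rule comps_le[where g = g])
    show "finite ?X" using fin by (simp add: P_def)
    show "g p \<in> flags D" if "p \<in> ?X" for p using that by (rule g_in)
    fix p q assume pq: "(p, q) \<in> gr ?X (face_reverse twH) \<union> gr ?X (corner rot)" "p \<in> ?X" "q \<in> ?X"
    then consider "q = face_reverse twH p" | "q = corner rot p" by (auto simp: gr_def)
    then show "(g p, g q) \<in> conn (flags D) ?R"
    proof cases
      case 1
      from pq(2) show ?thesis
      proof (rule cases)
        fix d s assume p: "p = (j d, s)" "d \<in> S" "d \<in> D"
        have "q = (j (prod.swap d), s = tw2 d)"
          using 1 p(1) twH_S[OF p(2)] swapj[OF p(2)] by (simp add: face_reverse_def)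
        moreover have sD: "prod.swap d \<in> D" using gd(3)[OF p(2)] gD(2) by blast
        ultimately have "g q = (prod.swap d, (s = tw2 d) = or (prod.swap d))"
          using g_j by simp
        moreover have "traverse S tw (d, s = or d) = (prod.swap d, (s = or d) = tw d)"
          using p(2) by (simp add: traverse_def)
        moreover have "((s = or d) = tw d) = ((s = tw2 d) = or (prod.swap d))"
          by (auto simp: tw2_def)
        ultimately have "g q = traverse S tw (d, s = or d)" by simp
        moreover have "g p = (d, s = or d)" using p g_j by simp
        ultimately show ?thesis using g_in[OF pq(2)] g_in[OF pq(3)] by (intro conn_base) auto
      next
        fix d s assume p: "p = (j d, s)" "d \<in> ?h"
        have "q = (?sj d, \<not> s)" using 1 p(1) twH_h[of d] p(2) by (simp add: face_reverse_def)
        then have "g q = g p" using p g_sj[OF p(2)] g_j by simp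
        then show ?thesis using g_in[OF pq(2)] by (simp add: conn_refl)
      next
        fix d s assume p: "p = (?sj d, s)" "d \<in> ?h"
        have "q = (j d, \<not> s)" using 1 p(1) twH_h[of d] p(2) by (simp add: face_reverse_def)
        then have "g q = g p" using p g_sj[OF p(2)] g_j by simp
        then show ?thesis using g_in[OF pq(2)] by (simp add: conn_refl)
      qed
    next
      case 2
      obtain e s where p: "p = (e, s)" "e \<in> P" using pq(2) by auto
      show ?thesis
      proof (cases s)
        case False
        then have "q = (rot e, True)" using 2 p(1) by (simp add: corner_def)
        then show ?thesis using rot_conn[OF p(2)] p(1) False by simp
      next
        case True
        define e' where "e' = inv rot e"
        have e': "e' \<in> P" "rot e' = e"
          using p(2) permutes_in_image[OF permutes_inv[OF perm]] permutes_inverses[OF perm]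
          by (simp_all add: e'_def)
        have "q = (e', False)" using 2 p(1) True by (simp add: corner_def e'_def)
        then show ?thesis using conn_sym[OF rot_conn[OF e'(1)]] e'(2) p(1) True by simp
      qed
    qed
  next
    fix c assume c: "c \<in> flags D"
    obtain d s where ds: "c = (d, s)" "d \<in> D" using c by auto
    have "g (j d, s = or d) = c" using g_j[OF ds(2)] ds(1) by auto
    moreover have "(j d, s = or d) \<in> ?X" using ds(2) by (simp add: P_def)
    ultimately show "\<exists>p\<in>?X. (g p, c) \<in> conn (flags D) ?R"
      using c conn_refl by metis
  qed
  then have faces: "map_faces D S tw \<beta> \<le> num_faces H rot twH" unfolding F .
  \<comment> \<open>Each half-edge yields one new vertex and one new edge, which cancel in the Euler
    characteristic.\<close>
  have cV: "card V = card (fst ` D) + card ?h"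
  proof -
    have "card ((\<lambda>v. 2 * v) ` fst ` D) = card (fst ` D)"
      by (intro card_image inj_onI) simp
    moreover have "card (leaf ` ?h) = card ?h"
      by (intro card_image inj_onI) (simp add: leaf_inj)
    moreover have "(\<lambda>v. 2 * v) ` fst ` D \<inter> leaf ` ?h = {}"
      using odd_leaf by (metis (no_types, lifting) disjoint_iff dvd_triv_left imageE)
    ultimately show ?thesis unfolding V_def using fin by (simp add: card_Un_disjoint)
  qed
  have cP: "card P = card S + 2 * card ?h"
  proof -
    have "card (j ` D) = card D" using injj by (intro card_image) (rule inj_on_subset, auto)
    moreover have "card (?sj ` ?h) = card ?h"
    proof (intro card_image inj_onI)
      fix d e assume eq: "?sj d = ?sj e"
      then have "j d = j e" by (simp add: prod_eq_iff)
      then show "d = e" using injj by (simp add: inj_eq)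
    qed
    moreover have "j ` D \<inter> ?sj ` ?h = {}"
    proof (rule equals0I)
      fix e assume "e \<in> j ` D \<inter> ?sj ` ?h"
      then obtain d where "d \<in> ?h" "e = ?sj d" "e \<in> j ` D" by blast
      then show False using sj_notin[of d] by simp
    qed
    moreover have "card D = card S + card ?h"
      using gD fin by (metis add.commute card_Diff_subset card_mono le_add_diff_inverse2)
    ultimately show ?thesis unfolding P_def using fin by (simp add: card_Un_disjoint)
  qed
  have "surface_euler_genus H rot twH \<le> map_genus D S tw \<beta>"
    using faces con unfolding surface_euler_genus_def surface_euler_char_def H map_genus_def cV cP
    by simp
  moreover have "map_prod (\<lambda>v. 2 * v) (\<lambda>v. 2 * v) ` S \<subseteq> P"
  proof (rule image_subsetI)
    fix d assume d: "d \<in> S"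
    have "map_prod (\<lambda>v. 2 * v) (\<lambda>v. 2 * v) d = j d" using jS[OF d] by (cases d) simp
    then show "map_prod (\<lambda>v. 2 * v) (\<lambda>v. 2 * v) d \<in> P" using d gD(2) by (auto simp: P_def)
  qed
  ultimately show ?thesis
    using cs P_ne by (intro that[of H rot twH]) (auto simp: H V_def)
qed

text \<open>Surfaces are connected, so the map is made connected by bridges before it is realised.
  Only upper bounds on the genus are carried along, hence some k' below k; nonnegativity makes the
  final value a natural number.\<close>

lemma embeds_if_map_embeds:
  assumes "parcs G \<noteq> {}" "map_embeds G k"
  shows "\<exists>k'\<le>k. embeds_in_euler_genus G k'"
proof -
  obtain D :: "(nat \<times> nat) set" and tw \<beta> f where D: "dart_map D (map_prod f f ` parcs G) tw \<beta>"
    "inj_on f (pverts G)" "f ` pverts G \<subseteq> fst ` D" "map_genus D (map_prod f f ` parcs G) tw \<beta> \<le> int k"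
    using assms(2) unfolding map_embeds_def by (elim exE conjE) (rule that)
  let ?S = "map_prod f f ` parcs G"
  have "?S \<subseteq> D" using dart_graphD(2)[OF dart_mapD(1)[OF D(1)]] .
  then have "D \<noteq> {}" using assms(1) by auto
  with D(1) obtain D' S' \<beta>' where D': "dart_map D' S' tw \<beta>'" "fst ` D' = fst ` D" "?S \<subseteq> S'"
    "map_genus D' S' tw \<beta>' \<le> map_genus D ?S tw \<beta>" "comps (fst ` D') S' = 1"
    by (rule dart_map_connect)
  have "D' \<noteq> {}" using D'(2) \<open>D \<noteq> {}\<close> by auto
  with D'(1) obtain H \<pi> tw' where H: "comb_surface H \<pi> tw'" "parcs H \<noteq> {}"
    "surface_euler_genus H \<pi> tw' \<le> map_genus D' S' tw \<beta>'"
    "(\<lambda>v. 2 * v) ` fst ` D' \<subseteq> pverts H" "map_prod (\<lambda>v. 2 * v) (\<lambda>v. 2 * v) ` S' \<subseteq> parcs H"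
    using D'(5) by (rule dart_map_realise)
  let ?f = "\<lambda>v. 2 * f v"
  have ge: "0 \<le> surface_euler_genus H \<pi> tw'" using H(1,2) by (rule surface_euler_genus_nonneg)
  have "inj_on ?f (pverts G)" using D(2) by (simp add: inj_on_def)
  moreover have "?f ` pverts G \<subseteq> pverts H"
  proof (rule image_subsetI)
    fix v assume "v \<in> pverts G"
    then have "f v \<in> fst ` D'" using D(3) D'(2) by blast
    then show "2 * f v \<in> pverts H" using H(4) by blast
  qed
  moreover have "map_prod ?f ?f ` parcs G \<subseteq> parcs H"
  proof (rule image_subsetI)
    fix d assume "d \<in> parcs G"
    then have "map_prod f f d \<in> S'" using D'(3) by blast
    then have "map_prod (\<lambda>v. 2 * v) (\<lambda>v. 2 * v) (map_prod f f d) \<in> parcs H" using H(5) by blast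
    then show "map_prod ?f ?f d \<in> parcs H" by (cases d) simp
  qed
  ultimately have "embeds_in_euler_genus G (nat (surface_euler_genus H \<pi> tw'))"
    unfolding embeds_in_euler_genus_def using H(1) ge
    by (intro exI[of _ H] exI[of _ \<pi>] exI[of _ tw'] exI[of _ ?f] conjI) simp_all
  moreover have "nat (surface_euler_genus H \<pi> tw') \<le> k"
    using H(3) D'(4) D(4) by simp
  ultimately show ?thesis by blast
qed


section \<open>Additivity over edge amalgamations\<close>

lemma dart_map_insert_many:
  assumes "finite E" "dart_map D S tw \<beta>" "\<And>d. d \<in> E \<Longrightarrow> fst d \<in> fst ` D \<and> fst d \<noteq> snd d"
  shows "\<exists>\<beta>'. dart_map (D \<union> E) S tw \<beta>' \<and> fst ` (D \<union> E) = fst ` D"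
  using assms(1,3)
proof (induction E rule: finite_induct)
  case empty
  then show ?case using assms(2) by auto
next
  case (insert e E)
  then obtain \<beta>\<^sub>1 where 1: "dart_map (D \<union> E) S tw \<beta>\<^sub>1" "fst ` (D \<union> E) = fst ` D" by blast
  have e: "fst e \<in> fst ` (D \<union> E)" "fst e \<noteq> snd e" using insert.prems[of e] 1(2) by auto
  obtain \<beta>' where "dart_map (Set.insert e (D \<union> E)) S tw \<beta>'"
    by (rule dart_map_insert[OF 1(1) e])
  moreover have "D \<union> Set.insert e E = Set.insert e (D \<union> E)" by simp
  moreover have "fst ` (Set.insert e (D \<union> E)) = fst ` D"
    using 1(2) insert.prems[of e] by auto
  ultimately show ?case by metis
qed

lemma map_embedsI:
  fixes D :: "(nat \<times> nat) set"
  assumes "dart_map D (map_prod f f ` parcs G) tw \<beta>" "inj_on f (pverts G)" "f ` pverts G \<subseteq> fst ` D"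
  shows "map_embeds G (nat (map_genus D (map_prod f f ` parcs G) tw \<beta>))"
  unfolding map_embeds_def using assms
  by (intro exI[of _ D] exI[of _ tw] exI[of _ \<beta>] exI[of _ f] conjI) simp_all

lemma image_arcs:
  assumes "pair_graph G" "inj_on f (pverts G)"
  shows "d \<in> map_prod f f ` parcs G \<Longrightarrow> prod.swap d \<in> map_prod f f ` parcs G"
    "d \<in> map_prod f f ` parcs G \<Longrightarrow> fst d \<noteq> snd d"
    "map_prod f f ` parcs G \<subseteq> f ` pverts G \<times> f ` pverts G"
    "finite (map_prod f f ` parcs G)" "even (card (map_prod f f ` parcs G))"
proof -
  let ?S = "map_prod f f ` parcs G"
  note pg = pair_graphD[OF assms(1)]
  have 1: "prod.swap d \<in> ?S \<and> fst d \<noteq> snd d \<and> d \<in> f ` pverts G \<times> f ` pverts G" if d: "d \<in> ?S" for d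
  proof -
    obtain u w where uw: "(u, w) \<in> parcs G" "d = (f u, f w)" using d by auto
    have V: "u \<in> pverts G" "w \<in> pverts G" using pg(3) uw(1) by auto
    have "prod.swap d = map_prod f f (w, u)" using uw(2) by simp
    then have "prod.swap d \<in> ?S" using pg(4)[OF uw(1)] by (rule image_eqI)
    moreover have "f u \<noteq> f w" using pg(5)[OF uw(1)] inj_onD[OF assms(2) _ V] by blast
    ultimately show ?thesis using uw(2) V by simp
  qed
  then show "d \<in> ?S \<Longrightarrow> prod.swap d \<in> ?S" "d \<in> ?S \<Longrightarrow> fst d \<noteq> snd d" "?S \<subseteq> f ` pverts G \<times> f ` pverts G"
    by blast+
  show fin: "finite ?S" using pg(2) by simp
  have "fpf ?S prod.swap"
    unfolding fpf_def
  proof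
    fix d assume "d \<in> ?S"
    then have "prod.swap d \<in> ?S" "fst d \<noteq> snd d" using 1 by blast+
    then show "prod.swap d \<in> ?S \<and> prod.swap (prod.swap d) = d \<and> prod.swap d \<noteq> d"
      by (metis fst_swap swap_swap)
  qed
  with fin show "even (card ?S)" by (rule fpf_even_card)
qed

text \<open>\<open>euler_genus\<close> is a \<open>LEAST\<close>, so some embedding has to exist.
  One half-edge per vertex with \<open>flip\<close> as corner matching is a map; the arcs of G are
  inserted as half-edges in any corners and afterwards declared to be edges.\<close>

lemma ex_map_embeds:
  assumes "pair_graph G"
  shows "\<exists>k. map_embeds G k"
proof -
  note pg = pair_graphD[OF assms]
  obtain f :: "'a \<Rightarrow> nat" where f: "inj_on f (pverts G)"
    using finite_imp_inj_to_nat_seg[OF pg(1)] by blast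
  let ?V = "f ` pverts G" and ?S = "map_prod f f ` parcs G"
  have finV: "finite ?V" using pg(1) by simp
  obtain l where l: "l \<notin> ?V" using ex_new_if_finite[OF infinite_UNIV_nat finV] by blast
  define D where "D = (\<lambda>v. (v, l)) ` ?V"
  have fstD: "fst ` D = ?V" by (simp add: D_def image_image)
  have finD: "finite D" using finV by (simp add: D_def)
  have "dart_map D {} (\<lambda>_. False) flip"
    unfolding dart_map_def
  proof (intro conjI ballI)
    show "dart_graph D {} (\<lambda>_. False)"
      unfolding dart_graph_def using finD l by (auto simp: D_def)
    have "num_verts D flip \<le> comps ?V {}"
      unfolding num_verts_def
    proof (rule comps_le[where g = "\<lambda>v. ((v, l), False)"])
      fix c assume c: "c \<in> flags D"
      then obtain v s where v: "v \<in> ?V" "c = ((v, l), s)" by (auto simp: D_def)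
      have "(((v, l), False), c) \<in> conn (flags D) (corner_rel D flip)"
      proof (cases s)
        case False
        then show ?thesis using v c by (simp add: conn_refl)
      next
        case True
        then have "c = flip ((v, l), False)" using v by (simp add: flip_def)
        moreover have "((v, l), False) \<in> flags D" using v(1) by (simp add: D_def)
        ultimately show ?thesis using c by (intro conn_base) (simp_all add: corner_rel_iff)
      qed
      then show "\<exists>u\<in>?V. (((u, l), False), c) \<in> conn (flags D) (corner_rel D flip)" using v(1) by blast
    qed (use finV in \<open>auto simp: D_def\<close>)
    then show "num_verts D flip = card (fst ` D)"
      using num_verts_ge[OF finD, of flip] by (simp add: comps_empty_rel fstD)
  qed (simp_all add: fpf_flip)
  then have "\<exists>\<beta>. dart_map (D \<union> ?S) {} (\<lambda>_. False) \<beta> \<and> fst ` (D \<union> ?S) = fst ` D"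
  proof (rule dart_map_insert_many[OF image_arcs(4)[OF assms f]])
    fix d assume d: "d \<in> ?S"
    then have "d \<in> ?V \<times> ?V" using image_arcs(3)[OF assms f] by blast
    then show "fst d \<in> fst ` D \<and> fst d \<noteq> snd d"
      using image_arcs(2)[OF assms f d] unfolding fstD mem_Times_iff by blast
  qed
  then obtain \<beta> where \<beta>: "dart_map (D \<union> ?S) {} (\<lambda>_. False) \<beta>" "fst ` (D \<union> ?S) = fst ` D"
    by blast
  have "dart_graph (D \<union> ?S) ?S (\<lambda>_. False)"
    unfolding dart_graph_def
    using dart_graphD(1)[OF dart_mapD(1)[OF \<beta>(1)]] dart_graph_dartD(2)[OF dart_mapD(1)[OF \<beta>(1)]]
      image_arcs(1)[OF assms f] by blast
  then have dm: "dart_map (D \<union> ?S) ?S (\<lambda>_. False) \<beta>"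
    using dart_mapD[OF \<beta>(1)] unfolding dart_map_def by blast
  have "?V \<subseteq> fst ` (D \<union> ?S)" unfolding \<beta>(2) fstD by (rule subset_refl)
  from map_embedsI[OF dm f this] show ?thesis by (rule exI)
qed

lemma euler_genus_le:
  assumes "parcs G \<noteq> {}" "map_embeds G k"
  shows "euler_genus G \<le> k"
proof -
  obtain k' where k': "k' \<le> k" "embeds_in_euler_genus G k'"
    using embeds_if_map_embeds[OF assms] by blast
  have "euler_genus G \<le> k'"
    unfolding euler_genus_def using k'(2) by (rule Least_le)
  with k'(1) show ?thesis by simp
qed

lemma map_embeds_euler_genus:
  assumes "pair_graph G" "parcs G \<noteq> {}"
  shows "map_embeds G (euler_genus G)"
proof -
  obtain k where "map_embeds G k" using ex_map_embeds[OF assms(1)] by blast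
  then obtain k' where "embeds_in_euler_genus G k'" using embeds_if_map_embeds[OF assms(2)] by blast
  then have "embeds_in_euler_genus G (euler_genus G)" unfolding euler_genus_def by (rule LeastI)
  with assms show ?thesis by (rule map_embeds_if_embeds)
qed

lemma card_glue:
  assumes "finite S\<^sub>1" "finite S\<^sub>2" "even (card S\<^sub>1)" "even (card S\<^sub>2)" "S\<^sub>1 \<inter> S\<^sub>2 = {(x, y), (y, x)}" "x \<noteq> y"
  shows "card S\<^sub>1 div 2 + card S\<^sub>2 div 2 = card (S\<^sub>1 \<union> S\<^sub>2) div 2 + 1"
proof -
  have "card S\<^sub>1 + card S\<^sub>2 = card (S\<^sub>1 \<union> S\<^sub>2) + 2"
    using card_Un_Int[OF assms(1,2)] assms(5,6) by simp
  then show ?thesis using assms(3,4) by (auto elim!: evenE)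
qed

text \<open>The two sides together have one component, two vertices and one edge more than the
  whole, contributing 2 - 2 + 1 = 1. So the face inequalities with offset one are exactly genus
  inequalities.\<close>

lemma map_genus_glue:
  assumes "finite V\<^sub>1" "finite V\<^sub>2" "V\<^sub>1 \<inter> V\<^sub>2 = {x, y}" "x \<noteq> y"
    and "S\<^sub>1 \<subseteq> V\<^sub>1 \<times> V\<^sub>1" "S\<^sub>2 \<subseteq> V\<^sub>2 \<times> V\<^sub>2" "(x, y) \<in> S\<^sub>1" "(x, y) \<in> S\<^sub>2" "(y, x) \<in> S\<^sub>1" "(y, x) \<in> S\<^sub>2"
    and "\<And>d. d \<in> S\<^sub>1 \<Longrightarrow> fst d \<noteq> snd d" "even (card S\<^sub>1)" "even (card S\<^sub>2)"
    and D: "fst ` D = V\<^sub>1 \<union> V\<^sub>2" "fst ` D\<^sub>1 = V\<^sub>1" "fst ` D\<^sub>2 = V\<^sub>2"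
  shows "map_genus D\<^sub>1 S\<^sub>1 tw\<^sub>1 \<beta>\<^sub>1 + map_genus D\<^sub>2 S\<^sub>2 tw\<^sub>2 \<beta>\<^sub>2 - map_genus D (S\<^sub>1 \<union> S\<^sub>2) tw \<beta>
    = int (map_faces D (S\<^sub>1 \<union> S\<^sub>2) tw \<beta>) + 1 - int (map_faces D\<^sub>1 S\<^sub>1 tw\<^sub>1 \<beta>\<^sub>1) - int (map_faces D\<^sub>2 S\<^sub>2 tw\<^sub>2 \<beta>\<^sub>2)"
proof -
  have fin: "finite S\<^sub>1" "finite S\<^sub>2" using assms(1,2,5,6) finite_subset by blast+
  have "S\<^sub>1 \<inter> S\<^sub>2 = {(x, y), (y, x)}"
  proof
    show "S\<^sub>1 \<inter> S\<^sub>2 \<subseteq> {(x, y), (y, x)}"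
    proof
      fix d assume d: "d \<in> S\<^sub>1 \<inter> S\<^sub>2"
      then have "fst d \<in> V\<^sub>1 \<inter> V\<^sub>2" "snd d \<in> V\<^sub>1 \<inter> V\<^sub>2" using assms(5,6) by auto
      moreover have "fst d \<noteq> snd d" using d assms(11) by blast
      ultimately show "d \<in> {(x, y), (y, x)}" unfolding assms(3) by (cases d) auto
    qed
  qed (use assms(7-10) in blast)
  then have "card S\<^sub>1 div 2 + card S\<^sub>2 div 2 = card (S\<^sub>1 \<union> S\<^sub>2) div 2 + 1"
    using fin assms(4,12,13) by (intro card_glue)
  moreover have "card V\<^sub>1 + card V\<^sub>2 = card (V\<^sub>1 \<union> V\<^sub>2) + 2"
    using card_Un_Int[OF assms(1,2)] assms(3,4) by simp
  moreover have "comps (V\<^sub>1 \<union> V\<^sub>2) (S\<^sub>1 \<union> S\<^sub>2) + 1 = comps V\<^sub>1 S\<^sub>1 + comps V\<^sub>2 S\<^sub>2"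
    using assms(1-3,5-8) by (rule comps_glue)
  ultimately show ?thesis unfolding map_genus_def D by linarith
qed

lemma euler_genus_glue_ge:
  assumes A: "pair_graph A" and B: "pair_graph B" and G: "pair_graph G"
    and V: "pverts G = pverts A \<union> pverts B" "pverts A \<inter> pverts B = {x, y}"
    and E: "parcs G = parcs A \<union> parcs B" "(x, y) \<in> parcs A" "(x, y) \<in> parcs B"
  shows "euler_genus A + euler_genus B \<le> euler_genus G"
proof -
  have "parcs G \<noteq> {}" using E by auto
  obtain D :: "(nat \<times> nat) set" and tw \<beta> f where D: "dart_map D (map_prod f f ` parcs G) tw \<beta>"
    "inj_on f (pverts G)" "f ` pverts G \<subseteq> fst ` D" "map_genus D (map_prod f f ` parcs G) tw \<beta> \<le> int (euler_genus G)"
    using map_embeds_euler_genus[OF G \<open>parcs G \<noteq> {}\<close>] unfolding map_embeds_def by (elim exE conjE) (rule that)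
  have fA: "inj_on f (pverts A)" and fB: "inj_on f (pverts B)"
    using D(2) V(1) by (auto intro: inj_on_subset)
  let ?S1 = "map_prod f f ` parcs A" and ?S2 = "map_prod f f ` parcs B"
  note iA = image_arcs[OF A fA] and iB = image_arcs[OF B fB]
  define V\<^sub>2 where "V\<^sub>2 = f ` pverts B"
  \<comment> \<open>Vertices of the map that do not come from G are assigned to the first side, so
    that the two sides cover all vertices.\<close>
  define V\<^sub>1 where "V\<^sub>1 = fst ` D - (V\<^sub>2 - {f x, f y})"
  have xy: "x \<in> pverts A" "x \<in> pverts B" "y \<in> pverts A" "y \<in> pverts B" using V(2) by auto
  have "x \<noteq> y" using pair_graphD(5)[OF A E(2)] .
  then have fxy: "f x \<noteq> f y" using inj_onD[OF fA _ xy(1,3)] by blast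
  have S: "map_prod f f ` parcs G = ?S1 \<union> ?S2" unfolding E(1) by (rule image_Un)
  have V2D: "V\<^sub>2 \<subseteq> fst ` D" using D(3) V(1) by (auto simp: V\<^sub>2_def)
  have in2: "f x \<in> V\<^sub>2" "f y \<in> V\<^sub>2" using xy by (auto simp: V\<^sub>2_def)
  have Vs: "fst ` D = V\<^sub>1 \<union> V\<^sub>2" "V\<^sub>1 \<inter> V\<^sub>2 = {f x, f y}"
    using V2D in2 unfolding V\<^sub>1_def by blast+
  have AV: "f ` pverts A \<subseteq> V\<^sub>1"
  proof (rule image_subsetI)
    fix u assume u: "u \<in> pverts A"
    have "f u \<in> fst ` D" using D(3) V(1) u by blast
    moreover have "f u \<in> {f x, f y}" if fu: "f u \<in> V\<^sub>2"
    proof -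
      obtain w where w: "w \<in> pverts B" "f u = f w" using fu by (auto simp: V\<^sub>2_def)
      then have "u = w" using inj_onD[OF D(2), of u w] u V(1) by blast
      then have "u \<in> {x, y}" using u w(1) V(2) by blast
      then show ?thesis by auto
    qed
    ultimately show "f u \<in> V\<^sub>1" unfolding V\<^sub>1_def by blast
  qed
  have S1V: "?S1 \<subseteq> V\<^sub>1 \<times> V\<^sub>1" using iA(3) AV by blast
  have S2V: "?S2 \<subseteq> V\<^sub>2 \<times> V\<^sub>2" using iB(3) by (simp add: V\<^sub>2_def)
  have e1: "(f x, f y) \<in> ?S1" "(f x, f y) \<in> ?S2" using E(2,3) by force+
  have e2: "(f y, f x) \<in> ?S1" "(f y, f x) \<in> ?S2" using iA(1)[OF e1(1)] iB(1)[OF e1(2)] by simp_all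
  obtain D\<^sub>1 tw\<^sub>1 \<beta>\<^sub>1 D\<^sub>2 tw\<^sub>2 \<beta>\<^sub>2 where R: "dart_map D\<^sub>1 ?S1 tw\<^sub>1 \<beta>\<^sub>1" "fst ` D\<^sub>1 = V\<^sub>1"
    "dart_map D\<^sub>2 ?S2 tw\<^sub>2 \<beta>\<^sub>2" "fst ` D\<^sub>2 = V\<^sub>2"
    "map_faces D (?S1 \<union> ?S2) tw \<beta> + 1 \<le> map_faces D\<^sub>1 ?S1 tw\<^sub>1 \<beta>\<^sub>1 + map_faces D\<^sub>2 ?S2 tw\<^sub>2 \<beta>\<^sub>2"
    by (rule dart_map_split[OF D(1)[unfolded S] Vs S1V S2V e1 iA(1) iB(1)])
  have finD: "finite (fst ` D)" using dart_graphD(1)[OF dart_mapD(1)[OF D(1)]] by simp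
  then have finV: "finite V\<^sub>1" "finite V\<^sub>2" unfolding Vs(1) by simp_all
  note glue = map_genus_glue[OF finV Vs(2) fxy S1V S2V e1 e2 iA(2,5) iB(5) Vs(1) R(2,4),
      of tw\<^sub>1 \<beta>\<^sub>1 tw\<^sub>2 \<beta>\<^sub>2 tw \<beta>]
  have "map_genus D\<^sub>1 ?S1 tw\<^sub>1 \<beta>\<^sub>1 + map_genus D\<^sub>2 ?S2 tw\<^sub>2 \<beta>\<^sub>2 \<le> int (euler_genus G)"
    using glue R(5) D(4) unfolding S by linarith
  moreover have "euler_genus A \<le> nat (map_genus D\<^sub>1 ?S1 tw\<^sub>1 \<beta>\<^sub>1)"
    using E(2) AV R(2) by (intro euler_genus_le map_embedsI R(1) fA) auto
  moreover have "euler_genus B \<le> nat (map_genus D\<^sub>2 ?S2 tw\<^sub>2 \<beta>\<^sub>2)"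
    using E(3) R(4) by (intro euler_genus_le map_embedsI R(3) fB) (auto simp: V\<^sub>2_def)
  ultimately show ?thesis
    using map_genus_nonneg[OF R(1)] map_genus_nonneg[OF R(3)] by linarith
qed

text \<open>An upper bound on the genus is all that is claimed, so each count is compared in one
  direction only: faces do not decrease and components do not increase.\<close>

lemma dart_map_rename:
  fixes j :: "nat \<Rightarrow> nat"
  assumes dm: "dart_map D S tw \<beta>" and j: "inj j"
  defines "D' \<equiv> map_prod j j ` D" and "S' \<equiv> map_prod j j ` S"
  obtains tw' \<beta>' where "dart_map D' S' tw' \<beta>'" "map_genus D' S' tw' \<beta>' \<le> map_genus D S tw \<beta>"
    "fst ` D' = j ` fst ` D"
proof -
  let ?J = "map_prod j j"
  define F where "F p = (?J (fst p), snd p)" for p :: "nat flag"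
  have injJ: "inj ?J" using j by (rule prod.inj_map)  (rule j)
  have injF: "inj F"
  proof (rule injI)
    fix p q assume "F p = F q"
    then have "?J (fst p) = ?J (fst q)" "snd p = snd q" by (simp_all add: F_def)
    then show "p = q" using injD[OF injJ] by (simp add: prod_eq_iff)
  qed
  have invF: "inv F (F p) = p" for p using injF by (rule inv_f_f)
  have invJ: "inv ?J (?J d) = d" for d using injJ by (rule inv_f_f)
  note dg = dart_mapD[OF dm] note gD = dart_graphD[OF dg(1)] note gd = dart_graph_dartD[OF dg(1)]
  have fstJ: "fst (?J d) = j (fst d)" "snd (?J d) = j (snd d)" "prod.swap (?J d) = ?J (prod.swap d)" for d
    by (cases d; simp)+
  have X: "flags D' = F ` flags D"
  proof
    show "flags D' \<subseteq> F ` flags D"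
    proof
      fix p assume "p \<in> flags D'"
      then obtain d where d: "d \<in> D" "fst p = ?J d" by (auto simp: D'_def mem_Times_iff)
      then have "p = F (d, snd p)" by (simp add: F_def prod_eq_iff)
      then show "p \<in> F ` flags D" using d(1) by blast
    qed
    show "F ` flags D \<subseteq> flags D'" by (auto simp: F_def D'_def)
  qed
  have vF: "vtx (F p) = j (vtx p)" for p by (simp add: F_def fstJ)
  have flipF: "flip (F p) = F (flip p)" for p by (simp add: F_def flip_def)
  define tw' where "tw' d = (\<exists>e. d = ?J e \<and> tw e)" for d
  have twJ: "tw' (?J d) = tw d" for d using injJ by (auto simp: tw'_def inj_eq)
  define \<beta>' where "\<beta>' p = F (\<beta> (inv F p))" for p
  have \<beta>F: "\<beta>' (F p) = F (\<beta> p)" for p by (simp add: \<beta>'_def invF)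
  have memS: "?J d \<in> S' \<longleftrightarrow> d \<in> S" for d unfolding S'_def using injJ by (rule inj_image_mem_iff)
  have trF: "traverse S' tw' (F p) = F (traverse S tw p)" for p
    using memS[of "fst p"] by (simp add: traverse_def F_def twJ fstJ flip_def)
  have V: "fst ` D' = j ` fst ` D" unfolding D'_def image_image by (rule image_cong) (simp_all add: fstJ)
  have finX: "finite (flags D)" "finite (flags D')" using gD(1) by (simp_all add: D'_def)
  have dgD: "dart_graph D' S' tw'"
    unfolding dart_graph_def
  proof (intro conjI ballI allI)
    show "fst d \<noteq> snd d" if "d \<in> D'" for d
    proof -
      from that obtain e where e: "d = ?J e" "e \<in> D" unfolding D'_def by (rule imageE)
      have "j (fst e) \<noteq> j (snd e)" using gd(2)[OF e(2)] j by (simp add: inj_eq)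
      then show ?thesis unfolding e(1) fstJ .
    qed
    show "prod.swap d \<in> S'" if "d \<in> S'" for d
    proof -
      from that obtain e where e: "d = ?J e" "e \<in> S" unfolding S'_def by (rule imageE)
      have "?J (prod.swap e) \<in> S'" using gd(3)[OF e(2)] memS[of "prod.swap e"] by simp
      then show ?thesis by (simp only: e(1) fstJ)
    qed
    show "tw' (prod.swap d) = tw' d" for d
    proof (cases "\<exists>e. d = ?J e")
      case True
      then obtain e where e: "d = ?J e" by blast
      show ?thesis unfolding e fstJ(3) twJ by (rule gd(1))
    next
      case False
      moreover have "\<nexists>e. prod.swap d = ?J e" using False fstJ(3) by (metis swap_swap)
      ultimately show ?thesis by (simp add: tw'_def)
    qed
  qed (use gD in \<open>auto simp: D'_def S'_def\<close>)
  have fb: "fpf (flags D') \<beta>'"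
    unfolding fpf_def X
  proof
    fix q assume "q \<in> F ` flags D"
    then obtain p where p: "p \<in> flags D" "q = F p" by blast
    show "\<beta>' q \<in> F ` flags D \<and> \<beta>' (\<beta>' q) = q \<and> \<beta>' q \<noteq> q"
      using fpfD[OF dg(2) p(1)] injF unfolding p(2) \<beta>F by (simp add: inj_eq)
  qed
  have v: "\<forall>q\<in>flags D'. vtx (\<beta>' q) = vtx q"
  proof
    fix q assume "q \<in> flags D'"
    then obtain p where p: "p \<in> flags D" "q = F p" unfolding X by blast
    show "vtx (\<beta>' q) = vtx q" using bspec[OF dg(3) p(1)] unfolding p(2) \<beta>F vF by simp
  qed
  have Fin: "F p \<in> flags D'" if "p \<in> flags D" for p using that unfolding X by blast
  have "num_verts D' \<beta>' \<le> num_verts D \<beta>"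
    unfolding num_verts_def corner_rel_dart_map[OF v] corner_rel_dart_map[OF dg(3)]
  proof (rule comps_le[where g = F])
    fix u w assume uw: "(u, w) \<in> gr (flags D) flip \<union> gr (flags D) \<beta>" "u \<in> flags D" "w \<in> flags D"
    then have "w = flip u \<or> w = \<beta> u" unfolding Un_iff gr_iff by blast
    then have "F w = flip (F u) \<or> F w = \<beta>' (F u)" unfolding flipF \<beta>F by blast
    then have "(F u, F w) \<in> gr (flags D') flip \<union> gr (flags D') \<beta>'"
      using Fin[OF uw(2)] unfolding Un_iff gr_iff by blast
    then show "(F u, F w) \<in> conn (flags D') (gr (flags D') flip \<union> gr (flags D') \<beta>')"
      using Fin[OF uw(2)] Fin[OF uw(3)] by (rule conn_base)
  next
    fix c assume c: "c \<in> flags D'"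
    then obtain p where "p \<in> flags D" "c = F p" unfolding X by blast
    then show "\<exists>a\<in>flags D. (F a, c) \<in> conn (flags D') (gr (flags D') flip \<union> gr (flags D') \<beta>')"
      using c by (intro bexI[of _ p]) (simp_all add: conn_refl)
  qed (use finX Fin in simp_all)
  moreover have cardV: "card (j ` fst ` D) = card (fst ` D)"
    using j by (intro card_image) (rule inj_on_subset, auto)
  ultimately have "num_verts D' \<beta>' = card (fst ` D')"
    using num_verts_ge[OF dart_graphD(1)[OF dgD], of \<beta>'] dg(4) V by simp
  with dgD fb v have dm': "dart_map D' S' tw' \<beta>'" unfolding dart_map_def by blast
  have "map_faces D S tw \<beta> \<le> map_faces D' S' tw' \<beta>'"
    unfolding map_faces_def
  proof (rule comps_le[where g = "inv F"])
    let ?R = "gr (flags D) (traverse S tw) \<union> gr (flags D) \<beta>"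
    show in_D: "inv F q \<in> flags D" if "q \<in> flags D'" for q
      using that invF unfolding X by auto
    fix u w assume uw: "(u, w) \<in> gr (flags D') (traverse S' tw') \<union> gr (flags D') \<beta>'" "u \<in> flags D'" "w \<in> flags D'"
    obtain p where p: "p \<in> flags D" "u = F p" using uw(2) unfolding X by blast
    have "w = traverse S' tw' u \<or> w = \<beta>' u" using uw(1) unfolding Un_iff gr_iff by blast
    then have "inv F w = traverse S tw p \<or> inv F w = \<beta> p"
      unfolding p(2) trF \<beta>F using invF by metis
    then have "(p, inv F w) \<in> ?R" using p(1) unfolding Un_iff gr_iff by blast
    then show "(inv F u, inv F w) \<in> conn (flags D) ?R"
      unfolding p(2) invF using p(1) in_D[OF uw(3)] by (rule conn_base)
  next
    fix c assume c: "c \<in> flags D"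
    then show "\<exists>a\<in>flags D'. (inv F a, c) \<in> conn (flags D) (gr (flags D) (traverse S tw) \<union> gr (flags D) \<beta>)"
      by (intro bexI[of _ "F c"] Fin) (simp_all add: invF conn_refl)
  qed (fact finX)
  moreover have "comps (j ` fst ` D) S' \<le> comps (fst ` D) S"
  proof (rule comps_le[where g = j])
    fix u w assume "(u, w) \<in> S" "u \<in> fst ` D" "w \<in> fst ` D"
    moreover from this(1) have "(j u, j w) \<in> S'" unfolding S'_def by (metis image_eqI map_prod_simp)
    ultimately show "(j u, j w) \<in> conn (j ` fst ` D) S'" by (intro conn_base) simp_all
  next
    fix c assume "c \<in> j ` fst ` D"
    then show "\<exists>a\<in>fst ` D. (j a, c) \<in> conn (j ` fst ` D) S'" by (auto intro: conn_refl)
  qed (use gD(1) in simp_all)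
  moreover have "card S' = card S"
    unfolding S'_def using injJ by (intro card_image) (rule inj_on_subset, auto)
  ultimately have "map_genus D' S' tw' \<beta>' \<le> map_genus D S tw \<beta>"
    unfolding map_genus_def V cardV by simp
  with dm' show ?thesis using V by (rule that)
qed

text \<open>The embeddings of A and B use unrelated vertex numbers and are first renamed so that
  they meet in the terminals only.\<close>

lemma euler_genus_glue_le:
  assumes A: "pair_graph A" and B: "pair_graph B"
    and V: "pverts G = pverts A \<union> pverts B" "pverts A \<inter> pverts B = {x, y}"
    and E: "parcs G = parcs A \<union> parcs B" "(x, y) \<in> parcs A" "(x, y) \<in> parcs B"
  shows "euler_genus G \<le> euler_genus A + euler_genus B"
proof -
  have ne: "parcs A \<noteq> {}" "parcs B \<noteq> {}" using E by auto
  obtain D\<^sub>1 :: "(nat \<times> nat) set" and tw\<^sub>1 \<beta>\<^sub>1 f where 1: "dart_map D\<^sub>1 (map_prod f f ` parcs A) tw\<^sub>1 \<beta>\<^sub>1"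
    "inj_on f (pverts A)" "f ` pverts A \<subseteq> fst ` D\<^sub>1" "map_genus D\<^sub>1 (map_prod f f ` parcs A) tw\<^sub>1 \<beta>\<^sub>1 \<le> int (euler_genus A)"
    using map_embeds_euler_genus[OF A ne(1)] unfolding map_embeds_def by (elim exE conjE) (rule that)
  obtain D\<^sub>2 :: "(nat \<times> nat) set" and tw\<^sub>2 \<beta>\<^sub>2 h where 2: "dart_map D\<^sub>2 (map_prod h h ` parcs B) tw\<^sub>2 \<beta>\<^sub>2"
    "inj_on h (pverts B)" "h ` pverts B \<subseteq> fst ` D\<^sub>2" "map_genus D\<^sub>2 (map_prod h h ` parcs B) tw\<^sub>2 \<beta>\<^sub>2 \<le> int (euler_genus B)"
    using map_embeds_euler_genus[OF B ne(2)] unfolding map_embeds_def by (elim exE conjE) (rule that)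
  have xy: "x \<in> pverts A" "x \<in> pverts B" "y \<in> pverts A" "y \<in> pverts B" using V(2) by auto
  have "x \<noteq> y" using pair_graphD(5)[OF A E(2)] .
  then have fxy: "f x \<noteq> f y" "h x \<noteq> h y"
    using inj_onD[OF 1(2) _ xy(1,3)] inj_onD[OF 2(2) _ xy(2,4)] by blast+
  \<comment> \<open>The terminals become 0 and 1. All other vertices become even numbers from 2 on
    for A and odd numbers from 3 on for B.\<close>
  define j\<^sub>1 where "j\<^sub>1 n = (if n = f x then 0 else if n = f y then 1 else 2 * n + 2)" for n
  define j\<^sub>2 where "j\<^sub>2 n = (if n = h x then 0 else if n = h y then 1 else 2 * n + 3)" for n
  have inj1: "inj j\<^sub>1" by (rule injI) (auto simp: j\<^sub>1_def split: if_splits)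
  have inj2: "inj j\<^sub>2" by (rule injI) (auto simp: j\<^sub>2_def split: if_splits)
  have meet: "j\<^sub>1 a \<in> {0, 1}" if "j\<^sub>1 a = j\<^sub>2 b" for a b
    using that by (auto simp: j\<^sub>1_def j\<^sub>2_def split: if_splits) presburger+
  let ?S1 = "map_prod j\<^sub>1 j\<^sub>1 ` map_prod f f ` parcs A" and ?S2 = "map_prod j\<^sub>2 j\<^sub>2 ` map_prod h h ` parcs B"
  let ?D1 = "map_prod j\<^sub>1 j\<^sub>1 ` D\<^sub>1" and ?D2 = "map_prod j\<^sub>2 j\<^sub>2 ` D\<^sub>2"
  from 1(1) inj1 obtain t1 b1 where r1: "dart_map ?D1 ?S1 t1 b1"
    "map_genus ?D1 ?S1 t1 b1 \<le> map_genus D\<^sub>1 (map_prod f f ` parcs A) tw\<^sub>1 \<beta>\<^sub>1" "fst ` ?D1 = j\<^sub>1 ` fst ` D\<^sub>1"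
    by (rule dart_map_rename)
  from 2(1) inj2 obtain t2 b2 where r2: "dart_map ?D2 ?S2 t2 b2"
    "map_genus ?D2 ?S2 t2 b2 \<le> map_genus D\<^sub>2 (map_prod h h ` parcs B) tw\<^sub>2 \<beta>\<^sub>2" "fst ` ?D2 = j\<^sub>2 ` fst ` D\<^sub>2"
    by (rule dart_map_rename)
  let ?f = "\<lambda>v. j\<^sub>1 (f v)" and ?h = "\<lambda>v. j\<^sub>2 (h v)"
  have S1: "?S1 = map_prod ?f ?f ` parcs A" and S2: "?S2 = map_prod ?h ?h ` parcs B"
    by (simp_all add: image_image map_prod_def case_prod_unfold)
  have if1: "inj_on ?f (pverts A)"
    by (rule inj_onI) (rule inj_onD[OF 1(2)], rule injD[OF inj1])
  have if2: "inj_on ?h (pverts B)"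
    by (rule inj_onI) (rule inj_onD[OF 2(2)], rule injD[OF inj2])
  have at: "?f x = 0" "?f y = 1" "?h x = 0" "?h y = 1" using fxy by (simp_all add: j\<^sub>1_def j\<^sub>2_def)
  note iA = image_arcs[OF A if1, folded S1] and iB = image_arcs[OF B if2, folded S2]
  have e1: "(0, 1) \<in> ?S1" "(0, 1) \<in> ?S2"
  proof -
    have eq: "(0, 1) = map_prod ?f ?f (x, y)" "(0, 1) = map_prod ?h ?h (x, y)" using at by simp_all
    show "(0, 1) \<in> ?S1" unfolding S1 using eq(1) E(2) by (rule image_eqI)
    show "(0, 1) \<in> ?S2" unfolding S2 using eq(2) E(3) by (rule image_eqI)
  qed
  have e2: "(1, 0) \<in> ?S1" "(1, 0) \<in> ?S2" using iA(1)[OF e1(1)] iB(1)[OF e1(2)] by simp_all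
  have AV: "?f ` pverts A \<subseteq> fst ` ?D1" and BV: "?h ` pverts B \<subseteq> fst ` ?D2"
  proof -
    have "?f ` pverts A = j\<^sub>1 ` f ` pverts A" "?h ` pverts B = j\<^sub>2 ` h ` pverts B"
      by (simp_all only: image_image)
    then show "?f ` pverts A \<subseteq> fst ` ?D1" "?h ` pverts B \<subseteq> fst ` ?D2"
      unfolding r1(3) r2(3) using image_mono[OF 1(3)] image_mono[OF 2(3)] by simp_all
  qed
  have S1V: "?S1 \<subseteq> fst ` ?D1 \<times> fst ` ?D1"
    using iA(3) Sigma_mono[OF AV AV] by (rule subset_trans)
  have S2V: "?S2 \<subseteq> fst ` ?D2 \<times> fst ` ?D2"
    using iB(3) Sigma_mono[OF BV BV] by (rule subset_trans)
  have VI: "fst ` ?D1 \<inter> fst ` ?D2 = {0, 1}"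
  proof
    show "fst ` ?D1 \<inter> fst ` ?D2 \<subseteq> {0, 1}"
      unfolding r1(3) r2(3)
    proof
      fix n assume "n \<in> j\<^sub>1 ` fst ` D\<^sub>1 \<inter> j\<^sub>2 ` fst ` D\<^sub>2"
      then obtain a b where "n = j\<^sub>1 a" "n = j\<^sub>2 b" by blast
      then show "n \<in> {0, 1}" using meet[of a b] by simp
    qed
    have "(0, 1) \<in> fst ` ?D1 \<times> fst ` ?D1" "(0, 1) \<in> fst ` ?D2 \<times> fst ` ?D2"
      using subsetD[OF S1V e1(1)] subsetD[OF S2V e1(2)] by (simp_all only:)
    then show "{0, 1} \<subseteq> fst ` ?D1 \<inter> fst ` ?D2"
      unfolding mem_Sigma_iff by blast
  qed
  have DI: "?D1 \<inter> ?D2 \<subseteq> {(0, 1), (1, 0)}"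
  proof
    fix d assume d: "d \<in> ?D1 \<inter> ?D2"
    from IntD1[OF d] obtain p where p: "d = map_prod j\<^sub>1 j\<^sub>1 p" by (rule imageE)
    from IntD2[OF d] obtain q where q: "d = map_prod j\<^sub>2 j\<^sub>2 q" by (rule imageE)
    have "fst d = j\<^sub>1 (fst p)" "snd d = j\<^sub>1 (snd p)" unfolding p by simp_all
    moreover have "fst d = j\<^sub>2 (fst q)" "snd d = j\<^sub>2 (snd q)" unfolding q by simp_all
    ultimately have "fst d \<in> {0, 1}" "snd d \<in> {0, 1}"
      using meet[of "fst p" "fst q"] meet[of "snd p" "snd q"] by simp_all
    moreover have "fst d \<noteq> snd d" using dart_graph_dartD(2)[OF dart_mapD(1)[OF r1(1)]] d by blast
    ultimately show "d \<in> {(0, 1), (1, 0)}" by (cases d) auto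
  qed
  obtain D tw \<beta> where R: "dart_map D (?S1 \<union> ?S2) tw \<beta>" "fst ` D = fst ` ?D1 \<union> fst ` ?D2"
    "map_faces ?D1 ?S1 t1 b1 + map_faces ?D2 ?S2 t2 b2 \<le> map_faces D (?S1 \<union> ?S2) tw \<beta> + 1"
    by (rule dart_map_join[OF r1(1) r2(1) VI e1 DI])
  have fin: "finite (fst ` ?D1)" "finite (fst ` ?D2)"
    using dart_graphD(1)[OF dart_mapD(1)[OF r1(1)]] dart_graphD(1)[OF dart_mapD(1)[OF r2(1)]] by simp_all
  have "map_genus D (?S1 \<union> ?S2) tw \<beta> \<le> int (euler_genus A) + int (euler_genus B)"
    using map_genus_glue[OF fin VI _ S1V S2V e1 e2 iA(2,5) iB(5) R(2) refl refl, of t1 b1 t2 b2 tw \<beta>]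
      R(3) r1(2) r2(2) 1(4) 2(4) by linarith
  moreover define k where "k v = (if v \<in> pverts A then ?f v else ?h v)" for v
  have kA: "k v = ?f v" if "v \<in> pverts A" for v using that by (simp add: k_def)
  have kB: "k v = ?h v" if "v \<in> pverts B" for v
  proof (cases "v \<in> pverts A")
    case True
    then have "v \<in> {x, y}" using that V(2) by blast
    then show ?thesis using at True by (auto simp: k_def)
  qed (simp add: k_def)
  have "map_prod k k ` parcs G = ?S1 \<union> ?S2"
  proof -
    have "map_prod k k ` parcs A = map_prod ?f ?f ` parcs A"
      by (rule image_cong) (use pair_graphD(3)[OF A] kA in auto)
    moreover have "map_prod k k ` parcs B = map_prod ?h ?h ` parcs B"
      by (rule image_cong) (use pair_graphD(3)[OF B] kB in auto)
    ultimately show ?thesis unfolding E(1) S1 S2 image_Un by simp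
  qed
  moreover have "inj_on k (pverts G)"
  proof (rule inj_onI)
    have cross: "u = w" if "u \<in> pverts A" "w \<in> pverts B" "k u = k w" for u w
    proof -
      have eq: "?f u = ?h w" using that kA kB by simp
      then consider "?h w = 0" | "?h w = 1" using meet[of "f u" "h w"] by auto
      then show ?thesis
      proof cases
        case 1
        then have "u = x" "w = x"
          using eq at inj_onD[OF if1, of u x] inj_onD[OF if2, of w x] that xy by simp_all
        then show ?thesis by simp
      next
        case 2
        then have "u = y" "w = y"
          using eq at inj_onD[OF if1, of u y] inj_onD[OF if2, of w y] that xy by simp_all
        then show ?thesis by simp
      qed
    qed
    fix u w assume "u \<in> pverts G" "w \<in> pverts G" "k u = k w"
    then show "u = w"
      using cross[of u w] cross[of w u] inj_onD[OF if1, of u w] inj_onD[OF if2, of u w] kA kB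
      unfolding V(1) by (metis UnE)
  qed
  moreover have "k ` pverts G \<subseteq> fst ` D"
  proof (rule image_subsetI)
    fix v assume "v \<in> pverts G"
    then have "v \<in> pverts A \<or> v \<in> pverts B" unfolding V(1) by blast
    then show "k v \<in> fst ` D" unfolding R(2) using kA kB AV BV by (metis UnI1 UnI2 image_subset_iff)
  qed
  moreover have "parcs G \<noteq> {}" using E by auto
  ultimately have "euler_genus G \<le> nat (map_genus D (?S1 \<union> ?S2) tw \<beta>)"
    using map_embedsI[of D k G tw \<beta>] R(1) by (intro euler_genus_le) simp_all
  then show ?thesis
    using \<open>map_genus D (?S1 \<union> ?S2) tw \<beta> \<le> int (euler_genus A) + int (euler_genus B)\<close> by linarith
qed

lemma euler_genus_glue:
  assumes "pair_graph A" "pair_graph B" "pair_graph G"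
    and "pverts G = pverts A \<union> pverts B" "pverts A \<inter> pverts B = {x, y}"
    and "parcs G = parcs A \<union> parcs B" "(x, y) \<in> parcs A" "(x, y) \<in> parcs B"
  shows "euler_genus G = euler_genus A + euler_genus B"
  using euler_genus_glue_le[OF assms(1,2,4-)] euler_genus_glue_ge[OF assms] by (rule antisym)

section \<open>Sums of terminal graphs and minor-operations\<close>

lemma pair_graph_irrefl: "pair_graph G \<Longrightarrow> (w, w) \<notin> parcs G"
  using pair_graphD(5) by metis

lemma pair_graph_add_edge:
  assumes "pair_graph G" "x \<in> pverts G" "y \<in> pverts G" "x \<noteq> y"
  shows "pair_graph (add_edge x y G)"
  by (rule pair_graphI) (use pair_graphD[OF assms(1)] pair_graph_irrefl[OF assms(1)] assms(2-) in \<open>auto simp: add_edge_def\<close>)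

text \<open>Both summands and their sum receive the edge xy, which makes this an edge amalgamation.
  The summands range over \<open>terminal_graphs\<close>, since the lemma is also applied to
  \<open>\<mu> G\<^sub>1\<close>, where xy may be present.\<close>

lemma euler_genus_plus_sum:
  assumes "G\<^sub>1 \<in> terminal_graphs x y" "G\<^sub>2 \<in> terminal_graphs x y" "is_xy_sum x y G\<^sub>1 G\<^sub>2 G"
  shows "euler_genus_plus x y G = euler_genus_plus x y G\<^sub>1 + euler_genus_plus x y G\<^sub>2"
  unfolding euler_genus_plus_def
proof (rule euler_genus_glue)
  have 1: "pair_graph G\<^sub>1" "x \<in> pverts G\<^sub>1" "y \<in> pverts G\<^sub>1" "x \<noteq> y"
    and 2: "pair_graph G\<^sub>2" "x \<in> pverts G\<^sub>2" "y \<in> pverts G\<^sub>2"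
    using assms(1,2) by (auto simp: terminal_graphs_def)
  have G: "G = \<lparr>pverts = pverts G\<^sub>1 \<union> pverts G\<^sub>2, parcs = parcs G\<^sub>1 \<union> parcs G\<^sub>2\<rparr>"
    and V: "pverts G\<^sub>1 \<inter> pverts G\<^sub>2 = {x, y}"
    using assms(3) by (auto simp: is_xy_sum_def)
  show "pair_graph (add_edge x y G\<^sub>1)" using 1 by (rule pair_graph_add_edge)
  show "pair_graph (add_edge x y G\<^sub>2)" using 2 1(4) by (rule pair_graph_add_edge)
  have "pair_graph G"
    by (rule pair_graphI) (use pair_graphD[OF 1(1)] pair_graphD[OF 2(1)] pair_graph_irrefl[OF 1(1)] pair_graph_irrefl[OF 2(1)] in \<open>auto simp: G\<close>)
  then show "pair_graph (add_edge x y G)"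
    using 1 by (intro pair_graph_add_edge) (auto simp: G)
qed (use assms(3) in \<open>auto simp: is_xy_sum_def add_edge_def\<close>)

lemma pair_graph_delete_edge: "pair_graph G \<Longrightarrow> pair_graph (delete_edge u v G)"
  by (rule pair_graphI) (use pair_graphD[of G] pair_graph_irrefl[of G] in \<open>auto simp: delete_edge_def\<close>)

lemma pair_graph_contract_edge:
  assumes "pair_graph G"
  shows "pair_graph (contract_edge u v G)"
proof (rule pair_graphI)
  show "finite (pverts (contract_edge u v G))"
    using pair_graphD(1)[OF assms] by (simp add: contract_edge_def Let_def)
  show "parcs (contract_edge u v G) \<subseteq> pverts (contract_edge u v G) \<times> pverts (contract_edge u v G)"
    using pair_graphD(3)[OF assms] by (auto simp: contract_edge_def Let_def)
  show "(b, a) \<in> parcs (contract_edge u v G)" if "(a, b) \<in> parcs (contract_edge u v G)" for a b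
    using that pair_graphD(4)[OF assms] unfolding contract_edge_def Let_def
    by (simp only: pair_pre_digraph.simps mem_Collect_eq prod.inject) metis
  show "a \<noteq> b" if "(a, b) \<in> parcs (contract_edge u v G)" for a b
    using that by (auto simp: contract_edge_def Let_def)
qed

text \<open>Contracting an edge between x and a neighbour of y creates xy, so membership in
  \<open>terminal_graphs_nonadj\<close> is not preserved. The operation leaves
  \<open>G\<^sub>2\<close> alone: a common edge could only be xy, and a vertex v that is contracted
  away is no terminal, hence outside \<open>G\<^sub>2\<close>.\<close>

lemma minor_of_sum:
  assumes "G\<^sub>1 \<in> terminal_graphs_nonadj x y" "G\<^sub>2 \<in> terminal_graphs_nonadj x y" "is_xy_sum x y G\<^sub>1 G\<^sub>2 G"
    and "\<mu> \<in> minor_operations x y G\<^sub>1"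
  shows "apply_minor \<mu> G\<^sub>1 \<in> terminal_graphs x y" "is_xy_sum x y (apply_minor \<mu> G\<^sub>1) G\<^sub>2 (apply_minor \<mu> G)"
proof -
  have 1: "pair_graph G\<^sub>1" "x \<in> pverts G\<^sub>1" "y \<in> pverts G\<^sub>1" "x \<noteq> y" "(x, y) \<notin> parcs G\<^sub>1"
    and 2: "pair_graph G\<^sub>2"
    using assms(1,2) by (auto simp: terminal_graphs_nonadj_def terminal_graphs_def)
  note g1 = pair_graphD[OF 1(1)] and g2 = pair_graphD[OF 2]
  have G: "G = \<lparr>pverts = pverts G\<^sub>1 \<union> pverts G\<^sub>2, parcs = parcs G\<^sub>1 \<union> parcs G\<^sub>2\<rparr>"
    and V: "pverts G\<^sub>1 \<inter> pverts G\<^sub>2 = {x, y}"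
    using assms(3) by (auto simp: is_xy_sum_def)
  have "(y, x) \<notin> parcs G\<^sub>1" using 1(5) g1(4) by blast
  have notin: "(a, b) \<notin> parcs G\<^sub>2" if "(a, b) \<in> parcs G\<^sub>1" for a b
  proof
    assume "(a, b) \<in> parcs G\<^sub>2"
    then have "a \<in> {x, y}" "b \<in> {x, y}" using that g1(3) g2(3) V by blast+
    then show False using that g1(5)[OF that] 1(5) \<open>(y, x) \<notin> parcs G\<^sub>1\<close> by blast
  qed
  from assms(4) consider u v where "\<mu> = Delete u v" "(u, v) \<in> parcs G\<^sub>1"
    | u v where "\<mu> = Contract u v" "(u, v) \<in> parcs G\<^sub>1" "v \<notin> {x, y}"
    unfolding minor_operations_def by blast
  then have "apply_minor \<mu> G\<^sub>1 \<in> terminal_graphs x y \<and> is_xy_sum x y (apply_minor \<mu> G\<^sub>1) G\<^sub>2 (apply_minor \<mu> G)"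
  proof cases
    case (1 u v)
    have "(u, v) \<notin> parcs G\<^sub>2" "(v, u) \<notin> parcs G\<^sub>2"
      using notin[OF 1(2)] notin[OF g1(4)[OF 1(2)]] .
    then have "parcs G\<^sub>1 \<union> parcs G\<^sub>2 - {(u, v), (v, u)} = parcs G\<^sub>1 - {(u, v), (v, u)} \<union> parcs G\<^sub>2"
      by blast
    then show ?thesis
      using \<open>pair_graph G\<^sub>1\<close> \<open>x \<in> pverts G\<^sub>1\<close> \<open>y \<in> pverts G\<^sub>1\<close> \<open>x \<noteq> y\<close> V pair_graph_delete_edge[of G\<^sub>1 u v] 1(1)
      by (simp add: terminal_graphs_def is_xy_sum_def delete_edge_def G)
  next
    case (2 u v)
    let ?r = "\<lambda>w. if w = v then u else w"
    have uv: "u \<in> pverts G\<^sub>1" "v \<in> pverts G\<^sub>1" "u \<noteq> v" using 2(2) g1(3,5) by auto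
    then have v2: "v \<notin> pverts G\<^sub>2" using V 2(3) by blast
    have r2: "?r ` pverts G\<^sub>2 = pverts G\<^sub>2" using v2 by force
    have r1: "?r ` pverts G\<^sub>1 = pverts G\<^sub>1 - {v}" using uv by force
    \<comment> \<open>The renaming of v to u is the identity on the vertices of
      \<open>G\<^sub>2\<close>.\<close>
    have arcs2: "{(?r a, ?r b) | a b. (a, b) \<in> parcs G\<^sub>2 \<and> ?r a \<noteq> ?r b} = parcs G\<^sub>2"
    proof -
      have fixed: "?r a = a" "?r b = b" "a \<noteq> b" if "(a, b) \<in> parcs G\<^sub>2" for a b
        using that v2 g2(3) g2(5)[OF that] by auto
      show ?thesis
      proof (intro equalityI subsetI)
        fix e assume "e \<in> {(?r a, ?r b) | a b. (a, b) \<in> parcs G\<^sub>2 \<and> ?r a \<noteq> ?r b}"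
        then obtain a b where e: "e = (?r a, ?r b)" "(a, b) \<in> parcs G\<^sub>2" by blast
        show "e \<in> parcs G\<^sub>2" unfolding e(1) fixed[OF e(2)] by (rule e(2))
      next
        fix e assume e: "e \<in> parcs G\<^sub>2"
        obtain a b where ab: "e = (a, b)" by (cases e)
        note e = e[unfolded ab]
        have "(a, b) = (?r a, ?r b) \<and> (a, b) \<in> parcs G\<^sub>2 \<and> ?r a \<noteq> ?r b"
          unfolding fixed[OF e] using e fixed(3)[OF e] by simp
        then show "e \<in> {(?r a, ?r b) | a b. (a, b) \<in> parcs G\<^sub>2 \<and> ?r a \<noteq> ?r b}"
          unfolding ab by blast
      qed
    qed
    have split: "{(?r a, ?r b) | a b. (a, b) \<in> parcs G\<^sub>1 \<union> parcs G\<^sub>2 \<and> ?r a \<noteq> ?r b}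
      = {(?r a, ?r b) | a b. (a, b) \<in> parcs G\<^sub>1 \<and> ?r a \<noteq> ?r b}
        \<union> {(?r a, ?r b) | a b. (a, b) \<in> parcs G\<^sub>2 \<and> ?r a \<noteq> ?r b}"
      by blast
    have c: "contract_edge u v H = \<lparr>pverts = ?r ` pverts H, parcs = {(?r a, ?r b) | a b. (a, b) \<in> parcs H \<and> ?r a \<noteq> ?r b}\<rparr>" for H
      by (simp add: contract_edge_def Let_def)
    have "contract_edge u v G = \<lparr>pverts = pverts (contract_edge u v G\<^sub>1) \<union> pverts G\<^sub>2,
        parcs = parcs (contract_edge u v G\<^sub>1) \<union> parcs G\<^sub>2\<rparr>"
      unfolding c G pair_pre_digraph.simps split arcs2 image_Un r2 ..
    moreover have p1: "pverts (contract_edge u v G\<^sub>1) = pverts G\<^sub>1 - {v}"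
      unfolding c by (simp only: pair_pre_digraph.simps r1)
    moreover have "(pverts G\<^sub>1 - {v}) \<inter> pverts G\<^sub>2 = {x, y}" using V v2 by blast
    ultimately show ?thesis
      using pair_graph_contract_edge[OF \<open>pair_graph G\<^sub>1\<close>, of u v] 2(1,3) \<open>x \<in> pverts G\<^sub>1\<close> \<open>y \<in> pverts G\<^sub>1\<close> \<open>x \<noteq> y\<close>
      unfolding terminal_graphs_def is_xy_sum_def by auto
  qed
  then show "apply_minor \<mu> G\<^sub>1 \<in> terminal_graphs x y" "is_xy_sum x y (apply_minor \<mu> G\<^sub>1) G\<^sub>2 (apply_minor \<mu> G)"
    by blast+
qed

theorem theorem4p9:
  fixes x y :: 'a and G G\<^sub>1 G\<^sub>2 :: "'a pair_pre_digraph"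
  assumes "G\<^sub>1 \<in> terminal_graphs_nonadj x y" and "G\<^sub>2 \<in> terminal_graphs_nonadj x y"
    and "Digraph_Component.connected (with_proj G\<^sub>1)"
    and "Digraph_Component.connected (with_proj G\<^sub>2)"
    and "is_xy_sum x y G\<^sub>1 G\<^sub>2 G"
  shows "euler_genus_plus_tight x y G\<^sub>1 G \<longleftrightarrow> G\<^sub>1 \<in> critical_nonadj x y"
proof -
  have T: "G\<^sub>1 \<in> terminal_graphs x y" "G\<^sub>2 \<in> terminal_graphs x y"
    using assms(1,2) by (auto simp: terminal_graphs_nonadj_def)
  have "euler_genus_plus x y (apply_minor \<mu> G) < euler_genus_plus x y G \<longleftrightarrow>
      euler_genus_plus x y (apply_minor \<mu> G\<^sub>1) < euler_genus_plus x y G\<^sub>1"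
    if "\<mu> \<in> minor_operations x y G\<^sub>1" for \<mu>
  proof -
    note \<mu> = minor_of_sum[OF assms(1,2,5) that]
    show ?thesis
      unfolding euler_genus_plus_sum[OF T assms(5)] euler_genus_plus_sum[OF \<mu>(1) T(2) \<mu>(2)] by simp
  qed
  moreover have "subgraph (with_proj G\<^sub>1) (with_proj G)"
  proof -
    have p: "pair_graph G\<^sub>1" "pair_graph G\<^sub>2"
      using T by (auto simp: terminal_graphs_def)
    have G: "G = \<lparr>pverts = pverts G\<^sub>1 \<union> pverts G\<^sub>2, parcs = parcs G\<^sub>1 \<union> parcs G\<^sub>2\<rparr>"
      using assms(5) by (simp add: is_xy_sum_def)
    have "wf_digraph (with_proj G\<^sub>1)" "wf_digraph (with_proj G)"
      unfolding wf_digraph_def with_proj_simps G pair_pre_digraph.simps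
      using pair_graphD(3)[OF p(1)] pair_graphD(3)[OF p(2)] by auto
    then show ?thesis
      unfolding subgraph_def compatible_def by (simp add: G)
  qed
  ultimately show ?thesis
    using assms(1) unfolding euler_genus_plus_tight_def critical_nonadj_def by blast
qed

end
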